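(* Let $(X,g)$ be a ($3$-dimensional) Liouville billiard table of classical type with boundary $\Gamma=\partial X$, let $\mu$ be the function on $B^*\Gamma$ given either by $\mu\equiv1$ or by $\mu(\xi)=\langle\pi^+(\xi),n_g\rangle^{-1}$, and let $K\in C(\Gamma,\mathbb R)$ be invariant with respect to the action of the group $G(X)$ on $\Gamma$. Suppose that $\mathcal R_{K,\mu}(\Lambda)=0$ for any Liouville torus $\Lambda\subset\mathcal F_b=U_1\cup U_2$. Then $K\equiv0$.
   Context: **Liouville billiard tables (dimension 3).** For $l>0$ put $\mathbb T_l=\mathbb R/l\mathbb Z$. Fix $N,\omega_1,\omega_2>0$ and let $C=\mathbb T_{\omega_1}\times\mathbb T_{\omega_2}\times[-N,N]$ with coordinates $\theta=(\theta_1,\theta_2,\theta_3)$. Consider the commuting involutions $\sigma_1(\theta)=(-\theta_1,\frac{\omega_2}{2}-\theta_2,\theta_3)$ and $\sigma_2(\theta)=(\theta_1,-\theta_2,-\theta_3)$ of $C$, let $\tilde C$ be the quotient of $C$ by the group $\mathbb Z_2\oplus\mathbb Z_2$ they generate and $\sigma:C\to\tilde C$ the projection. The set of points fixed by some nontrivial group element is $S=S_1\sqcup S_2$, $S_1=\{\theta_1\equiv0\ (\mathrm{mod}\ \frac{\omega_1}2),\ \theta_2\equiv\frac{\omega_2}4\ (\mathrm{mod}\ \frac{\omega_2}2)\}$, $S_2=\{\theta_2\equiv 0\ (\mathrm{mod}\ \frac{\omega_2}2),\ \theta_3=0\}$. Let $\varphi_1,\varphi_2:\mathbb R\to\mathbb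 R$, $\varphi_3:[-N,N]\to\mathbb R$ be $C^\infty$ functions, $\varphi_k=\varphi_k(\theta_k)$, such that: (A1) each $\varphi_k$ is even; $\varphi_1(\theta_1)\ge\varphi_2(\theta_2)\ge0\ge\varphi_3(\theta_3)$; $\varphi_k$ is $\omega_k$-periodic for $k=1,2$; $\varphi_2(\theta_2)=\varphi_2(\frac{\omega_2}2-\theta_2)$. (A2) $\nu_k:=\min\varphi_k=\max\varphi_{k+1}$ for $k=1,2$, and $\nu_1>\nu_2=0$; for $k=1,2$, $\varphi_k(\theta_k)=\nu_k$ iff $\theta_k\equiv0\ (\mathrm{mod}\ \frac{\omega_k}2)$; $\varphi_2(\theta_2)=\nu_1$ iff $\theta_2\equiv\frac{\omega_2}4\ (\mathrm{mod}\ \frac{\omega_2}2)$; $\varphi_3(\theta_3)=\nu_2$ iff $\theta_3=0$. (A3) $\varphi_k''(0)=\varphi_k''(\omega_k/2)>0$ for $k=1,2$; and for all $l\ge0$: $\varphi_1^{(2l)}(0)=\varphi_1^{(2l)}(\omega_1/2)$, $\varphi_1^{(2l)}(0)=(-1)^l\varphi_2^{(2l)}(\omega_2/4)$, $\varphi_2^{(2l)}(0)=(-1)^l\varphi_3^{(2l)}(0)$. Put $\Pi_1=(\varphi_1-\varphi_2)(\varphi_1-\varphi_3)$, $\Pi_2=(\varphi_1-\varphi_2)(\varphi_2-\varphi_3)$, $\Pi_3=(\varphi_1-\varphi_3)(\varphi_2-\varphi_3)$ and consider on $C$ the quadratic forms $\Pi_1d\theta_1^2+\Pi_2d\theta_2^2+\Pi_3d\theta_3^2$,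 $I_1=(\varphi_2+\varphi_3)\Pi_1d\theta_1^2+(\varphi_1+\varphi_3)\Pi_2d\theta_2^2+(\varphi_1+\varphi_2)\Pi_3d\theta_3^2$ and $I_2=\varphi_2\varphi_3\Pi_1d\theta_1^2+\varphi_1\varphi_3\Pi_2d\theta_2^2+\varphi_1\varphi_2\Pi_3d\theta_3^2$. There is a smooth structure on $\tilde C$ for which $\sigma$ is smooth and a local diffeomorphism off $S$ and the push-forwards $g$, $\tilde I_1$, $\tilde I_2$ of these forms are smooth, with $g$ a Riemannian metric (near $\sigma(S_1)$ charts are $(x_1^2-x_2^2,2x_1x_2,\theta_3)$ with $x_k=\theta_k-\theta_k^0$, $(\theta_1^0,\theta_2^0,\theta_3)\in S_1$; near $\sigma(S_2)$ charts are built analogously from $\theta_2-\theta_2^0,\theta_3$, keeping $\theta_1$). The resulting Riemannian manifold with boundary $(X,g)$, homeomorphic to a closed 3-ball, is a *Liouville billiard table*. It is *of classical type* if moreover (A4) $\varphi_1(\theta_1)=\varphi_1(\frac{\omega_1}2-\theta_1)$, and (A5) $\varphi_k'>0$ on $(0,\omega_k/4)$ for $k=1,2$ and $\varphi_3'<0$ on $(0,N]$. Put $\nu_0=\max\varphi_1$, $\nu_3=\varphi_3(N)<0$. **Group $G(X)$.** For classical type, the maps $\theta\mapsto(-\theta_1,\theta_2,\theta_3)$, $\theta\mapsto(\frac{\omega_1}2-\theta_1,\theta_2,\theta_3)$, $\theta\mapsto(\theta_1,-\theta_2,\theta_3)$ descend to isometries of $X$ generating a group $G(X)\cong(\mathbb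 Z/2\mathbb Z)^3$, which acts on $\Gamma$ by restriction. **Billiard data.** $n_g$ is the inward unit normal to $\Gamma$; $B^*\Gamma=\{\xi\in T^*\Gamma:\|\xi\|_g<1\}$; $\pi_\Gamma:T^*\Gamma\to\Gamma$ is the projection. For $\xi\in B^*\Gamma$ with $x=\pi_\Gamma(\xi)$, $\pi^+(\xi)\in T_x^*X$ is the covector of norm $1$ whose restriction to $T_x\Gamma$ is $\xi$ and with $\langle\pi^+(\xi),n_g\rangle>0$. Identify vectors and covectors of $X$ by $g$ and put $F_j(\xi)=\tilde I_j(\pi^+(\xi),\pi^+(\xi))$, $j=1,2$ (commuting integrals of the billiard ball map; standing assumption: the billiard ball map is defined on all of $B^*\Gamma$). **Liouville tori, Radon transform.** A *Liouville torus* is a compact connected component $\Lambda$ of a level set $\{F_1=c_1,F_2=c_2\}\subset B^*\Gamma$ such that $dF_1\wedge dF_2\ne0$ at every point of $\Lambda$; it is diffeomorphic to $\mathbb T^2$. With $\omega$ the canonical symplectic form on $B^*\Gamma$, choose a 2-form $\alpha$ near $\Lambda$ with $\omega\wedge\omega=\alpha\wedge dF_1\wedge dF_2$; the *Leray form* $\lambda=\alpha|_\Lambda$ is a well-defined volume form on $\Lambda$. The Radon transform is $\mathcal R_{K,\mu}(\Lambda)=\frac1{\lambda(\Lambda)}\int_\Lambda(\pi_\Gamma^*K)\,\mu\,\lambda$, $\lambda(\Lambda)=\int_\Lambda\lambda$. **Boundary cases.** For $\xi\in B^*\Gamma$ over $\Gamma\setminus\sigma(S_1)$ let $\kappa_1\le\kappa_2$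 be the (real) roots of $t^2-F_1(\xi)t+F_2(\xi)$. $U_1$ is the set of such $\xi$ with $\nu_3<\kappa_1<0$ and $0<\kappa_2<\nu_1$; $U_2$ is the set of such $\xi$ with $\nu_3<\kappa_1<0$ and $\nu_1<\kappa_2<\nu_0$; $\mathcal F_b=U_1\cup U_2$. *)

theory Defs
  imports "HOL-Analysis.Analysis"
begin

section \<open>The data of a Liouville billiard table\<close>

record table =
  hgt :: real
  om1 :: real
  om2 :: real
  ph1 :: "real \<Rightarrow> real"
  ph2 :: "real \<Rightarrow> real"
  ph3 :: "real \<Rightarrow> real"

text \<open>One-sided derivatives at boundary points of the set. The values of \<open>ph3\<close> outside
  \<open>{-hgt T..hgt T}\<close> never matter.\<close>

definition smooth_fun_on :: "real set \<Rightarrow> (real \<Rightarrow> real) \<Rightarrow> bool" where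
  "smooth_fun_on A f \<longleftrightarrow> (\<exists>D :: nat \<Rightarrow> real \<Rightarrow> real. (\<forall>x\<in>A. D 0 x = f x) \<and>
     (\<forall>n. \<forall>x\<in>A. (D n has_real_derivative D (Suc n) x) (at x within A)))"

definition nu0 :: "table \<Rightarrow> real" where "nu0 T = Sup (range (ph1 T))"
definition nu1 :: "table \<Rightarrow> real" where "nu1 T = Inf (range (ph1 T))"
definition nu2 :: "table \<Rightarrow> real" where "nu2 T = Inf (range (ph2 T))"
definition nu3 :: "table \<Rightarrow> real" where "nu3 T = ph3 T (hgt T)"

definition condA1 :: "table \<Rightarrow> bool" where
  "condA1 T \<longleftrightarrow>
     (\<forall>t. ph1 T (- t) = ph1 T t) \<and> (\<forall>t. ph2 T (- t) = ph2 T t) \<and>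
     (\<forall>t\<in>{- hgt T..hgt T}. ph3 T (- t) = ph3 T t) \<and>
     (\<forall>s t. ph1 T s \<ge> ph2 T t) \<and> (\<forall>t. ph2 T t \<ge> 0) \<and> (\<forall>t\<in>{- hgt T..hgt T}. ph3 T t \<le> 0) \<and>
     (\<forall>t. ph1 T (t + om1 T) = ph1 T t) \<and> (\<forall>t. ph2 T (t + om2 T) = ph2 T t) \<and>
     (\<forall>t. ph2 T t = ph2 T (om2 T / 2 - t))"

text \<open>The infima and suprema below are minima and maxima, by continuity and periodicity.\<close>

definition condA2 :: "table \<Rightarrow> bool" where
  "condA2 T \<longleftrightarrow>
     nu1 T = Sup (range (ph2 T)) \<and> nu2 T = Sup (ph3 T ` {- hgt T..hgt T}) \<and>
     nu1 T > nu2 T \<and> nu2 T = 0 \<and>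
     (\<forall>t. ph1 T t = nu1 T \<longleftrightarrow> (\<exists>m::int. t = of_int m * (om1 T / 2))) \<and>
     (\<forall>t. ph2 T t = nu2 T \<longleftrightarrow> (\<exists>m::int. t = of_int m * (om2 T / 2))) \<and>
     (\<forall>t. ph2 T t = nu1 T \<longleftrightarrow> (\<exists>m::int. t = om2 T / 4 + of_int m * (om2 T / 2))) \<and>
     (\<forall>t\<in>{- hgt T..hgt T}. ph3 T t = nu2 T \<longleftrightarrow> t = 0)"

definition condA3 :: "table \<Rightarrow> bool" where
  "condA3 T \<longleftrightarrow>
     (deriv ^^ 2) (ph1 T) 0 = (deriv ^^ 2) (ph1 T) (om1 T / 2) \<and> (deriv ^^ 2) (ph1 T) 0 > 0 \<and>
     (deriv ^^ 2) (ph2 T) 0 = (deriv ^^ 2) (ph2 T) (om2 T / 2) \<and> (deriv ^^ 2) (ph2 T) 0 > 0 \<and>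
     (\<forall>l::nat.
        (deriv ^^ (2 * l)) (ph1 T) 0 = (deriv ^^ (2 * l)) (ph1 T) (om1 T / 2) \<and>
        (deriv ^^ (2 * l)) (ph1 T) 0 = (-1) ^ l * (deriv ^^ (2 * l)) (ph2 T) (om2 T / 4) \<and>
        (deriv ^^ (2 * l)) (ph2 T) 0 = (-1) ^ l * (deriv ^^ (2 * l)) (ph3 T) 0)"

definition liouville_table :: "table \<Rightarrow> bool" where
  "liouville_table T \<longleftrightarrow>
     hgt T > 0 \<and> om1 T > 0 \<and> om2 T > 0 \<and>
     smooth_fun_on UNIV (ph1 T) \<and> smooth_fun_on UNIV (ph2 T) \<and>
     smooth_fun_on {- hgt T..hgt T} (ph3 T) \<and>
     condA1 T \<and> condA2 T \<and> condA3 T"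

definition classical_liouville_table :: "table \<Rightarrow> bool" where
  "classical_liouville_table T \<longleftrightarrow> liouville_table T \<and>
     (\<forall>t. ph1 T t = ph1 T (om1 T / 2 - t)) \<and>
     (\<forall>t. 0 < t \<and> t < om1 T / 4 \<longrightarrow> deriv (ph1 T) t > 0) \<and>
     (\<forall>t. 0 < t \<and> t < om2 T / 4 \<longrightarrow> deriv (ph2 T) t > 0) \<and>
     (\<forall>t. 0 < t \<and> t \<le> hgt T \<longrightarrow>
        (\<exists>d. (ph3 T has_real_derivative d) (at t within {- hgt T..hgt T}) \<and> d < 0))"


section \<open>The quotient X and its boundary\<close>

text \<open>Points of the cylinder are represented by their lifts to \<open>strip T\<close>, that is, by triples
  \<open>(\<theta>\<^sub>1, \<theta>\<^sub>2, \<theta>\<^sub>3)\<close> of real numbers with \<open>\<bar>\<theta>\<^sub>3\<bar> \<le> hgt T\<close>. A point of the quotient X is the set of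
  all its lifts, that is, an orbit of the group generated by the two period translations and
  by \<open>sigma1\<close> and \<open>sigma2\<close>; \<open>proj T\<close> is the projection.\<close>

type_synonym pt = "real \<times> real \<times> real"

definition strip :: "table \<Rightarrow> pt set" where
  "strip T = {(a, b, c). \<bar>c\<bar> \<le> hgt T}"

definition shift :: "table \<Rightarrow> int \<Rightarrow> int \<Rightarrow> pt \<Rightarrow> pt" where
  "shift T m n = (\<lambda>(a, b, c). (a + of_int m * om1 T, b + of_int n * om2 T, c))"

definition sigma1 :: "table \<Rightarrow> pt \<Rightarrow> pt" where
  "sigma1 T = (\<lambda>(a, b, c). (- a, om2 T / 2 - b, c))"

definition sigma2 :: "pt \<Rightarrow> pt" where
  "sigma2 = (\<lambda>(a, b, c). (a, - b, - c))"

definition proj :: "table \<Rightarrow> pt \<Rightarrow> pt set" where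
  "proj T x = {shift T m n (h x) | m n h. h \<in> {id, sigma1 T, sigma2, sigma1 T \<circ> sigma2}}"

definition X_space :: "table \<Rightarrow> pt set set" where
  "X_space T = proj T ` strip T"

definition X_top :: "table \<Rightarrow> pt set topology" where
  "X_top T = topology (\<lambda>W. W \<subseteq> X_space T \<and>
     openin (top_of_set (strip T)) {x \<in> strip T. proj T x \<in> W})"

lemma openin_X_top:
  "openin (X_top T) W \<longleftrightarrow> W \<subseteq> X_space T \<and>
     openin (top_of_set (strip T)) {x \<in> strip T. proj T x \<in> W}"
proof -
  have "istopology (\<lambda>W. W \<subseteq> X_space T \<and>
     openin (top_of_set (strip T)) {x \<in> strip T. proj T x \<in> W})"
    unfolding istopology_def
  proof (intro conjI allI impI)
    fix A B
    assume "A \<subseteq> X_space T \<and> openin (top_of_set (strip T)) {x \<in> strip T. proj T x \<in> A}"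
      and "B \<subseteq> X_space T \<and> openin (top_of_set (strip T)) {x \<in> strip T. proj T x \<in> B}"
    moreover have "{x \<in> strip T. proj T x \<in> A \<inter> B} =
        {x \<in> strip T. proj T x \<in> A} \<inter> {x \<in> strip T. proj T x \<in> B}" by auto
    ultimately show "A \<inter> B \<subseteq> X_space T"
      and "openin (top_of_set (strip T)) {x \<in> strip T. proj T x \<in> A \<inter> B}"
      by (auto simp only: intro!: openin_Int)
  next
    fix \<K>
    assume *: "\<forall>W\<in>\<K>. W \<subseteq> X_space T \<and>
      openin (top_of_set (strip T)) {x \<in> strip T. proj T x \<in> W}"
    then show "\<Union>\<K> \<subseteq> X_space T" by auto
    have "{x \<in> strip T. proj T x \<in> \<Union>\<K>} = (\<Union>W\<in>\<K>. {x \<in> strip T. proj T x \<in> W})" by auto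
    then show "openin (top_of_set (strip T)) {x \<in> strip T. proj T x \<in> \<Union>\<K>}"
      using * by (simp only:) (rule openin_Union, auto)
  qed
  then show ?thesis unfolding X_top_def by (simp add: topology_inverse')
qed

definition bdry :: "table \<Rightarrow> pt set set" where
  "bdry T = proj T ` {(a, b, c). \<bar>c\<bar> = hgt T}"

definition branch1 :: "table \<Rightarrow> pt set" where
  "branch1 T = {(a, b, c) \<in> strip T. (\<exists>m::int. a = of_int m * (om1 T / 2)) \<and>
     (\<exists>n::int. b = om2 T / 4 + of_int n * (om2 T / 2))}"

definition branch2 :: "table \<Rightarrow> pt set" where
  "branch2 T = {(a, b, c) \<in> strip T. (\<exists>n::int. b = of_int n * (om2 T / 2)) \<and> c = 0}"

definition branch :: "table \<Rightarrow> pt set" where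
  "branch T = branch1 T \<union> branch2 T"

text \<open>Taking images of orbits realizes the maps induced on X, because the three maps below
  normalize the group of deck transformations.\<close>

inductive_set GX :: "table \<Rightarrow> (pt set \<Rightarrow> pt set) set" for T where
  "id \<in> GX T"
| "h \<in> GX T \<Longrightarrow> image (\<lambda>(a, b, c). (- a, b, c)) \<circ> h \<in> GX T"
| "h \<in> GX T \<Longrightarrow> image (\<lambda>(a, b, c). (om1 T / 2 - a, b, c)) \<circ> h \<in> GX T"
| "h \<in> GX T \<Longrightarrow> image (\<lambda>(a, b, c). (a, - b, c)) \<circ> h \<in> GX T"


section \<open>Smooth structure and cotangent bundles\<close>

text \<open>Every lift \<open>c\<close> of a point of X gives local coordinates \<open>y = chart_map T c \<theta>\<close> near that
  point. The map \<open>lift T c\<close> is a right inverse of \<open>chart_map T c\<close>; the choice of the square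
  root is immaterial after projection to X, because the half-turn of the chart plane about
  \<open>c \<in> branch T\<close> is a deck transformation. \<open>pull T c \<theta> \<eta>\<close> are the components with respect to
  \<open>d\<theta>\<close> of the covector at \<open>\<theta>\<close> with components \<open>\<eta>\<close> with respect to \<open>dy\<close>, that is, the transposed
  derivative of \<open>chart_map T c\<close> at \<open>\<theta>\<close> applied to \<open>\<eta>\<close>.\<close>

fun chart_map :: "table \<Rightarrow> pt \<Rightarrow> pt \<Rightarrow> pt" where
  "chart_map T (a0, b0, c0) (a, b, c) =
     (if (a0, b0, c0) \<in> branch1 T then ((a - a0)^2 - (b - b0)^2, 2 * (a - a0) * (b - b0), c)
      else if (a0, b0, c0) \<in> branch2 T then (a, (b - b0)^2 - c^2, 2 * (b - b0) * c)
      else (a, b, c))"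

fun lift :: "table \<Rightarrow> pt \<Rightarrow> pt \<Rightarrow> pt" where
  "lift T (a0, b0, c0) (y1, y2, y3) =
     (if (a0, b0, c0) \<in> branch1 T then
        (a0 + Re (csqrt (Complex y1 y2)), b0 + Im (csqrt (Complex y1 y2)), y3)
      else if (a0, b0, c0) \<in> branch2 T then
        (y1, b0 + Re (csqrt (Complex y2 y3)), Im (csqrt (Complex y2 y3)))
      else (y1, y2, y3))"

fun pull :: "table \<Rightarrow> pt \<Rightarrow> pt \<Rightarrow> pt \<Rightarrow> pt" where
  "pull T (a0, b0, c0) (a, b, c) (e1, e2, e3) =
     (if (a0, b0, c0) \<in> branch1 T then
        (2 * (a - a0) * e1 + 2 * (b - b0) * e2, - 2 * (b - b0) * e1 + 2 * (a - a0) * e2, e3)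
      else if (a0, b0, c0) \<in> branch2 T then
        (e1, 2 * (b - b0) * e2 + 2 * c * e3, - 2 * c * e2 + 2 * (b - b0) * e3)
      else (e1, e2, e3))"

lemma chart_map_lift: "chart_map T c (lift T c y) = y"
proof -
  obtain a0 b0 c0 where c: "c = (a0, b0, c0)" by (cases c) auto
  obtain y1 y2 y3 where y: "y = (y1, y2, y3)" by (cases y) auto
  have eq: "(Re (csqrt z))^2 - (Im (csqrt z))^2 = Re z \<and> 2 * Re (csqrt z) * Im (csqrt z) = Im z"
    for z
  proof -
    have "csqrt z * csqrt z = z" by (metis power2_csqrt power2_eq_square)
    from arg_cong[OF this, of Re] arg_cong[OF this, of Im] show ?thesis
      by (simp only: times_complex.sel power2_eq_square mult.commute mult_2_right mult.assoc)
         (simp only: mult_2 distrib_left mult.commute)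
  qed
  show ?thesis
    using eq[of "Complex y1 y2"] eq[of "Complex y2 y3"] by (simp add: c y)
qed

lemma pull_is_transposed_derivative:
  "\<exists>D. (chart_map T c has_derivative D) (at x) \<and> (\<forall>e v. pull T c x e \<bullet> v = e \<bullet> D v)"
proof -
  obtain a0 b0 c0 where c: "c = (a0, b0, c0)" by (cases c) auto
  obtain a b d where x: "x = (a, b, d)" by (cases x) auto
  consider (one) "c \<in> branch1 T" | (two) "c \<notin> branch1 T" "c \<in> branch2 T"
    | (reg) "c \<notin> branch1 T" "c \<notin> branch2 T" by blast
  then show ?thesis
  proof cases
    case one
    have f: "chart_map T c = (\<lambda>p. ((fst p - a0)^2 - (fst (snd p) - b0)^2,
        2 * (fst p - a0) * (fst (snd p) - b0), snd (snd p)))"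
      using one by (auto simp: c fun_eq_iff)
    let ?D = "\<lambda>v :: pt. (2 * (a - a0) * fst v - 2 * (b - b0) * fst (snd v),
        2 * (b - b0) * fst v + 2 * (a - a0) * fst (snd v), snd (snd v))"
    have "(chart_map T c has_derivative ?D) (at x)"
      unfolding f by (auto intro!: derivative_eq_intros simp: x fun_eq_iff algebra_simps)
    moreover have "\<forall>e v. pull T c x e \<bullet> v = e \<bullet> ?D v"
      using one by (auto simp: c x algebra_simps)
    ultimately show ?thesis by blast
  next
    case two
    have f: "chart_map T c = (\<lambda>p. (fst p, (fst (snd p) - b0)^2 - (snd (snd p))^2,
        2 * (fst (snd p) - b0) * snd (snd p)))"
      using two by (auto simp: c fun_eq_iff)
    let ?D = "\<lambda>v :: pt. (fst v, 2 * (b - b0) * fst (snd v) - 2 * d * snd (snd v),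
        2 * d * fst (snd v) + 2 * (b - b0) * snd (snd v))"
    have "(chart_map T c has_derivative ?D) (at x)"
      unfolding f by (auto intro!: derivative_eq_intros simp: x fun_eq_iff algebra_simps)
    moreover have "\<forall>e v. pull T c x e \<bullet> v = e \<bullet> ?D v"
      using two by (auto simp: c x algebra_simps)
    ultimately show ?thesis by blast
  next
    case reg
    have f: "chart_map T c = (\<lambda>p. p)"
      using reg by (auto simp: c fun_eq_iff)
    show ?thesis unfolding f
      using reg by (intro exI[of _ "\<lambda>v. v"] conjI) (auto simp: c x)
  qed
qed

text \<open>A covector of X over \<open>proj T \<theta>\<close> is represented by \<open>(\<theta>, \<eta>)\<close>, where \<open>\<eta>\<close> are its components in
  the coordinates given by the lift \<open>\<theta>\<close> itself (so \<open>\<eta>\<close> are components with respect to \<open>d\<theta>\<close> when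
  \<open>\<theta> \<notin> branch T\<close>). The covector is the set of all its representatives. The signs in \<open>lsigma1\<close> and
  \<open>lsigma2\<close> come from expressing the involutions in these coordinates: for example \<open>sigma1\<close>
  changes the signs of both \<open>\<theta>\<^sub>1 - \<theta>\<^sub>1\<^sup>0\<close> and \<open>\<theta>\<^sub>2 - \<theta>\<^sub>2\<^sup>0\<close>, hence is the identity in the coordinates
  used at \<open>branch1 T\<close>.\<close>

type_synonym rep = "pt \<times> pt"

definition lshift :: "table \<Rightarrow> int \<Rightarrow> int \<Rightarrow> rep \<Rightarrow> rep" where
  "lshift T m n = (\<lambda>(x, e). (shift T m n x, e))"

definition lsigma1 :: "table \<Rightarrow> rep \<Rightarrow> rep" where
  "lsigma1 T = (\<lambda>(x, e1, e2, e3). (sigma1 T x,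
     if x \<in> branch1 T then (e1, e2, e3)
     else if x \<in> branch2 T then (- e1, e2, - e3)
     else (- e1, - e2, e3)))"

definition lsigma2 :: "table \<Rightarrow> rep \<Rightarrow> rep" where
  "lsigma2 T = (\<lambda>(x, e1, e2, e3). (sigma2 x,
     if x \<in> branch1 T then (e1, - e2, - e3)
     else if x \<in> branch2 T then (e1, e2, e3)
     else (e1, - e2, - e3)))"

definition covec :: "table \<Rightarrow> rep \<Rightarrow> rep set" where
  "covec T r = {lshift T m n (h r) | m n h.
     h \<in> {id, lsigma1 T, lsigma2 T, lsigma1 T \<circ> lsigma2 T}}"

definition TX :: "table \<Rightarrow> rep set set" where
  "TX T = {covec T (x, e) | x e. x \<in> strip T}"

definition foot :: "(pt \<times> 'e) set \<Rightarrow> pt set" where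
  "foot \<zeta> = fst ` \<zeta>"

text \<open>\<open>chart_dom T c\<close> removes from the strip the branch lines not passing through \<open>c\<close>. On it
  \<open>param T c (y, \<eta>)\<close>, the covector with coordinates \<open>y\<close>, \<open>\<eta>\<close> in the chart given by \<open>c\<close>, is a
  local diffeomorphism onto an open subset of the cotangent bundle of X.\<close>

fun axis :: "table \<Rightarrow> pt \<Rightarrow> pt set" where
  "axis T (a0, b0, c0) =
     (if (a0, b0, c0) \<in> branch1 T then {(a0, b0, z) | z. True}
      else if (a0, b0, c0) \<in> branch2 T then {(z, b0, 0) | z. True}
      else {})"

definition chart_dom :: "table \<Rightarrow> pt \<Rightarrow> pt set" where
  "chart_dom T c = strip T - (branch T - axis T c)"

definition param_dom :: "table \<Rightarrow> pt \<Rightarrow> (pt \<times> pt) set" where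
  "param_dom T c = {(y, e). lift T c y \<in> chart_dom T c}"

definition param :: "table \<Rightarrow> pt \<Rightarrow> pt \<times> pt \<Rightarrow> rep set" where
  "param T c = (\<lambda>(y, e). covec T (lift T c y,
     if lift T c y \<in> branch T then e else pull T c (lift T c y) e))"

text \<open>The cotangent bundle of the boundary consists of the restrictions of covectors of X; near
  the boundary the third coordinate of every chart is \<open>\<theta>\<^sub>3\<close>, so restriction forgets the third
  component. Each point of the boundary has lifts with \<open>\<theta>\<^sub>3 = hgt T\<close>, and the boundary charts
  are those given by such lifts.\<close>

type_synonym brep = "pt \<times> real \<times> real"

definition restr :: "rep set \<Rightarrow> brep set" where
  "restr \<zeta> = (\<lambda>(x, e1, e2, e3). (x, e1, e2)) ` \<zeta>"

definition TGamma :: "table \<Rightarrow> brep set set" where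
  "TGamma T = {restr \<zeta> | \<zeta>. \<zeta> \<in> TX T \<and> foot \<zeta> \<in> bdry T}"

type_synonym bcoord = "(real \<times> real) \<times> (real \<times> real)"

definition bcenter :: "table \<Rightarrow> pt set" where
  "bcenter T = {(a, b, c). c = hgt T}"

definition bparam_dom :: "table \<Rightarrow> pt \<Rightarrow> bcoord set" where
  "bparam_dom T c = {((y1, y2), e). lift T c (y1, y2, hgt T) \<in> chart_dom T c}"

definition bparam :: "table \<Rightarrow> pt \<Rightarrow> bcoord \<Rightarrow> brep set" where
  "bparam T c = (\<lambda>((y1, y2), (e1, e2)). restr (param T c ((y1, y2, hgt T), (e1, e2, 0))))"

definition TGamma_top :: "table \<Rightarrow> brep set topology" where
  "TGamma_top T = topology (\<lambda>W. W \<subseteq> TGamma T \<and>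
     (\<forall>c \<in> bcenter T. open {z \<in> bparam_dom T c. bparam T c z \<in> W}))"

lemma openin_TGamma_top:
  "openin (TGamma_top T) W \<longleftrightarrow> W \<subseteq> TGamma T \<and>
     (\<forall>c \<in> bcenter T. open {z \<in> bparam_dom T c. bparam T c z \<in> W})"
proof -
  let ?pre = "\<lambda>c W. {z \<in> bparam_dom T c. bparam T c z \<in> W}"
  have "istopology (\<lambda>W. W \<subseteq> TGamma T \<and> (\<forall>c \<in> bcenter T. open (?pre c W)))"
    unfolding istopology_def
  proof (intro conjI allI impI ballI)
    fix A B
    assume A: "A \<subseteq> TGamma T \<and> (\<forall>c \<in> bcenter T. open (?pre c A))"
      and B: "B \<subseteq> TGamma T \<and> (\<forall>c \<in> bcenter T. open (?pre c B))"
    show "A \<inter> B \<subseteq> TGamma T" using A by auto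
    fix c assume "c \<in> bcenter T"
    with A B have "open (?pre c A \<inter> ?pre c B)" by auto
    also have "?pre c A \<inter> ?pre c B = ?pre c (A \<inter> B)" by auto
    finally show "open (?pre c (A \<inter> B))" .
  next
    fix \<K>
    assume *: "\<forall>W\<in>\<K>. W \<subseteq> TGamma T \<and> (\<forall>c \<in> bcenter T. open (?pre c W))"
    then show "\<Union>\<K> \<subseteq> TGamma T" by auto
    fix c assume "c \<in> bcenter T"
    with * have "open (\<Union>W\<in>\<K>. ?pre c W)" by auto
    also have "(\<Union>W\<in>\<K>. ?pre c W) = ?pre c (\<Union>\<K>)" by auto
    finally show "open (?pre c (\<Union>\<K>))" .
  qed
  then show ?thesis unfolding TGamma_top_def by (simp add: topology_inverse')
qed


section \<open>The metric and the quadratic integrals\<close>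

fun Pi1 :: "table \<Rightarrow> pt \<Rightarrow> real" where
  "Pi1 T (a, b, c) = (ph1 T a - ph2 T b) * (ph1 T a - ph3 T c)"

fun Pi2 :: "table \<Rightarrow> pt \<Rightarrow> real" where
  "Pi2 T (a, b, c) = (ph1 T a - ph2 T b) * (ph2 T b - ph3 T c)"

fun Pi3 :: "table \<Rightarrow> pt \<Rightarrow> real" where
  "Pi3 T (a, b, c) = (ph1 T a - ph3 T c) * (ph2 T b - ph3 T c)"

fun gform :: "table \<Rightarrow> pt \<Rightarrow> pt \<Rightarrow> real" where
  "gform T (a, b, c) (v1, v2, v3) =
     Pi1 T (a, b, c) * v1^2 + Pi2 T (a, b, c) * v2^2 + Pi3 T (a, b, c) * v3^2"

fun Iform1 :: "table \<Rightarrow> pt \<Rightarrow> pt \<Rightarrow> real" where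
  "Iform1 T (a, b, c) (v1, v2, v3) =
     (ph2 T b + ph3 T c) * Pi1 T (a, b, c) * v1^2 +
     (ph1 T a + ph3 T c) * Pi2 T (a, b, c) * v2^2 +
     (ph1 T a + ph2 T b) * Pi3 T (a, b, c) * v3^2"

fun Iform2 :: "table \<Rightarrow> pt \<Rightarrow> pt \<Rightarrow> real" where
  "Iform2 T (a, b, c) (v1, v2, v3) =
     ph2 T b * ph3 T c * Pi1 T (a, b, c) * v1^2 +
     ph1 T a * ph3 T c * Pi2 T (a, b, c) * v2^2 +
     ph1 T a * ph2 T b * Pi3 T (a, b, c) * v3^2"

text \<open>The vector identified with a covector by the metric, off the branch set.\<close>

fun sharp :: "table \<Rightarrow> pt \<Rightarrow> pt \<Rightarrow> pt" where
  "sharp T x (p1, p2, p3) = (p1 / Pi1 T x, p2 / Pi2 T x, p3 / Pi3 T x)"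

text \<open>Value on a representative of a covector of the push-forward of the quadratic form \<open>Q\<close>. Over
  the branch set, the push-forward is the continuous extension in the chart: the limit of its
  values on covectors with the same chart components at nearby regular points.\<close>

definition on_rep :: "table \<Rightarrow> (pt \<Rightarrow> pt \<Rightarrow> real) \<Rightarrow> rep \<Rightarrow> real" where
  "on_rep T Q = (\<lambda>(x, e).
     if x \<in> branch T then
       Lim (at x within (strip T - branch T)) (\<lambda>x'. Q x' (sharp T x' (pull T x x' e)))
     else Q x (sharp T x e))"

text \<open>All functions to which \<open>the_elem\<close> is applied below are constant on the set of
  representatives.\<close>

definition on_cov :: "table \<Rightarrow> (pt \<Rightarrow> pt \<Rightarrow> real) \<Rightarrow> rep set \<Rightarrow> real" where
  "on_cov T Q \<zeta> = the_elem (on_rep T Q ` \<zeta>)"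

text \<open>Squared norm for the metric induced on the boundary; \<open>\<theta>\<^sub>3\<close> is orthogonal to the other two
  coordinates.\<close>

definition bnorm2 :: "table \<Rightarrow> brep set \<Rightarrow> real" where
  "bnorm2 T \<xi> = the_elem ((\<lambda>(x, e1, e2). on_rep T (gform T) (x, e1, e2, 0)) ` \<xi>)"

definition BGamma :: "table \<Rightarrow> brep set set" where
  "BGamma T = {\<xi> \<in> TGamma T. bnorm2 T \<xi> < 1}"

text \<open>Inward unit normal at a boundary point, in the chart given by the lift \<open>x\<close>. The formula is
  also valid for \<open>x \<in> branch1 T\<close>, since \<open>\<theta>\<^sub>3\<close> is a chart coordinate orthogonal to the other two and
  \<open>Pi3\<close> does not vanish there.\<close>

definition inward_normal :: "table \<Rightarrow> pt \<Rightarrow> pt" where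
  "inward_normal T x = (0, 0, - sgn (snd (snd x)) / sqrt (Pi3 T x))"

definition normal_pairing :: "table \<Rightarrow> rep set \<Rightarrow> real" where
  "normal_pairing T \<zeta> = the_elem ((\<lambda>(x, e). e \<bullet> inward_normal T x) ` \<zeta>)"

definition pi_plus :: "table \<Rightarrow> brep set \<Rightarrow> rep set" where
  "pi_plus T \<xi> = (THE \<zeta>. \<zeta> \<in> TX T \<and> restr \<zeta> = \<xi> \<and> on_cov T (gform T) \<zeta> = 1 \<and>
     normal_pairing T \<zeta> > 0)"

definition F1 :: "table \<Rightarrow> brep set \<Rightarrow> real" where
  "F1 T \<xi> = on_cov T (Iform1 T) (pi_plus T \<xi>)"

definition F2 :: "table \<Rightarrow> brep set \<Rightarrow> real" where
  "F2 T \<xi> = on_cov T (Iform2 T) (pi_plus T \<xi>)"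


section \<open>The billiard ball map\<close>

text \<open>\<open>\<zeta>\<close> solves at time \<open>t\<close>, in the chart given by \<open>c\<close>, Hamilton's equations of half the squared
  norm. On unit covectors this is the unit speed geodesic flow.\<close>

definition geodesic_at :: "table \<Rightarrow> pt \<Rightarrow> (real \<Rightarrow> pt \<times> pt) \<Rightarrow> real \<Rightarrow> bool" where
  "geodesic_at T c \<zeta> t \<longleftrightarrow> (\<exists>v w DH.
     (\<zeta> has_vector_derivative (v, w)) (at t) \<and>
     ((\<lambda>z. on_cov T (gform T) (param T c z) / 2) has_derivative DH) (at (\<zeta> t)) \<and>
     (\<forall>u k. DH (u, k) = v \<bullet> k - w \<bullet> u))"

text \<open>The geodesic issued from \<open>pi_plus T \<xi>\<close> stays in the interior until it hits the boundary
  transversally, at time \<open>\<tau>\<close>.\<close>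

definition billiard_defined_at :: "table \<Rightarrow> brep set \<Rightarrow> bool" where
  "billiard_defined_at T \<xi> \<longleftrightarrow> (\<exists>\<tau>>0. \<exists>Z :: real \<Rightarrow> rep set.
     Z 0 = pi_plus T \<xi> \<and>
     (\<forall>t. 0 < t \<and> t < \<tau> \<longrightarrow> foot (Z t) \<in> X_space T - bdry T) \<and>
     restr (Z \<tau>) \<in> BGamma T \<and>
     (\<forall>t\<in>{0..\<tau>}. \<exists>c\<in>strip T. \<exists>\<epsilon>>0. \<exists>\<zeta>.
        continuous_on ({0..\<tau>} \<inter> ball t \<epsilon>) \<zeta> \<and>
        (\<forall>s \<in> {0..\<tau>} \<inter> ball t \<epsilon>. \<zeta> s \<in> param_dom T c \<and> param T c (\<zeta> s) = Z s \<and>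
           (0 < s \<and> s < \<tau> \<longrightarrow> geodesic_at T c \<zeta> s))))"

definition billiard_map_defined :: "table \<Rightarrow> bool" where
  "billiard_map_defined T \<longleftrightarrow> (\<forall>\<xi>\<in>BGamma T. billiard_defined_at T \<xi>)"


section \<open>Liouville tori and the Radon transform\<close>

definition wedge11 :: "('a \<Rightarrow> real) \<Rightarrow> ('a \<Rightarrow> real) \<Rightarrow> 'a \<Rightarrow> 'a \<Rightarrow> real" where
  "wedge11 D E u v = D u * E v - D v * E u"

definition wedge22 :: "('a \<Rightarrow> 'a \<Rightarrow> real) \<Rightarrow> ('a \<Rightarrow> 'a \<Rightarrow> real) \<Rightarrow> 'a \<Rightarrow> 'a \<Rightarrow> 'a \<Rightarrow> 'a \<Rightarrow> real" where
  "wedge22 \<alpha> \<beta> u v w z =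
     \<alpha> u v * \<beta> w z - \<alpha> u w * \<beta> v z + \<alpha> u z * \<beta> v w +
     \<alpha> v w * \<beta> u z - \<alpha> v z * \<beta> u w + \<alpha> w z * \<beta> u v"

definition two_form :: "('a::real_vector \<Rightarrow> 'a \<Rightarrow> real) \<Rightarrow> bool" where
  "two_form \<alpha> \<longleftrightarrow> bilinear \<alpha> \<and> (\<forall>u. \<alpha> u u = 0)"

definition symp :: "bcoord \<Rightarrow> bcoord \<Rightarrow> real" where
  "symp = (\<lambda>(u, k) (v, l). k \<bullet> v - l \<bullet> u)"

definition dF :: "table \<Rightarrow> pt \<Rightarrow> bcoord \<Rightarrow> (bcoord \<Rightarrow> real) \<Rightarrow> (bcoord \<Rightarrow> real) \<Rightarrow> bool" where
  "dF T c z D1 D2 \<longleftrightarrow>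
     ((\<lambda>z. F1 T (bparam T c z)) has_derivative D1) (at z) \<and>
     ((\<lambda>z. F2 T (bparam T c z)) has_derivative D2) (at z)"

definition independent_at :: "table \<Rightarrow> brep set \<Rightarrow> bool" where
  "independent_at T \<xi> \<longleftrightarrow> (\<exists>c\<in>bcenter T. \<exists>z\<in>bparam_dom T c. \<exists>D1 D2.
     bparam T c z = \<xi> \<and> dF T c z D1 D2 \<and> (\<exists>u v. wedge11 D1 D2 u v \<noteq> 0))"

definition liouville_torus :: "table \<Rightarrow> brep set set \<Rightarrow> bool" where
  "liouville_torus T \<Lambda> \<longleftrightarrow>
     (\<exists>c1 c2. \<Lambda> \<in> connected_components_of
        (subtopology (TGamma_top T) {\<xi> \<in> BGamma T. F1 T \<xi> = c1 \<and> F2 T \<xi> = c2})) \<and>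
     compactin (TGamma_top T) \<Lambda> \<and> (\<forall>\<xi>\<in>\<Lambda>. independent_at T \<xi>)"

text \<open>\<open>\<Psi>\<close> is a \<open>C\<^sup>1\<close> diffeomorphism from the standard 2-torus onto \<open>\<Lambda>\<close>, written as a doubly
  periodic map and given locally in charts by \<open>\<psi>\<close>, and \<open>\<delta>\<close> is the density of the pull-back by \<open>\<Psi>\<close>
  of the Leray form; \<open>\<alpha>\<close> is as in the definition of the Leray form.\<close>

definition torus_param ::
  "table \<Rightarrow> brep set set \<Rightarrow> (real \<times> real \<Rightarrow> brep set) \<Rightarrow> (real \<times> real \<Rightarrow> real) \<Rightarrow> bool" where
  "torus_param T \<Lambda> \<Psi> \<delta> \<longleftrightarrow>
     range \<Psi> = \<Lambda> \<and>
     (\<forall>s t. \<Psi> s = \<Psi> t \<longleftrightarrow> fst s - fst t \<in> \<int> \<and> snd s - snd t \<in> \<int>) \<and>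
     (\<forall>s0. \<exists>c\<in>bcenter T. \<exists>U \<psi> \<psi>'. open U \<and> s0 \<in> U \<and>
        continuous_on U (\<lambda>s. \<psi>' s (1, 0)) \<and> continuous_on U (\<lambda>s. \<psi>' s (0, 1)) \<and>
        (\<forall>s\<in>U. \<psi> s \<in> bparam_dom T c \<and> bparam T c (\<psi> s) = \<Psi> s \<and>
           (\<psi> has_derivative \<psi>' s) (at s) \<and> inj (\<psi>' s) \<and>
           (\<exists>D1 D2 \<alpha>. dF T c (\<psi> s) D1 D2 \<and> two_form \<alpha> \<and>
              wedge22 \<alpha> (wedge11 D1 D2) = wedge22 symp symp \<and>
              \<delta> s = \<alpha> (\<psi>' s (1, 0)) (\<psi>' s (0, 1)))))"

text \<open>\<open>r\<close> is the value of the Radon transform at \<open>\<Lambda>\<close>. By change of variables, it does not depend on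
  the parametrization of \<open>\<Lambda>\<close>.\<close>

definition has_radon_transform ::
  "table \<Rightarrow> (pt set \<Rightarrow> real) \<Rightarrow> (brep set \<Rightarrow> real) \<Rightarrow> brep set set \<Rightarrow> real \<Rightarrow> bool" where
  "has_radon_transform T K \<mu> \<Lambda> r \<longleftrightarrow> (\<exists>\<Psi> \<delta>. torus_param T \<Lambda> \<Psi> \<delta> \<and>
     r = 1 / integral (cbox (0, 0) (1, 1)) \<delta> *
         integral (cbox (0, 0) (1, 1)) (\<lambda>s. K (foot (\<Psi> s)) * \<mu> (\<Psi> s) * \<delta> s))"

definition roots_at :: "table \<Rightarrow> brep set \<Rightarrow> real \<Rightarrow> real \<Rightarrow> bool" where
  "roots_at T \<xi> \<kappa>1 \<kappa>2 \<longleftrightarrow> \<kappa>1 \<le> \<kappa>2 \<and>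
     (\<forall>t. t^2 - F1 T \<xi> * t + F2 T \<xi> = (t - \<kappa>1) * (t - \<kappa>2))"

definition U1 :: "table \<Rightarrow> brep set set" where
  "U1 T = {\<xi> \<in> BGamma T. foot \<xi> \<notin> proj T ` branch1 T \<and>
     (\<exists>\<kappa>1 \<kappa>2. roots_at T \<xi> \<kappa>1 \<kappa>2 \<and> nu3 T < \<kappa>1 \<and> \<kappa>1 < 0 \<and> 0 < \<kappa>2 \<and> \<kappa>2 < nu1 T)}"

definition U2 :: "table \<Rightarrow> brep set set" where
  "U2 T = {\<xi> \<in> BGamma T. foot \<xi> \<notin> proj T ` branch1 T \<and>
     (\<exists>\<kappa>1 \<kappa>2. roots_at T \<xi> \<kappa>1 \<kappa>2 \<and> nu3 T < \<kappa>1 \<and> \<kappa>1 < 0 \<and> nu1 T < \<kappa>2 \<and> \<kappa>2 < nu0 T)}"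

end

theory Submission
  imports Defs
begin

text \<open>On the level \<open>F\<^sub>1 = \<kappa>\<^sub>1 + \<kappa>\<^sub>2\<close>, \<open>F\<^sub>2 = \<kappa>\<^sub>1 \<kappa>\<^sub>2\<close> the variables separate:
  \<open>p\<^sub>1\<^sup>2 = (\<phi>\<^sub>1 - \<kappa>\<^sub>1) (\<phi>\<^sub>1 - \<kappa>\<^sub>2)\<close> and \<open>p\<^sub>2\<^sup>2 = (\<phi>\<^sub>2 - \<kappa>\<^sub>1) (\<kappa>\<^sub>2 - \<phi>\<^sub>2)\<close>, and the Leray form is a multiple of
  \<open>(\<phi>\<^sub>1 - \<phi>\<^sub>2) d\<theta>\<^sub>1 d\<theta>\<^sub>2 / (p\<^sub>1 p\<^sub>2)\<close>. Hence the vanishing of the Radon transform on the tori of both families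
  says that, for \<open>\<nu>\<^sub>3 < \<kappa>\<^sub>1 < 0 < \<kappa>\<^sub>2 < \<nu>\<^sub>0\<close>, \<open>\<kappa>\<^sub>2 \<noteq> \<nu>\<^sub>1\<close>, the function \<open>F = K w (\<phi>\<^sub>1 - \<phi>\<^sub>2)\<close>, where \<open>w > 0\<close>
  comes from \<open>\<mu>\<close>, integrates to zero over \<open>{\<phi>\<^sub>2 < \<kappa>\<^sub>2 < \<phi>\<^sub>1}\<close> against \<open>1 / (p\<^sub>1 p\<^sub>2)\<close>.
  Integrating this against \<open>d\<kappa>\<^sub>2 / (\<kappa>\<^sub>2 - \<tau>)\<close> gives
  \<open>\<integral> F / (sqrt ((\<phi>\<^sub>1 - \<kappa>\<^sub>1) (\<phi>\<^sub>2 - \<kappa>\<^sub>1)) sqrt ((\<phi>\<^sub>1 - \<tau>) (\<phi>\<^sub>2 - \<tau>))) = 0\<close> for all \<open>\<tau> < 0\<close>. Expanding in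
  \<open>\<kappa>\<^sub>1\<close> and \<open>\<tau>\<close> near a common point \<open>\<kappa>\<^sub>0\<close>, with \<open>u = 1 / (\<phi>\<^sub>1 - \<kappa>\<^sub>0)\<close> and \<open>v = 1 / (\<phi>\<^sub>2 - \<kappa>\<^sub>0)\<close>, one finds
  \<open>\<integral> F u v P\<^sub>n(u, v) P\<^sub>m(u, v) = 0\<close>, where \<open>P\<^sub>n\<close> are homogenized Legendre polynomials. Their three term
  recurrence shows that the span of the products \<open>P\<^sub>n P\<^sub>m\<close> is stable under multiplication by \<open>u + v\<close> and
  \<open>u v\<close>. These two functions separate the points of a fundamental domain, so \<open>F = 0\<close> by the
  Stone-Weierstrass theorem.\<close>

section \<open>A moment problem\<close>

text \<open>The weight 1 / (k - \<tau>) is chosen because the integral of 1 / ((k - \<tau>) sqrt ((u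
  - k) (k - v))) over v < k < u is elementary, namely pi / sqrt ((u - \<tau>) (v - \<tau>)). For a
  given point the kernel lives on the interval between the values of \<phi>2 and \<phi>1. That
  interval contains \<open>nu1 T\<close>, so neither family of tori alone covers it, while the
  single missing value \<open>nu1 T\<close> is a null set. The first square root comes from the
  torus parameter \<kappa>1, which only ranges over \<open>nu3 T\<close> < \<kappa>1 < 0, the second
  one from the free \<tau> < 0. Both can be moved in a disc around the midpoint of
  ]\<open>nu3 T\<close>, 0[, and this suffices because the dependence on them is analytic. The
  expansion yields only the products of two Legendre polynomials, not visibly all symmetric
  polynomials. Therefore the vanishing conditions themselves are shown to pass from F to F (u + v)
  and F u v. The factor \<phi>1 - \<phi>2 in F comes from the Leray form. It removes the degenerate
  kernels at \<phi>1 = \<phi>2, and in return F = 0 says nothing about K there; continuity of K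
  closes this gap.\<close>

definition isqrt_coeff :: "nat \<Rightarrow> real" where
  "isqrt_coeff n = (-1) ^ n * ((- 1 / 2) gchoose n)"

text \<open>This is the coefficient of s^n in ((1 - s u) (1 - s v))^(-1/2). For u, v > 0 it equals
  (u v)^(n/2) L_n ((u + v) / (2 sqrt (u v))) with the Legendre polynomial L_n. The number
  \<open>isqrt_coeff n\<close> is the central binomial coefficient of 2n divided by 4^n.\<close>

definition legP :: "real \<Rightarrow> real \<Rightarrow> nat \<Rightarrow> real" where
  "legP u v n = (\<Sum>i\<le>n. (isqrt_coeff i * u ^ i) * (isqrt_coeff (n - i) * v ^ (n - i)))"

lemma isqrt_coeff_Suc: "real (Suc n) * isqrt_coeff (Suc n) = (real n + 1 / 2) * isqrt_coeff n"
proof -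
  have "real (Suc n) * ((-1/2) gchoose Suc n) = - (real n + 1 / 2) * ((-1/2 :: real) gchoose n)"
    using gbinomial_mult_1[of "-1/2 :: real" n] by (simp add: algebra_simps)
  then have "(-1) ^ Suc n * (real (Suc n) * ((-1/2) gchoose Suc n))
      = (-1) ^ Suc n * (- (real n + 1 / 2) * ((-1/2 :: real) gchoose n))" by (simp only:)
  then show ?thesis by (simp add: isqrt_coeff_def algebra_simps del: of_nat_Suc)
qed

text \<open>Nonnegativity gives absolute convergence of the series for free and makes
  \<open>legP M M n\<close> a majorant.\<close>

lemma isqrt_coeff_nonneg: "isqrt_coeff n \<ge> 0"
proof (induction n)
  case (Suc n)
  have "isqrt_coeff (Suc n) = (real n + 1 / 2) * isqrt_coeff n / real (Suc n)"
    using isqrt_coeff_Suc[of n] by (simp add: field_simps del: of_nat_Suc)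
  then show ?case using Suc by simp
qed (simp add: isqrt_coeff_def)

lemma isqrt_coeff_sums:
  assumes "\<bar>x\<bar> < 1"
  shows "(\<lambda>n. isqrt_coeff n * x ^ n) sums (1 / sqrt (1 - x))"
proof -
  have "(\<lambda>n. ((-1/2) gchoose n) * (- x) ^ n) sums (1 + - x) powr (-1/2)"
    using assms by (intro gen_binomial_real) auto
  moreover have "((-1/2) gchoose n) * (- x) ^ n = isqrt_coeff n * x ^ n" for n
    by (simp add: isqrt_coeff_def power_minus[of x])
  moreover have "(1 + - x) powr (-1/2) = 1 / sqrt (1 - x)"
    using assms powr_minus[of "1 - x" "1/2"] powr_half_sqrt[of "1 - x"]
    by (simp add: inverse_eq_divide)
  ultimately show ?thesis by simp
qed

lemma legP_sums:
  assumes "\<bar>s * u\<bar> < 1" "\<bar>s * v\<bar> < 1"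
  shows "(\<lambda>n. legP u v n * s ^ n) sums (1 / sqrt ((1 - s * u) * (1 - s * v)))"
proof -
  have summ: "summable (\<lambda>n. norm (isqrt_coeff n * x ^ n))" if "\<bar>x\<bar> < 1" for x
    using isqrt_coeff_sums[of "\<bar>x\<bar>"] that isqrt_coeff_nonneg
    by (auto simp: abs_mult power_abs sums_iff)
  have eq: "(\<Sum>i\<le>n. isqrt_coeff i * (s * u) ^ i * (isqrt_coeff (n - i) * (s * v) ^ (n - i)))
      = legP u v n * s ^ n" for n
    unfolding legP_def sum_distrib_right
  proof (rule sum.cong[OF refl])
    fix i assume "i \<in> {..n}"
    then have "s ^ n = s ^ i * s ^ (n - i)" by (simp flip: power_add)
    then show "isqrt_coeff i * (s * u) ^ i * (isqrt_coeff (n - i) * (s * v) ^ (n - i))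
       = isqrt_coeff i * u ^ i * (isqrt_coeff (n - i) * v ^ (n - i)) * s ^ n"
      by (simp add: power_mult_distrib)
  qed
  show ?thesis
    using Cauchy_product_sums[OF summ[OF assms(1)] summ[OF assms(2)]]
      isqrt_coeff_sums[OF assms(1)] isqrt_coeff_sums[OF assms(2)]
    by (simp add: eq sums_iff real_sqrt_mult)
qed

lemma legP_abs_le:
  assumes "\<bar>u\<bar> \<le> M" "\<bar>v\<bar> \<le> M"
  shows "\<bar>legP u v n\<bar> \<le> legP M M n"
proof -
  have "\<bar>isqrt_coeff i * u ^ i * (isqrt_coeff (n - i) * v ^ (n - i))\<bar>
      \<le> isqrt_coeff i * M ^ i * (isqrt_coeff (n - i) * M ^ (n - i))" for i
    using assms isqrt_coeff_nonneg
    by (auto simp: abs_mult power_abs intro!: mult_mono power_mono mult_nonneg_nonneg)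
  then show ?thesis unfolding legP_def
    by (intro order.trans[OF sum_abs sum_mono])
qed

lemma legP_0 [simp]: "legP u v 0 = 1"
  by (simp add: legP_def isqrt_coeff_def)

text \<open>Comparing coefficients in \<open>(1 - u X) (1 - v X) G' = ((u + v) / 2 - u v X) G\<close> for
  \<open>G = ((1 - u X) (1 - v X)) powr (- 1 / 2)\<close>.\<close>

lemma legP_rec:
  "real (Suc n) * legP u v (Suc n) =
     (real n + 1 / 2) * (u + v) * legP u v n - real n * (u * v) * legP u v (n - 1)"
proof -
  define A where "A w = Abs_fps (\<lambda>n. isqrt_coeff n * w ^ n)" for w
  \<comment> \<open>\<open>A w\<close> is the formal series of (1 - w X)^(-1/2); its differential
    equation is \<open>isqrt_coeff_Suc\<close> read off coefficientwise.\<close>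
  have dA: "(1 - fps_const w * fps_X) * fps_deriv (A w) = fps_const (w / 2) * A w" for w
  proof (rule fps_ext)
    fix n
    show "fps_nth ((1 - fps_const w * fps_X) * fps_deriv (A w)) n = fps_nth (fps_const (w / 2) * A w) n"
    proof (cases n)
      case 0
      then show ?thesis using isqrt_coeff_Suc[of 0]
        by (simp add: A_def left_diff_distrib mult.assoc)
    next
      case (Suc m)
      have "real (n + 1) * (isqrt_coeff (n + 1) * w ^ (n + 1)) - w * (real n * (isqrt_coeff n * w ^ n))
        = w ^ (n + 1) * (real (Suc n) * isqrt_coeff (Suc n) - real n * isqrt_coeff n)"
        by (simp add: algebra_simps)
      also have "\<dots> = w / 2 * (isqrt_coeff n * w ^ n)"
        unfolding isqrt_coeff_Suc by (simp add: algebra_simps)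
      finally show ?thesis using Suc
        by (simp add: A_def left_diff_distrib mult.assoc)
    qed
  qed
  define G where "G = A u * A v"
  have G: "fps_nth G n = legP u v n" for n
    by (simp add: G_def A_def fps_mult_nth legP_def atLeast0AtMost)
  have ring: "(a * b) * (p * q' + p' * q) = (b * q) * (a * p') + (a * p) * (b * q')"
    for a b p p' q q' :: "real fps" by (simp add: algebra_simps)
  have ring': "(b * q) * (c * p) + (a * p) * (d * q) = c * b * (p * q) + d * a * (p * q)"
    for a b c d p q :: "real fps" by (simp add: algebra_simps)
  have eq: "(1 - fps_const u * fps_X) * (1 - fps_const v * fps_X) * fps_deriv G
      = fps_const (u / 2) * (1 - fps_const v * fps_X) * G
      + fps_const (v / 2) * (1 - fps_const u * fps_X) * G"
    unfolding G_def fps_deriv_mult ring dA by (rule ring')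
  have e1: "(1 - a * X) * (1 - b * X) * D = D - (a + b) * (X * D) + (a * b) * (X * (X * D))"
    for a b X D :: "real fps" by (simp add: algebra_simps)
  have e2: "c * (1 - b * X) * D + d * (1 - a * X) * D = (c + d) * D - (c * b + d * a) * (X * D)"
    for a b c d X D :: "real fps" by (simp add: algebra_simps)
  note * = arg_cong[OF eq[unfolded e1 e2], of "\<lambda>f. fps_nth f n", unfolded fps_const_add fps_const_mult]
  \<comment> \<open>The equation contains X D and X (X D), so the coefficients of index n - 1 and n
    - 2 occur; the cases n = 0 and n = 1 avoid truncated subtraction.\<close>
  show ?thesis
  proof (cases n)
    case 0
    then show ?thesis using * by (simp add: G algebra_simps)
  next
    case (Suc m)
    note [simp] = Suc
    show ?thesis
    proof (cases m)
      case 0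
      then show ?thesis using * by (simp add: G algebra_simps)
    next
      case (Suc k)
      then show ?thesis using * by (simp add: G algebra_simps)
    qed
  qed
qed

lemma continuous_on_legP [continuous_intros]:
  "continuous_on S u \<Longrightarrow> continuous_on S v \<Longrightarrow> continuous_on S (\<lambda>x. legP (u x) (v x) n)"
  unfolding legP_def by (intro continuous_intros)

text \<open>If m is the first index with a nonzero coefficient, division by s^m leaves a power
  series that tends to this coefficient at 0 but vanishes for all small s other than 0.\<close>

lemma powser_eq_0:
  fixes a :: "nat \<Rightarrow> real"
  assumes "\<eta> > 0" and "\<And>s. \<bar>s\<bar> < \<eta> \<Longrightarrow> (\<lambda>n. a n * s ^ n) sums 0"
  shows "a n = 0"
proof (rule ccontr)
  assume "a n \<noteq> 0"
  define m where "m = (LEAST n. a n \<noteq> 0)"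
  have m: "a m \<noteq> 0" and less: "\<And>i. i < m \<Longrightarrow> a i = 0"
    unfolding m_def using LeastI[of "\<lambda>n. a n \<noteq> 0" n] \<open>a n \<noteq> 0\<close>
    by (auto dest: not_less_Least)
  define b where "b i = a (i + m)" for i
  have sums: "(\<lambda>i. b i * s ^ i) sums 0" if "\<bar>s\<bar> < \<eta>" "s \<noteq> 0" for s
  proof -
    have "(\<lambda>i. a (i + m) * s ^ (i + m)) sums 0"
      using sums_iff_shift[of "\<lambda>n. a n * s ^ n" m 0] assms(2)[OF that(1)] less
      by simp
    then have "(\<lambda>i. a (i + m) * s ^ (i + m) * (1 / s ^ m)) sums 0"
      using sums_mult2[of _ 0 "1 / s ^ m"] by fastforce
    then show ?thesis using that by (simp add: b_def power_add)
  qed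
  have "b 0 \<noteq> 0" using m by (simp add: b_def)
  have summ: "summable (\<lambda>i. b i * x ^ i)" if "norm x < \<eta>" for x
  proof (cases "x = 0")
    case False
    then show ?thesis using sums[of x] that by (auto simp: sums_iff)
  qed (use powser_sums_zero[of b] in \<open>auto simp: sums_iff\<close>)
  have "((\<lambda>x. \<Sum>i. b i * x ^ i) \<longlongrightarrow> b 0) (at 0)"
    by (rule powser_limit_0[OF assms(1)]) (use summ summable_sums in auto)
  moreover have "eventually (\<lambda>x. (\<Sum>i. b i * x ^ i) = 0) (at 0)"
    unfolding eventually_at using assms(1) sums by (intro exI[of _ \<eta>]) (auto simp: sums_iff dist_real_def)
  ultimately have "((\<lambda>x. 0) \<longlongrightarrow> b 0) (at (0::real))"
    by (subst (asm) tendsto_cong) auto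
  then show False using \<open>b 0 \<noteq> 0\<close> by (simp add: tendsto_const_iff)
qed

text \<open>The integrand is expanded in powers of s. The majorant \<open>legP M M n\<close> makes
  the series converge uniformly on the box, so it may be integrated term by term, and the resulting
  power series in s is identically zero.\<close>

lemma integral_legP_eq_0:
  fixes F u v :: "'a::euclidean_space \<Rightarrow> real"
  assumes F: "continuous_on (cbox a b) F" and u: "continuous_on (cbox a b) u"
    and v: "continuous_on (cbox a b) v" and "\<eta> > 0"
    and 0: "\<And>s. \<bar>s\<bar> < \<eta> \<Longrightarrow>
      integral (cbox a b) (\<lambda>x. F x / sqrt ((1 - s * u x) * (1 - s * v x))) = 0"
  shows "integral (cbox a b) (\<lambda>x. F x * legP (u x) (v x) n) = 0"
proof -
  have bdd: "\<exists>B>0. \<forall>x\<in>cbox a b. \<bar>f x\<bar> \<le> B" if "continuous_on (cbox a b) f" for f :: "'a \<Rightarrow> real"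
    using compact_imp_bounded[OF compact_continuous_image[OF that compact_cbox]]
    by (auto simp: bounded_pos)
  obtain Mu Mv B where M: "Mu > 0" "Mv > 0" "B > 0" "\<And>x. x \<in> cbox a b \<Longrightarrow> \<bar>u x\<bar> \<le> Mu"
      "\<And>x. x \<in> cbox a b \<Longrightarrow> \<bar>v x\<bar> \<le> Mv" "\<And>x. x \<in> cbox a b \<Longrightarrow> \<bar>F x\<bar> \<le> B"
    using bdd[OF u] bdd[OF v] bdd[OF F] by metis
  define M where "M = max Mu Mv"
  have Mpos: "M > 0" and uM: "\<And>x. x \<in> cbox a b \<Longrightarrow> \<bar>u x\<bar> \<le> M"
    and vM: "\<And>x. x \<in> cbox a b \<Longrightarrow> \<bar>v x\<bar> \<le> M" using M by (force simp: M_def)+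
  \<comment> \<open>With M bounding both functions, \<open>\<bar>s\<bar> < 1 / M\<close> keeps s u
    and s v in the disc of convergence, uniformly on the box.\<close>
  define \<eta>' where "\<eta>' = min \<eta> (1 / M)"
  define c where "c n = integral (cbox a b) (\<lambda>x. F x * legP (u x) (v x) n)" for n
  have "c n = 0"
  proof (rule powser_eq_0[where \<eta> = \<eta>' and a = c])
    show "\<eta>' > 0" using \<open>\<eta> > 0\<close> Mpos by (simp add: \<eta>'_def)
  next
    fix s assume s: "\<bar>s\<bar> < \<eta>'"
    then have sM: "\<bar>s\<bar> * M < 1" and s\<eta>: "\<bar>s\<bar> < \<eta>"
      using Mpos by (auto simp: \<eta>'_def field_simps)
    define f where "f n x = F x * legP (u x) (v x) n * s ^ n" for n x
    have lt: "\<bar>s * u x\<bar> < 1" "\<bar>s * v x\<bar> < 1" if "x \<in> cbox a b" for x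
      using sM uM[OF that] vM[OF that] mult_left_mono[of "\<bar>u x\<bar>" M "\<bar>s\<bar>"]
        mult_left_mono[of "\<bar>v x\<bar>" M "\<bar>s\<bar>"] by (auto simp: abs_mult)
    have "uniform_limit (cbox a b) (\<lambda>n x. \<Sum>i<n. f i x) (\<lambda>x. \<Sum>i. f i x) sequentially"
    proof (rule Weierstrass_m_test)
      fix n x assume x: "x \<in> cbox a b"
      show "norm (f n x) \<le> B * (legP M M n * \<bar>s\<bar> ^ n)"
        using M(6)[OF x] legP_abs_le[OF uM[OF x] vM[OF x], of n] M(3)
        by (auto simp: f_def abs_mult power_abs mult.assoc intro!: mult_mono)
    next
      show "summable (\<lambda>n. B * (legP M M n * \<bar>s\<bar> ^ n))"
        using legP_sums[of "\<bar>s\<bar>" M M] sM Mpos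
        by (intro summable_mult) (auto simp: sums_iff abs_mult)
    qed
    also have "?this \<longleftrightarrow> uniform_limit (cbox a b) (\<lambda>n x. \<Sum>i<n. f i x)
        (\<lambda>x. F x / sqrt ((1 - s * u x) * (1 - s * v x))) sequentially"
    proof (rule uniform_limit_cong')
      fix x assume x: "x \<in> cbox a b"
      have "(\<lambda>n. F x * (legP (u x) (v x) n * s ^ n)) sums
          (F x * (1 / sqrt ((1 - s * u x) * (1 - s * v x))))"
        by (intro sums_mult legP_sums lt x)
      then show "(\<Sum>i. f i x) = F x / sqrt ((1 - s * u x) * (1 - s * v x))"
        by (simp add: f_def sums_iff mult.assoc)
    qed auto
    finally have ul: "uniform_limit (cbox a b) (\<lambda>n x. \<Sum>i<n. f i x)
        (\<lambda>x. F x / sqrt ((1 - s * u x) * (1 - s * v x))) sequentially" .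
    have fc: "continuous_on (cbox a b) (f n)" for n
      unfolding f_def by (intro continuous_intros F u v)
    have fi: "(f n has_integral c n * s ^ n) (cbox a b)" for n
      unfolding f_def c_def
      by (intro has_integral_mult_left integrable_integral integrable_continuous
          continuous_intros F u v)
    obtain I J where I: "\<And>n. ((\<lambda>x. \<Sum>i<n. f i x) has_integral I n) (cbox a b)"
      and J: "((\<lambda>x. F x / sqrt ((1 - s * u x) * (1 - s * v x))) has_integral J) (cbox a b)"
      and lim: "I \<longlonglongrightarrow> J"
      by (rule uniform_limit_integral_cbox[OF ul]) (auto intro: continuous_on_sum fc that)
    have "I n = (\<Sum>i<n. c i * s ^ i)" for n
      using has_integral_unique[OF I has_integral_sum[of "{..<n}" f "\<lambda>i. c i * s ^ i", OF _ fi]] by simp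
    moreover have "J = 0" using J 0[OF s\<eta>] by (simp add: integral_unique)
    ultimately show "(\<lambda>n. c n * s ^ n) sums 0" using lim unfolding sums_def
      by presburger
  qed
  then show ?thesis by (simp add: c_def)
qed

text \<open>Let L be integration against F. The recurrence expresses (u + v) P_n by P_(n+1) and n u
  v P_(n-1), and L annihilates P_(n+1) P_m. Hence L((u + v) P_n P_m) is a multiple of L(u v P_(n-1)
  P_m), and by symmetry also of L(u v P_n P_(m-1)). Comparing the two moves the index down to 0,
  where the factor n kills the term.\<close>

lemma legP_products_step:
  fixes F u v :: "'a::euclidean_space \<Rightarrow> real"
  assumes F: "continuous_on (cbox a b) F" and u: "continuous_on (cbox a b) u"
    and v: "continuous_on (cbox a b) v"
    and 0: "\<And>n m. integral (cbox a b) (\<lambda>x. F x * legP (u x) (v x) n * legP (u x) (v x) m) = 0"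
  shows "integral (cbox a b) (\<lambda>x. F x * (u x * v x) * legP (u x) (v x) n * legP (u x) (v x) m) = 0"
      (is "?A n m = 0")
    and "integral (cbox a b) (\<lambda>x. F x * (u x + v x) * legP (u x) (v x) n * legP (u x) (v x) m) = 0"
proof -
  define L where "L f = integral (cbox a b) (\<lambda>x. F x * f x)" for f
  define P where "P n x = legP (u x) (v x) n" for n x
  define e1 e2 where "e1 x = u x + v x" and "e2 x = u x * v x" for x
  note [continuous_intros] = F u v
  have cP [continuous_intros]: "continuous_on (cbox a b) (P n)" for n
    unfolding P_def by (intro continuous_intros)
  have ce [continuous_intros]: "continuous_on (cbox a b) e1" "continuous_on (cbox a b) e2"
    unfolding e1_def e2_def by (intro continuous_intros)+
  have Ladd: "L (\<lambda>x. f x + g x) = L f + L g"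
    if "continuous_on (cbox a b) f" "continuous_on (cbox a b) g" for f g
    unfolding L_def distrib_left
    by (intro integral_add integrable_continuous continuous_intros that)
  have Lmult: "L (\<lambda>x. c * f x) = c * L f" for c f
  proof -
    have "(\<lambda>x. F x * (c * f x)) = (\<lambda>x. c * (F x * f x))" by (simp add: mult_ac)
    then show ?thesis unfolding L_def by simp
  qed
  have L0: "L (\<lambda>x. P n x * P m x) = 0" for n m
    using 0[of n m] by (simp add: L_def P_def mult.assoc)
  have rec: "e1 x * P n x = real (Suc n) / (real n + 1/2) * P (Suc n) x
      + real n / (real n + 1/2) * (e2 x * P (n - 1) x)" for n x
  proof -
    have *: "e * p = S / k + c / k * q" if "k \<noteq> 0" "S = k * e * p - c * q" for e p S k c q :: real
      using that by (simp add: field_simps)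
    show ?thesis
      using *[OF _ legP_rec[of n "u x" "v x", folded mult.assoc[of _ "u x * v x"], unfolded mult.assoc[of "real n"]]]
      by (simp add: P_def e1_def e2_def del: of_nat_Suc)
  qed
  have e1P: "L (\<lambda>x. e1 x * P n x * P m x) = real n / (real n + 1/2) * L (\<lambda>x. e2 x * P (n - 1) x * P m x)"
    for n m
  proof -
    have "L (\<lambda>x. e1 x * P n x * P m x) = L (\<lambda>x. real (Suc n) / (real n + 1/2) * (P (Suc n) x * P m x)
        + real n / (real n + 1/2) * (e2 x * P (n - 1) x * P m x))"
      unfolding rec distrib_right by (simp only: mult.assoc)
    also have "\<dots> = real (Suc n) / (real n + 1/2) * L (\<lambda>x. P (Suc n) x * P m x)
        + real n / (real n + 1/2) * L (\<lambda>x. e2 x * P (n - 1) x * P m x)"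
      by (subst Ladd) (intro continuous_intros | simp only: Lmult)+
    finally show ?thesis by (simp add: L0)
  qed
  have sym: "L (\<lambda>x. g x * P n x * P m x) = L (\<lambda>x. g x * P m x * P n x)" for g n m
    by (simp add: mult_ac)
  have e2P: "L (\<lambda>x. e2 x * P n x * P m x) = 0" for n m
  proof (induction n arbitrary: m)
    case 0
    have "0 = real (Suc m) / (real (Suc m) + 1/2) * L (\<lambda>x. e2 x * P m x * P 0 x)"
      using e1P[of 0 "Suc m"] e1P[of "Suc m" 0] sym[of e1 0 "Suc m"] by simp
    then have "L (\<lambda>x. e2 x * P m x * P 0 x) = 0" by (simp del: of_nat_Suc)
    then show ?case using sym[of e2 m 0] by simp
  next
    case (Suc n)
    have "real (Suc n) / (real (Suc n) + 1/2) * L (\<lambda>x. e2 x * P n x * P (Suc m) x)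
        = real (Suc m) / (real (Suc m) + 1/2) * L (\<lambda>x. e2 x * P m x * P (Suc n) x)"
      using e1P[of "Suc n" "Suc m"] e1P[of "Suc m" "Suc n"] sym[of e1 "Suc n" "Suc m"] by simp
    then have "L (\<lambda>x. e2 x * P m x * P (Suc n) x) = 0" using Suc by (simp del: of_nat_Suc)
    then show ?case using sym[of e2 m "Suc n"] by simp
  qed
  show "integral (cbox a b) (\<lambda>x. F x * (u x * v x) * legP (u x) (v x) n * legP (u x) (v x) m) = 0"
    using e2P[of n m] by (simp add: L_def P_def e2_def mult.assoc)
  show "integral (cbox a b) (\<lambda>x. F x * (u x + v x) * legP (u x) (v x) n * legP (u x) (v x) m) = 0"
    using e1P[of n m] e2P by (simp add: L_def P_def e1_def mult.assoc)
qed

text \<open>F itself is a uniform limit of multipliers f with vanishing integral of F f. So the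
  integral of F * F is zero, and continuity does the rest.\<close>

lemma integral_products_eq_0_imp_eq_0:
  fixes F u v :: "'a::euclidean_space \<Rightarrow> real"
  assumes F: "continuous_on (cbox a b) F" and u: "continuous_on (cbox a b) u"
    and v: "continuous_on (cbox a b) v" and "\<eta> > 0"
    and lt: "\<And>s x. \<bar>s\<bar> < \<eta> \<Longrightarrow> x \<in> cbox a b \<Longrightarrow> \<bar>s * u x\<bar> < 1 \<and> \<bar>s * v x\<bar> < 1"
    and 0: "\<And>s t. \<bar>s\<bar> < \<eta> \<Longrightarrow> \<bar>t\<bar> < \<eta> \<Longrightarrow>
      integral (cbox a b) (\<lambda>x. F x / sqrt ((1 - s * u x) * (1 - s * v x))
        / sqrt ((1 - t * u x) * (1 - t * v x))) = 0"
    and sep: "\<And>x y. x \<in> cbox a b \<Longrightarrow> y \<in> cbox a b \<Longrightarrow> u x + v x = u y + v y \<Longrightarrow>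
      u x * v x = u y * v y \<Longrightarrow> x = y"
    and ne: "box a b \<noteq> {}" and x: "x \<in> cbox a b"
  shows "F x = 0"
proof -
  note [continuous_intros] = F u v
  \<comment> \<open>The condition is put on an arbitrary density G instead of F, so that passing
    from G to G (u + v) or G u v can be iterated.\<close>
  define Z where "Z G \<longleftrightarrow> continuous_on (cbox a b) G \<and> (\<forall>n m.
      integral (cbox a b) (\<lambda>x. G x * legP (u x) (v x) n * legP (u x) (v x) m) = 0)" for G
  \<comment> \<open>The expansion is used twice: in t with the s-root kept inside the density, then
    in s with the polynomial from the first round inside the density.\<close>
  have "integral (cbox a b) (\<lambda>x. F x / sqrt ((1 - s * u x) * (1 - s * v x)) * legP (u x) (v x) m) = 0"
    if "\<bar>s\<bar> < \<eta>" for s m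
  proof (rule integral_legP_eq_0[OF _ u v \<open>\<eta> > 0\<close> 0[OF that]])
    have "(1 - s * u x) * (1 - s * v x) > 0" if "x \<in> cbox a b" for x
      using lt[OF \<open>\<bar>s\<bar> < \<eta>\<close> that] by (auto intro!: mult_pos_pos)
    then show "continuous_on (cbox a b) (\<lambda>x. F x / sqrt ((1 - s * u x) * (1 - s * v x)))"
      by (intro continuous_intros) force
  qed
  then have "integral (cbox a b) (\<lambda>x. F x * legP (u x) (v x) m * legP (u x) (v x) n) = 0" for n m
    by (intro integral_legP_eq_0[OF _ u v \<open>\<eta> > 0\<close>] continuous_intros) (simp add: mult_ac)
  then have ZF: "Z F" unfolding Z_def using F by (auto simp: mult_ac)
  \<comment> \<open>\<open>P\<close> is the ring of multipliers of the space \<open>Z\<close>, to which Stone-Weierstrass applies.\<close>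
  define P where "P f \<longleftrightarrow> continuous_on (cbox a b) f \<and> (\<forall>G. Z G \<longrightarrow> Z (\<lambda>x. G x * f x))" for f
  have Pu: "P (\<lambda>x. u x + v x)" "P (\<lambda>x. u x * v x)"
    unfolding P_def Z_def using legP_products_step[OF _ u v]
    by (auto intro!: continuous_intros)
  have Padd: "P (\<lambda>x. f x + g x)" if "P f" "P g" for f g
    unfolding P_def
  proof (intro conjI allI impI)
    show "continuous_on (cbox a b) (\<lambda>x. f x + g x)" using that unfolding P_def
      by (auto intro!: continuous_intros)
    fix G assume "Z G"
    then have Z: "Z (\<lambda>x. G x * f x)" "Z (\<lambda>x. G x * g x)" using that by (auto simp: P_def)
    show "Z (\<lambda>x. G x * (f x + g x))"
      unfolding Z_def
    proof (intro conjI allI)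
      show "continuous_on (cbox a b) (\<lambda>x. G x * (f x + g x))"
        using Z unfolding Z_def distrib_left by (auto intro!: continuous_intros)
      show "integral (cbox a b) (\<lambda>x. G x * (f x + g x) * legP (u x) (v x) n * legP (u x) (v x) m) = 0" for n m
        unfolding distrib_left distrib_right using Z unfolding Z_def
        by (subst integral_add) (auto intro!: integrable_continuous continuous_intros)
    qed
  qed
  \<comment> \<open>Both indices are taken to be 0, where \<open>legP\<close> is 1.\<close>
  have "integral (cbox a b) (\<lambda>x. F x * f x) = 0" if "P f" for f
  proof -
    have "Z (\<lambda>x. F x * f x)" using that ZF by (auto simp: P_def)
    then have "integral (cbox a b) (\<lambda>x. F x * f x * legP (u x) (v x) 0 * legP (u x) (v x) 0) = 0"
      unfolding Z_def by blast
    then show ?thesis by simp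
  qed
  note PF = this
  have R: "function_ring_on (Collect P) (cbox a b)"
  proof
    show "compact (cbox a b)" by (rule compact_cbox)
    show "f \<in> Collect P \<Longrightarrow> continuous_on (cbox a b) f" for f by (simp add: P_def)
    show "f \<in> Collect P \<Longrightarrow> g \<in> Collect P \<Longrightarrow> (\<lambda>x. f x + g x) \<in> Collect P" for f g
      using Padd by simp
    show "(\<lambda>x. f x * g x) \<in> Collect P" if "f \<in> Collect P" "g \<in> Collect P" for f g
      using that by (auto simp: P_def intro!: continuous_intros simp flip: mult.assoc)
    show "(\<lambda>_. c) \<in> Collect P" for c
    proof -
      have "integral (cbox a b) (\<lambda>x. G x * c * legP (u x) (v x) n * legP (u x) (v x) m) = 0"
        if "Z G" for G n m
      proof -
        have "(\<lambda>x. G x * c * legP (u x) (v x) n * legP (u x) (v x) m)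
          = (\<lambda>x. c * (G x * legP (u x) (v x) n * legP (u x) (v x) m))" by (simp add: mult_ac)
        then show ?thesis using that by (simp add: Z_def)
      qed
      then show ?thesis unfolding P_def by (auto simp: Z_def intro!: continuous_intros)
    qed
    show "\<exists>f\<in>Collect P. f x \<noteq> f y" if "x \<in> cbox a b" "y \<in> cbox a b" "x \<noteq> y" for x y
    proof (cases "u x + v x = u y + v y")
      case True
      then have "u x * v x \<noteq> u y * v y" using sep[OF that(1,2)] that(3) by auto
      then show ?thesis using Pu(2) by (intro bexI[of _ "\<lambda>x. u x * v x"]) auto
    next
      case False
      then show ?thesis using Pu(1) by (intro bexI[of _ "\<lambda>x. u x + v x"]) auto
    qed
  qed
  obtain f where f: "\<And>n::nat. f n \<in> Collect P" and lim: "uniform_limit (cbox a b) f F sequentially"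
    using function_ring_on.Stone_Weierstrass[OF R F] by (auto simp: Pi_iff)
  have fc: "continuous_on (cbox a b) (f n)" for n using f by (simp add: P_def)
  have "bounded (F ` cbox a b)"
    by (intro compact_imp_bounded compact_continuous_image F compact_cbox)
  have "uniform_limit (cbox a b) (\<lambda>n x. F x * f n x) (\<lambda>x. F x * F x) sequentially"
    by (intro uniform_lim_mult uniform_limit_const lim \<open>bounded (F ` cbox a b)\<close>)
  then obtain I J where IJ: "\<And>n. ((\<lambda>x. F x * f n x) has_integral I n) (cbox a b)"
    "((\<lambda>x. F x * F x) has_integral J) (cbox a b)" "I \<longlonglongrightarrow> J"
    by (rule uniform_limit_integral_cbox) (auto intro!: continuous_intros fc)
  have "I n = 0" for n using PF[of "f n"] f[of n] IJ(1)[of n] by (simp add: integral_unique)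
  then have "I = (\<lambda>n. 0)" by auto
  then have "J = 0" using IJ(3) LIMSEQ_unique[OF _ tendsto_const] by simp
  then have "F x * F x = 0"
    using has_integral_0_cbox_imp_0[of a b "\<lambda>x. F x * F x" x] IJ(2) ne x F
    by (auto intro!: continuous_intros)
  then show ?thesis by simp
qed

section \<open>Abel kernels\<close>

text \<open>The Moebius map \<open>q\<close> has its pole at \<open>\<tau>\<close> and sends v to -1
  and u to 1. Since 1 - q^2 is a constant times (u - k) (k - v) / (k - \<tau>)^2, the function
  arcsin (q k) / c is an antiderivative, continuous up to the end points.\<close>

lemma has_integral_abel_kernel:
  fixes u v \<tau> :: real
  assumes "\<tau> < v" "v < u"
  shows "((\<lambda>k. 1 / ((k - \<tau>) * sqrt ((u - k) * (k - v)))) has_integral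
           pi / sqrt ((u - \<tau>) * (v - \<tau>))) {v..u}"
proof -
  define c where "c = sqrt ((u - \<tau>) * (v - \<tau>))"
  define q where "q k = ((u + v - 2 * \<tau>) * (k - \<tau>) - 2 * (u - \<tau>) * (v - \<tau>)) / ((k - \<tau>) * (u - v))" for k
  have c: "c > 0" "c\<^sup>2 = (u - \<tau>) * (v - \<tau>)" using assms by (auto simp: c_def)
  have q1: "1 - (q k)\<^sup>2 = 4 * c\<^sup>2 * ((u - k) * (k - v)) / ((k - \<tau>) * (u - v))\<^sup>2" if "k \<noteq> \<tau>" for k
  proof -
    have "1 - (q k)\<^sup>2 = (((k - \<tau>) * (u - v))\<^sup>2 - ((u + v - 2 * \<tau>) * (k - \<tau>) - 2 * (u - \<tau>) * (v - \<tau>))\<^sup>2)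
        / ((k - \<tau>) * (u - v))\<^sup>2"
    proof -
      have "1 - (x / y)\<^sup>2 = (y\<^sup>2 - x\<^sup>2) / y\<^sup>2" if "y \<noteq> 0" for x y :: real
        using that by (simp add: field_simps)
      then show ?thesis using that assms unfolding q_def by auto
    qed
    also have "((k - \<tau>) * (u - v))\<^sup>2 - ((u + v - 2 * \<tau>) * (k - \<tau>) - 2 * (u - \<tau>) * (v - \<tau>))\<^sup>2
        = 4 * c\<^sup>2 * ((u - k) * (k - v))"
      unfolding c(2) by (simp add: power2_eq_square algebra_simps)
    finally show ?thesis .
  qed
  have range: "-1 \<le> q k" "q k \<le> 1" if "k \<in> {v..u}" for k
  proof -
    have "1 - (q k)\<^sup>2 \<ge> 0" using q1[of k] that assms by auto
    then have "\<bar>q k\<bar> \<le> 1" using abs_square_le_1 by auto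
    then show "-1 \<le> q k" "q k \<le> 1" by auto
  qed
  have "((\<lambda>k. 1 / ((k - \<tau>) * sqrt ((u - k) * (k - v)))) has_integral
      (arcsin (q u) / c - arcsin (q v) / c)) {v..u}"
  proof (rule fundamental_theorem_of_calculus_interior)
    show "v \<le> u" using assms by simp
    show "continuous_on {v..u} (\<lambda>k. arcsin (q k) / c)"
      using range c assms unfolding q_def by (intro continuous_intros) auto
    fix k assume k: "k \<in> {v<..<u}"
    have pos: "(u - k) * (k - v) > 0" "k - \<tau> > 0" "u - v > 0" using k assms by auto
    have s: "1 - (q k)\<^sup>2 > 0" 
      using q1[of k] pos c(1) by (auto intro!: divide_pos_pos mult_pos_pos)
    then have qlt: "-1 < q k" "q k < 1"
      using abs_square_less_1[of "q k"] by auto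
    have dq: "(q has_real_derivative 2 * c\<^sup>2 / ((k - \<tau>)\<^sup>2 * (u - v))) (at k)"
      unfolding q_def c(2) using pos
      by (auto intro!: derivative_eq_intros simp: divide_simps) (simp add: algebra_simps power2_eq_square)
    have sq: "sqrt (1 - (q k)\<^sup>2) = 2 * c * sqrt ((u - k) * (k - v)) / ((k - \<tau>) * (u - v))"
      using q1[of k] pos c(1) by (simp add: real_sqrt_divide real_sqrt_mult)
    have "((\<lambda>k. arcsin (q k) / c) has_real_derivative
        inverse (sqrt (1 - (q k)\<^sup>2)) * (2 * c\<^sup>2 / ((k - \<tau>)\<^sup>2 * (u - v))) / c) (at k)"
      by (intro DERIV_cdivide DERIV_chain2[OF DERIV_arcsin[OF qlt] dq])
    also have "inverse (sqrt (1 - (q k)\<^sup>2)) * (2 * c\<^sup>2 / ((k - \<tau>)\<^sup>2 * (u - v))) / c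
        = 1 / ((k - \<tau>) * sqrt ((u - k) * (k - v)))"
      unfolding sq using pos c(1) by (simp add: divide_simps power2_eq_square)
    finally show "((\<lambda>k. arcsin (q k) / c) has_vector_derivative 1 / ((k - \<tau>) * sqrt ((u - k) * (k - v)))) (at k)"
      by (simp add: has_real_derivative_iff_has_vector_derivative)
  qed
  moreover have "q u = 1"
  proof -
    have "(u + v - 2 * \<tau>) * (u - \<tau>) - 2 * (u - \<tau>) * (v - \<tau>) = (u - \<tau>) * (u - v)" by algebra
    then show ?thesis using assms by (simp add: q_def)
  qed
  moreover have "q v = -1"
  proof -
    have "(u + v - 2 * \<tau>) * (v - \<tau>) - 2 * (u - \<tau>) * (v - \<tau>) = - ((v - \<tau>) * (u - v))" by algebra
    then show ?thesis using assms by (simp add: q_def)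
  qed
  ultimately show ?thesis by (simp add: c_def flip: add_divide_distrib)
qed

text \<open>The open interval makes the kernel zero at its two singularities and identically zero
  for u = v.\<close>

definition abel_kernel :: "real \<Rightarrow> real \<Rightarrow> real \<Rightarrow> real" where
  "abel_kernel u v k = indicator {v<..<u} k / sqrt ((u - k) * (k - v))"

lemma has_bochner_integral_abel_kernel:
  fixes u v \<tau> :: real
  assumes "\<tau> < v" "v < u"
  shows "has_bochner_integral lborel (\<lambda>k. abel_kernel u v k / (k - \<tau>)) (pi / sqrt ((u - \<tau>) * (v - \<tau>)))"
proof (rule has_bochner_integral_nn_integral)
  show "(\<lambda>k. abel_kernel u v k / (k - \<tau>)) \<in> borel_measurable lborel"
    unfolding abel_kernel_def by measurable
  show "AE k in lborel. 0 \<le> abel_kernel u v k / (k - \<tau>)"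
    using assms by (auto simp: abel_kernel_def indicator_def)
  show "0 \<le> pi / sqrt ((u - \<tau>) * (v - \<tau>))" using assms by auto
  have "((\<lambda>k. abel_kernel u v k / (k - \<tau>)) has_integral pi / sqrt ((u - \<tau>) * (v - \<tau>))) {v..u}"
    by (rule has_integral_spike_finite[OF _ _ has_integral_abel_kernel[OF assms], of "{u, v}"])
      (auto simp: abel_kernel_def)
  then have "((\<lambda>k. if k \<in> {v..u} then abel_kernel u v k / (k - \<tau>) else 0)
      has_integral pi / sqrt ((u - \<tau>) * (v - \<tau>))) UNIV"
    by (simp only: has_integral_restrict_UNIV)
  also have "(\<lambda>k. if k \<in> {v..u} then abel_kernel u v k / (k - \<tau>) else 0) = (\<lambda>k. abel_kernel u v k / (k - \<tau>))"
    by (auto simp: abel_kernel_def indicator_def fun_eq_iff)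
  finally show "(\<integral>\<^sup>+ k. ennreal (abel_kernel u v k / (k - \<tau>)) \<partial>lborel) = ennreal (pi / sqrt ((u - \<tau>) * (v - \<tau>)))"
    using assms by (intro nn_integral_has_integral_lborel)
      (auto simp: abel_kernel_def indicator_def)
qed

text \<open>Fubini for the product of the box with the k-axis. Where u = v the kernel is zero but
  the closed form of its integral is not; \<open>F0\<close> makes the two sides agree there. The
  exceptional set \<open>N\<close> is null because it is countable.\<close>

lemma integral_abel_kernel_eq_0:
  fixes F u v :: "real \<times> real \<Rightarrow> real"
  assumes F: "continuous_on UNIV F" and u: "continuous_on UNIV u" and v: "continuous_on UNIV v"
    and le: "\<And>x. x \<in> cbox a b \<Longrightarrow> v x \<le> u x"
    and F0: "\<And>x. x \<in> cbox a b \<Longrightarrow> v x = u x \<Longrightarrow> F x = 0"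
    and lo: "\<And>x. x \<in> cbox a b \<Longrightarrow> lo \<le> v x" and hi: "\<And>x. x \<in> cbox a b \<Longrightarrow> u x \<le> hi"
    and \<tau>: "\<tau> < lo" and "countable N"
    and 0: "\<And>k. lo < k \<Longrightarrow> k < hi \<Longrightarrow> k \<notin> N \<Longrightarrow>
      (\<integral>s. \<integral>t. indicator (cbox a b) (s, t) * F (s, t) * abel_kernel (u (s, t)) (v (s, t)) k \<partial>lborel \<partial>lborel) = 0"
  shows "integral (cbox a b) (\<lambda>x. F x / sqrt ((u x - \<tau>) * (v x - \<tau>))) = 0"
proof -
  define g where "g x = F x * (pi / sqrt ((u x - \<tau>) * (v x - \<tau>)))" for x
  define f where "f = (\<lambda>(x, k). indicator (cbox a b) x * F x * (abel_kernel (u x) (v x) k / (k - \<tau>)))"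
  have pos: "(u x - \<tau>) * (v x - \<tau>) > 0" if "x \<in> cbox a b" for x
    using le[OF that] lo[OF that] \<tau> by (intro mult_pos_pos) auto
  have [measurable]: "F \<in> borel_measurable borel" "u \<in> borel_measurable borel" "v \<in> borel_measurable borel"
    using F u v by (auto intro: borel_measurable_continuous_onI)
  have [measurable]: "cbox a b \<in> sets borel" by simp
  have mf: "f \<in> borel_measurable (lborel \<Otimes>\<^sub>M lborel)"
  proof -
    have k: "abel_kernel u v k = (if v < k \<and> k < u then 1 / sqrt ((u - k) * (k - v)) else 0)" for u v k
      by (simp add: abel_kernel_def)
    have "f \<in> borel_measurable (borel \<Otimes>\<^sub>M borel)"
      unfolding f_def k by measurable
    also have "borel_measurable (borel \<Otimes>\<^sub>M borel) = borel_measurable (lborel \<Otimes>\<^sub>M lborel)"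
      by (intro measurable_cong_sets sets_pair_measure_cong) simp_all
    finally show ?thesis .
  qed
  have cg: "continuous_on (cbox a b) g"
    unfolding g_def using pos continuous_on_subset[OF F] continuous_on_subset[OF u] continuous_on_subset[OF v]
    by (intro continuous_intros) (auto simp: less_le)
  have inner: "has_bochner_integral lborel (\<lambda>k. f (x, k)) (indicator (cbox a b) x * g x)"
    "(\<integral>k. norm (f (x, k)) \<partial>lborel) = indicator (cbox a b) x * \<bar>g x\<bar>" for x
  proof -
    consider "x \<notin> cbox a b \<or> F x = 0" | "x \<in> cbox a b" "F x \<noteq> 0" by blast
    then have "has_bochner_integral lborel (\<lambda>k. f (x, k)) (indicator (cbox a b) x * g x) \<and>
      (\<integral>k. norm (f (x, k)) \<partial>lborel) = indicator (cbox a b) x * \<bar>g x\<bar>"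
    proof cases
      case 1
      then have "f (x, k) = 0" "indicator (cbox a b) x * g x = 0" for k
        by (auto simp: f_def g_def)
      then show ?thesis by (auto simp: has_bochner_integral_zero abs_mult indicator_def split: if_splits)
    next
      case 2
      have "\<tau> < v x" "v x < u x"
        using lo[OF 2(1)] \<tau> le[OF 2(1)] F0[OF 2(1)] 2(2) by (auto simp: less_le)
      note B = has_bochner_integral_abel_kernel[OF this]
      have f1: "f (x, k) = F x * (abel_kernel (u x) (v x) k / (k - \<tau>))" for k
        using 2 by (simp add: f_def)
      have f2: "norm (f (x, k)) = \<bar>F x\<bar> * (abel_kernel (u x) (v x) k / (k - \<tau>))" for k
      proof -
        have "abel_kernel (u x) (v x) k / (k - \<tau>) \<ge> 0"
          using \<open>\<tau> < v x\<close> by (auto simp: abel_kernel_def indicator_def)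
        then have "norm (F x * (abel_kernel (u x) (v x) k / (k - \<tau>)))
          = \<bar>F x\<bar> * (abel_kernel (u x) (v x) k / (k - \<tau>))"
          unfolding real_norm_def abs_mult by (simp only: abs_of_nonneg)
        then show ?thesis using 2 by (simp only: f_def prod.case indicator_simps mult_1)
      qed
      have g: "\<bar>g x\<bar> = \<bar>F x\<bar> * (pi / sqrt ((u x - \<tau>) * (v x - \<tau>)))"
        using pos[OF 2(1)] by (simp add: g_def abs_mult)
      have "has_bochner_integral lborel (\<lambda>k. f (x, k)) (g x)"
        unfolding f1 g_def by (rule has_bochner_integral_mult_right[OF B])
      moreover have "has_bochner_integral lborel (\<lambda>k. norm (f (x, k))) \<bar>g x\<bar>"
        unfolding f2 g by (rule has_bochner_integral_mult_right[OF B])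
      ultimately show ?thesis using 2(1) has_bochner_integral_integral_eq by auto
    qed
    then show "has_bochner_integral lborel (\<lambda>k. f (x, k)) (indicator (cbox a b) x * g x)"
      "(\<integral>k. norm (f (x, k)) \<partial>lborel) = indicator (cbox a b) x * \<bar>g x\<bar>" by auto
  qed
  have intg: "set_integrable lborel (cbox a b) g"
    unfolding set_integrable_def by (rule borel_integrable_compact[OF compact_cbox cg])
  \<comment> \<open>No estimate of the singular kernel is required: its integral over k is known
    exactly, so the integral of the norm is the absolute value of \<open>g\<close>, which is
    continuous on the box.\<close>
  have int_f: "integrable (lborel \<Otimes>\<^sub>M lborel) f"
  proof (rule lborel_pair.Fubini_integrable[OF mf])
    have "integrable lborel (\<lambda>x. \<bar>indicator (cbox a b) x * g x\<bar>)"
      using intg unfolding set_integrable_def by (intro integrable_abs) simp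
    then show "integrable lborel (\<lambda>x. \<integral> k. norm (f (x, k)) \<partial>lborel)"
      unfolding inner(2) by (simp add: abs_mult)
    show "AE x in lborel. integrable lborel (\<lambda>k. f (x, k))"
      using inner(1) by (auto simp: has_bochner_integral_iff)
  qed
  have "integral (cbox a b) g = (\<integral>x. \<integral>k. f (x, k) \<partial>lborel \<partial>lborel)"
    using set_borel_integral_eq_integral(2)[OF intg]
    by (simp add: set_lebesgue_integral_def has_bochner_integral_integral_eq[OF inner(1)])
  also have "\<dots> = (\<integral>k. \<integral>x. f (x, k) \<partial>lborel \<partial>lborel)"
    using lborel_pair.Fubini_integral[of "\<lambda>x k. f (x, k)"] int_f by simp
  also have "\<dots> = 0"
  proof (rule integral_eq_zero_AE)
    have "AE k in lborel. integrable lborel (\<lambda>x. f (x, k))"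
      using lborel_pair.AE_integrable_snd[of "\<lambda>x k. f (x, k)"] int_f by simp
    moreover have "AE k in lborel. k \<notin> N \<union> {lo, hi}"
      using \<open>countable N\<close> by (intro AE_not_in countable_imp_null_set_lborel) auto
    ultimately show "AE k in lborel. (\<integral>x. f (x, k) \<partial>lborel) = 0"
    proof eventually_elim
      case (elim k)
      show ?case
      proof (cases "lo < k \<and> k < hi")
        case True
        \<comment> \<open>For almost every k the slice is integrable over the plane, so it may be
          turned into the iterated integral in which hypothesis \<open>0\<close> is stated.\<close>
        have "(\<integral>x. f (x, k) \<partial>lborel) = (\<integral>x. f (x, k) \<partial>(lborel \<Otimes>\<^sub>M lborel))"
          by (simp add: lborel_prod)
        also have "\<dots> = (\<integral>s. \<integral>t. f ((s, t), k) \<partial>lborel \<partial>lborel)"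
          using elim(1) by (intro lborel_pair.integral_fst'[symmetric]) (simp add: lborel_prod)
        also have "\<dots> = (\<integral>s. \<integral>t. indicator (cbox a b) (s, t) * F (s, t) *
            abel_kernel (u (s, t)) (v (s, t)) k * (1 / (k - \<tau>)) \<partial>lborel \<partial>lborel)"
          by (simp add: f_def)
        also have "\<dots> = 0" using 0[of k] True elim(2)
          by (subst integral_mult_left_zero)+ simp
        finally show ?thesis .
      next
        case False
        then have "f (x, k) = 0" for x
          using lo[of x] hi[of x] by (auto simp: f_def abel_kernel_def indicator_def)
        then show ?thesis by simp
      qed
    qed
  qed
  finally have "integral (cbox a b) g = 0" .
  moreover have "g = (\<lambda>x. F x / sqrt ((u x - \<tau>) * (v x - \<tau>)) * pi)" by (auto simp: g_def)
  ultimately have "integral (cbox a b) (\<lambda>x. F x / sqrt ((u x - \<tau>) * (v x - \<tau>))) * pi = 0"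
    by (simp only: integral_mult_left)
  then show ?thesis by simp
qed

section \<open>Periodic orbits with one degree of freedom\<close>

text \<open>Hadamard's lemma: the quotient is the integral of f' (a + t (x - a)) over t in [0, 1].
  Each differentiation under the integral sign contributes a factor t, which gives the sequence of
  derivatives.\<close>

lemma smooth_fun_on_UNIV_div_linear:
  assumes "smooth_fun_on UNIV f" "f a = 0"
  obtains k where "smooth_fun_on UNIV k" "\<And>x. f x = (x - a) * k x"
proof -
  obtain D where D0: "\<And>x. D 0 x = f x"
    and D: "\<And>n x. (D n has_real_derivative D (Suc n) x) (at x)"
    using assms unfolding smooth_fun_on_def by auto
  have cD: "continuous_on UNIV (D n)" for n
    by (rule DERIV_continuous_on) (rule D)
  have cDc: "continuous_on S (\<lambda>z. D n (g z))" if "continuous_on S g" for S n and g :: "'b::t2_space \<Rightarrow> real"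
    by (rule continuous_on_compose2[OF cD that]) auto
  define k where "k n x = integral (cbox 0 1) (\<lambda>t. t ^ n * D (Suc n) (a + t * (x - a)))" for n x
  have k: "(k n has_real_derivative k (Suc n) x) (at x)" for n x
    unfolding k_def
  proof (rule leibniz_rule_field_derivative[where U = UNIV])
    fix x t :: real
    have "((\<lambda>x. D (Suc n) (a + t * (x - a))) has_real_derivative D (Suc (Suc n)) (a + t * (x - a)) * t) (at x)"
      by (rule DERIV_chain2[OF D]) (auto intro!: derivative_eq_intros)
    then show "((\<lambda>x. t ^ n * D (Suc n) (a + t * (x - a))) has_real_derivative
        t ^ Suc n * D (Suc (Suc n)) (a + t * (x - a))) (at x)"
      by (auto intro!: derivative_eq_intros)
  next
    fix x :: real
    show "(\<lambda>t. t ^ n * D (Suc n) (a + t * (x - a))) integrable_on cbox 0 1"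
      by (intro integrable_continuous continuous_intros cDc)
  next
    show "continuous_on (UNIV \<times> cbox 0 1) (\<lambda>(x, t). t ^ Suc n * D (Suc (Suc n)) (a + t * (x - a)))"
      unfolding split_beta by (intro continuous_intros cDc)
  qed auto
  show thesis
  proof
    show "smooth_fun_on UNIV (k 0)"
      unfolding smooth_fun_on_def by (rule exI[of _ k]) (auto simp: k)
    fix x
    have "((\<lambda>t. (x - a) * D 1 (a + t * (x - a))) has_integral D 0 (a + 1 * (x - a)) - D 0 (a + 0 * (x - a))) {0..1}"
    proof (rule fundamental_theorem_of_calculus)
      fix t :: real
      have "((\<lambda>t. D 0 (a + t * (x - a))) has_real_derivative D (Suc 0) (a + t * (x - a)) * (x - a)) (at t)"
        by (rule DERIV_chain2[OF D]) (auto intro!: derivative_eq_intros)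
      then show "((\<lambda>t. D 0 (a + t * (x - a))) has_vector_derivative (x - a) * D 1 (a + t * (x - a))) (at t within {0..1})"
        by (auto simp: has_real_derivative_iff_has_vector_derivative mult.commute intro: has_vector_derivative_at_within)
    qed simp
    then have "((\<lambda>t. (x - a) * D 1 (a + t * (x - a))) has_integral f x) {0..1}"
      using assms(2) by (simp add: D0)
    then have "f x = integral {0..1} (\<lambda>t. (x - a) * D 1 (a + t * (x - a)))"
      by (rule integral_unique[symmetric])
    also have "\<dots> = (x - a) * k 0 x" by (simp add: k_def)
    finally show "f x = (x - a) * k 0 x" .
  qed
qed

text \<open>A closed curve in the energy surface \<open>p\<^sup>2 = g \<theta>\<close> of the Hamiltonian \<open>(p\<^sup>2 - g \<theta>) / 2\<close>,
  traversed once as the parameter runs through \<open>[0, 1]\<close>; the orbit time is the integral of \<open>e\<close>.\<close>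

locale orbit =
  fixes g g' \<theta> p e :: "real \<Rightarrow> real"
  assumes energy: "(p s)\<^sup>2 = g (\<theta> s)"
    and der_theta: "(\<theta> has_real_derivative e s * p s) (at s)"
    and der_p: "(p has_real_derivative e s * (g' (\<theta> s) / 2)) (at s)"
    and der_g: "(g has_real_derivative g' x) (at x)"
    and cont_g': "continuous_on UNIV g'"
    and cont_e: "continuous_on UNIV e"
    and e_pos: "e s > 0"
    and regular: "p s \<noteq> 0 \<or> g' (\<theta> s) \<noteq> 0"
begin

lemma cont_theta: "continuous_on UNIV \<theta>" and cont_p: "continuous_on UNIV p"
  by (rule DERIV_continuous_on, rule der_theta) (rule DERIV_continuous_on, rule der_p)

end

text \<open>Without turning points the momentum keeps its sign, and the angle itself, scaled by its
  period w, serves as the parameter; the time density is then w / p.\<close>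

lemma rotation_orbit:
  fixes g g' :: "real \<Rightarrow> real" and w :: real
  assumes w: "w > 0" and g: "\<And>x. (g has_real_derivative g' x) (at x)" "continuous_on UNIV g'"
    and pos: "\<And>x. g x > 0"
  shows "orbit g g' (\<lambda>s. w * s) (\<lambda>s. sqrt (g (w * s))) (\<lambda>s. w / sqrt (g (w * s)))"
proof
  fix s x :: real
  show "(sqrt (g (w * s)))\<^sup>2 = g (w * s)" using pos[of "w * s"] by simp
  show "((\<lambda>s. w * s) has_real_derivative w / sqrt (g (w * s)) * sqrt (g (w * s))) (at s)"
    using pos[of "w * s"] by (auto intro!: derivative_eq_intros)
  have "((\<lambda>s. g (w * s)) has_real_derivative g' (w * s) * w) (at s)"
    by (rule DERIV_chain2[OF g(1)]) (auto intro!: derivative_eq_intros)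
  then show "((\<lambda>s. sqrt (g (w * s))) has_real_derivative w / sqrt (g (w * s)) * (g' (w * s) / 2)) (at s)"
    using pos[of "w * s"]
    by (auto intro!: derivative_eq_intros simp: divide_simps)
  show "(g has_real_derivative g' x) (at x)" by (rule g)
  have "continuous_on UNIV g"
    by (rule DERIV_continuous_on) (rule g(1))
  then have "continuous_on UNIV (\<lambda>s. g (w * s))"
    by (rule continuous_on_compose2) (auto intro!: continuous_intros)
  moreover have "g (w * s) \<noteq> 0" for s using pos[of "w * s"] by simp
  ultimately show "continuous_on UNIV (\<lambda>s. w / sqrt (g (w * s)))"
    by (intro continuous_intros) auto
  show "w / sqrt (g (w * s)) > 0" using w pos[of "w * s"] by simp
  show "sqrt (g (w * s)) \<noteq> 0 \<or> g' (w * s) \<noteq> 0" using pos[of "w * s"] by simp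
qed (rule g(2))

text \<open>Splitting off the simple zeros at c - r and c + r lets the cosine run through the
  turning points smoothly: the root of r^2 - (x - c)^2 becomes r sin, which changes sign as the
  momentum must, and only the root of the positive factor \<open>h\<close> remains.\<close>

lemma oscillation_orbit:
  fixes g h h' :: "real \<Rightarrow> real" and r c :: real
  assumes r: "r > 0" and g: "\<And>x. g x = (r\<^sup>2 - (x - c)\<^sup>2) * h x"
    and h: "\<And>x. (h has_real_derivative h' x) (at x)" "continuous_on UNIV h'"
    and pos: "\<And>x. \<bar>x - c\<bar> \<le> r \<Longrightarrow> h x > 0"
  defines "\<theta> \<equiv> \<lambda>s. c - r * cos (2 * pi * s)"
  defines "p \<equiv> \<lambda>s. r * sin (2 * pi * s) * sqrt (h (\<theta> s))"
  defines "e \<equiv> \<lambda>s. 2 * pi / sqrt (h (\<theta> s))"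
  shows "orbit g (\<lambda>x. - 2 * (x - c) * h x + (r\<^sup>2 - (x - c)\<^sup>2) * h' x) \<theta> p e" (is "orbit g ?g' \<theta> p e")
    and "\<And>s t. \<theta> s = \<theta> t \<and> p s = p t \<longleftrightarrow> s - t \<in> \<int>"
    and "\<And>x y. \<bar>x - c\<bar> \<le> r \<Longrightarrow> y\<^sup>2 = g x \<Longrightarrow> \<exists>s. \<theta> s = x \<and> p s = y"
    and "\<And>s. \<bar>\<theta> s - c\<bar> \<le> r"
proof -
  show rng: "\<bar>\<theta> s - c\<bar> \<le> r" for s
  proof -
    have "\<bar>r * cos (2 * pi * s)\<bar> \<le> r * 1"
      unfolding abs_mult using r abs_cos_le_one by (intro mult_mono) auto
    then show ?thesis by (simp add: \<theta>_def)
  qed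
  have hpos: "h (\<theta> s) > 0" for s by (rule pos[OF rng])
  have ch: "continuous_on UNIV h"
    by (rule DERIV_continuous_on) (rule h(1))
  have c\<theta>: "continuous_on UNIV \<theta>" unfolding \<theta>_def by (intro continuous_intros)
  have d\<theta>: "(\<theta> has_real_derivative 2 * pi * r * sin (2 * pi * s)) (at s)" for s
    unfolding \<theta>_def by (auto intro!: derivative_eq_intros)
  have dh: "((\<lambda>s. h (\<theta> s)) has_real_derivative h' (\<theta> s) * (2 * pi * r * sin (2 * pi * s))) (at s)" for s
    by (rule DERIV_chain2[OF h(1) d\<theta>])
  have sc: "r\<^sup>2 - (\<theta> s - c)\<^sup>2 = (r * sin (2 * pi * s))\<^sup>2" for s
  proof -
    have "(r * sin (2 * pi * s))\<^sup>2 = r\<^sup>2 * (1 - (cos (2 * pi * s))\<^sup>2)"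
      unfolding power_mult_distrib sin_squared_eq ..
    moreover have "(\<theta> s - c)\<^sup>2 = r\<^sup>2 * (cos (2 * pi * s))\<^sup>2"
      by (simp add: \<theta>_def power_mult_distrib)
    ultimately show ?thesis by (simp only: right_diff_distrib mult_1_right)
  qed
  show "orbit g ?g' \<theta> p e"
  proof
    fix s x
    show "(p s)\<^sup>2 = g (\<theta> s)"
      using hpos[of s] by (simp add: p_def g sc power_mult_distrib)
    show "(\<theta> has_real_derivative e s * p s) (at s)"
      using d\<theta>[of s] by (rule DERIV_cong) (use hpos[of s] in \<open>simp add: e_def p_def\<close>)
    have "((\<lambda>s. sqrt (h (\<theta> s))) has_real_derivative
        (inverse (sqrt (h (\<theta> s))) / 2) * (h' (\<theta> s) * (2 * pi * r * sin (2 * pi * s)))) (at s)"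
      by (rule DERIV_chain2[OF DERIV_real_sqrt[OF hpos] dh])
    then have dp: "(p has_real_derivative r * (cos (2 * pi * s) * (2 * pi)) * sqrt (h (\<theta> s)) +
       r * sin (2 * pi * s) * ((inverse (sqrt (h (\<theta> s))) / 2) * (h' (\<theta> s) * (2 * pi * r * sin (2 * pi * s))))) (at s)"
    proof -
      have "((\<lambda>s. r * sin (2 * pi * s)) has_real_derivative r * (cos (2 * pi * s) * (2 * pi))) (at s)"
        by (auto intro!: derivative_eq_intros)
      from DERIV_mult[OF this \<open>((\<lambda>s. sqrt (h (\<theta> s))) has_real_derivative _) (at s)\<close>]
      show ?thesis unfolding p_def by (rule DERIV_cong) (simp add: mult.commute)
    qed
    define q where "q = sqrt (h (\<theta> s))"
    have q: "q > 0" "h (\<theta> s) = q * q" using hpos[of s] by (auto simp: q_def)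
    have *: "\<theta> s - c = - r * cos (2 * pi * s)" by (simp add: \<theta>_def)
    show "(p has_real_derivative e s * (?g' (\<theta> s) / 2)) (at s)"
      unfolding * sc[of s, unfolded *] e_def q_def[symmetric] q(2)
      using dp[folded q_def] q(1)
      by (elim DERIV_cong) (simp add: field_simps power2_eq_square)
    show "(g has_real_derivative ?g' x) (at x)"
      unfolding g[abs_def] using h(1)
      by (auto intro!: derivative_eq_intros)
    show "continuous_on UNIV ?g'" by (intro continuous_intros ch h(2))
    have "continuous_on UNIV (\<lambda>s. h (\<theta> s))"
      by (rule continuous_on_compose2[OF ch c\<theta>]) auto
    moreover have "h (\<theta> s) \<noteq> 0" for s using hpos[of s] by simp
    ultimately show "continuous_on UNIV e" unfolding e_def by (intro continuous_intros) auto
    show "e s > 0" using hpos[of s] by (simp add: e_def)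
    \<comment> \<open>At a turning point the momentum vanishes, but the zero of \<open>g\<close> is
      simple, so its derivative does not.\<close>
    show "p s \<noteq> 0 \<or> ?g' (\<theta> s) \<noteq> 0"
    proof (cases "sin (2 * pi * s) = 0")
      case True
      then have "cos (2 * pi * s) \<noteq> 0" using sin_cos_squared_add[of "2 * pi * s"] by auto
      then show ?thesis unfolding * sc[of s, unfolded *] True using r hpos[of s] by simp
    next
      case False
      then show ?thesis using r hpos[of s] by (simp add: p_def)
    qed
  qed
  show "\<theta> s = \<theta> t \<and> p s = p t \<longleftrightarrow> s - t \<in> \<int>" for s t
  proof -
    have "\<theta> s = \<theta> t \<longleftrightarrow> cos (2 * pi * s) = cos (2 * pi * t)" using r by (simp add: \<theta>_def)
    moreover have "p s = p t \<longleftrightarrow> sin (2 * pi * s) = sin (2 * pi * t)" if "\<theta> s = \<theta> t"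
      using r hpos[of t] by (simp add: p_def that)
    ultimately have "\<theta> s = \<theta> t \<and> p s = p t \<longleftrightarrow>
        sin (2 * pi * s) = sin (2 * pi * t) \<and> cos (2 * pi * s) = cos (2 * pi * t)" by auto
    also have "\<dots> \<longleftrightarrow> (\<exists>n::int. 2 * pi * s = 2 * pi * t + 2 * pi * of_int n)"
      by (rule sin_cos_eq_iff)
    also have "\<dots> \<longleftrightarrow> s - t \<in> \<int>"
    proof -
      have "2 * pi * s = 2 * pi * t + 2 * pi * of_int n \<longleftrightarrow> s - t = of_int n" for n
      proof -
        have "2 * pi * s = 2 * pi * t + 2 * pi * of_int n \<longleftrightarrow> 2 * pi * (s - t - of_int n) = 0"
          by (simp only: right_diff_distrib) linarith
        then show ?thesis by (simp only: mult_eq_0_iff) auto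
      qed
      then show ?thesis by (auto simp: Ints_def)
    qed
    finally show ?thesis .
  qed
  show "\<exists>s. \<theta> s = x \<and> p s = y" if x: "\<bar>x - c\<bar> \<le> r" and y: "y\<^sup>2 = g x" for x y
  proof -
    have hx: "h x > 0" by (rule pos[OF x])
    \<comment> \<open>\<open>a\<close> and \<open>b\<close> are the cosine and sine that the point
      (x, y) must have; the energy equation says that they lie on the unit circle.\<close>
    define a where "a = (c - x) / r"
    define b where "b = y / (r * sqrt (h x))"
    have "b\<^sup>2 = (r\<^sup>2 - (x - c)\<^sup>2) / r\<^sup>2"
      using y hx by (simp add: b_def power_divide power_mult_distrib g)
    then have "a\<^sup>2 + b\<^sup>2 = 1"
      using r by (simp add: a_def power_divide power2_commute[of c x] flip: add_divide_distrib)
    then obtain t where t: "a = cos t" "b = sin t" by (metis sincos_total_2pi)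
    define s where "s = t / (2 * pi)"
    have ts: "2 * pi * s = t" by (simp add: s_def)
    have "\<theta> s = x" using t(1) r by (simp add: \<theta>_def ts a_def flip: t(1))
    moreover from this have "p s = y" using r hx by (simp add: p_def ts b_def flip: t(2))
    ultimately show ?thesis by blast
  qed
qed

section \<open>Orbit integrals as integrals over a quarter period\<close>

lemma lborel_integral_reflect:
  fixes f :: "real \<Rightarrow> real"
  shows "(\<integral>x. f (m - x) \<partial>lborel) = (\<integral>x. f x \<partial>lborel)"
  using lborel_integral_real_affine[of "-1" f m] by simp

lemma lborel_integral_symmetric_half:
  fixes f :: "real \<Rightarrow> real"
  assumes int: "integrable lborel (\<lambda>x. indicator {m - d..m + d} x * f x)" and "d \<ge> 0"
    and sym: "\<And>x. f (2 * m - x) = f x"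
  shows "(\<integral>x. indicator {m - d..m + d} x * f x \<partial>lborel) = 2 * (\<integral>x. indicator {m - d..m} x * f x \<partial>lborel)"
    and "(\<integral>x. indicator {m..m + d} x * f x \<partial>lborel) = (\<integral>x. indicator {m - d..m} x * f x \<partial>lborel)"
proof -
  have sub: "integrable lborel (\<lambda>x. indicator A x * f x)" if "A \<subseteq> {m - d..m + d}" "A \<in> sets borel" for A
  proof -
    have "integrable lborel (\<lambda>x. indicator A x * (indicator {m - d..m + d} x * f x))"
      using integrable_mult_indicator[OF _ int, of A] that(2) by simp
    also have "(\<lambda>x. indicator A x * (indicator {m - d..m + d} x * f x)) = (\<lambda>x. indicator A x * f x)"
      using that(1) by (auto simp: indicator_def fun_eq_iff)
    finally show ?thesis .
  qed
  show eq: "(\<integral>x. indicator {m..m + d} x * f x \<partial>lborel) = (\<integral>x. indicator {m - d..m} x * f x \<partial>lborel)"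
  proof -
    have "(\<integral>x. indicator {m..m + d} x * f x \<partial>lborel)
        = (\<integral>x. indicator {m..m + d} (2 * m - x) * f (2 * m - x) \<partial>lborel)"
      by (rule lborel_integral_reflect[symmetric])
    also have "\<dots> = (\<integral>x. indicator {m - d..m} x * f x \<partial>lborel)"
      unfolding sym by (intro Bochner_Integration.integral_cong refl) (auto simp: indicator_def)
    finally show ?thesis .
  qed
  have "(\<integral>x. indicator {m - d..m + d} x * f x \<partial>lborel) =
      (\<integral>x. indicator {m - d..m} x * f x + indicator {m..m + d} x * f x \<partial>lborel)"
  proof (rule integral_cong_AE)
    show "AE x in lborel. indicator {m - d..m + d} x * f x = indicator {m - d..m} x * f x + indicator {m..m + d} x * f x"
      using AE_lborel_singleton[of m] by eventually_elim (use \<open>d \<ge> 0\<close> in \<open>auto simp: indicator_def\<close>)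
  qed (use sub[of "{m - d..m}"] sub[of "{m..m + d}"] int \<open>d \<ge> 0\<close> in auto)
  also have "\<dots> = 2 * (\<integral>x. indicator {m - d..m} x * f x \<partial>lborel)"
    using \<open>d \<ge> 0\<close> by (subst Bochner_Integration.integral_add) (auto intro!: sub simp: eq)
  finally show "(\<integral>x. indicator {m - d..m + d} x * f x \<partial>lborel) = 2 * (\<integral>x. indicator {m - d..m} x * f x \<partial>lborel)" .
qed

lemma borel_integral_Icc:
  fixes f :: "real \<Rightarrow> real"
  assumes "continuous_on {a..b} f"
  shows "integral {a..b} f = (\<integral>x. indicator {a..b} x * f x \<partial>lborel)"
    and "integrable lborel (\<lambda>x. indicator {a..b} x * f x)"
proof -
  have "set_integrable lborel {a..b} f"
    unfolding set_integrable_def by (rule borel_integrable_compact[OF compact_Icc assms])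
  from set_borel_integral_eq_integral(2)[OF this] this
  show "integral {a..b} f = (\<integral>x. indicator {a..b} x * f x \<partial>lborel)"
    "integrable lborel (\<lambda>x. indicator {a..b} x * f x)"
    by (simp_all add: set_lebesgue_integral_def set_integrable_def)
qed

text \<open>The reflections in 0 and w / 4 cut a period into four congruent pieces. The case
  distinction on the sign of \<open>g\<close> gives the result the same shape as for oscillations,
  where it matters.\<close>

lemma integral_rotation_orbit:
  fixes g G :: "real \<Rightarrow> real"
  assumes w: "w > 0" and g: "continuous_on UNIV g" and G: "continuous_on UNIV G" and pos: "\<And>x. g x > 0"
    and sym: "\<And>x. g (- x) = g x" "\<And>x. g (w / 2 - x) = g x" "\<And>x. G (- x) = G x" "\<And>x. G (w / 2 - x) = G x"
  shows "integral {0..1} (\<lambda>s. G (w * s) * (w / sqrt (g (w * s)))) =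
    4 * (\<integral>x. indicator {0..w / 4} x * (if g x > 0 then G x / sqrt (g x) else 0) \<partial>lborel)"
proof -
  define f where "f x = G x / sqrt (g x)" for x
  have cf: "continuous_on S f" for S
    unfolding f_def using continuous_on_subset[OF g subset_UNIV] continuous_on_subset[OF G subset_UNIV] pos
    by (intro continuous_intros) (auto simp: less_le)
  have fs: "f (w / 2 - x) = f x" "f (w - x) = f x" for x
  proof -
    show 1: "f (w / 2 - x) = f x" for x using sym by (simp add: f_def)
    have "f (w - x) = f (w / 2 - (x - w / 2))" by (rule arg_cong[of _ _ f]) simp
    also have "\<dots> = f (- (w / 2 - x))" unfolding 1 by (rule arg_cong[of _ _ f]) simp
    also have "\<dots> = f (w / 2 - x)" unfolding f_def by (simp only: sym)
    also have "\<dots> = f x" by (rule 1)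
    finally show "f (w - x) = f x" .
  qed
  have "integral {0..1} (\<lambda>s. G (w * s) * (w / sqrt (g (w * s)))) = integral {0..1} (\<lambda>s. f (w * s) * w)"
    by (simp add: f_def mult_ac)
  also have "\<dots> = (\<integral>s. indicator {0..1} s * (f (w * s) * w) \<partial>lborel)"
    by (intro borel_integral_Icc continuous_intros continuous_on_compose2[OF cf[of UNIV]]) auto
  also have "\<dots> = (\<integral>s. w * (indicator {0..w} (0 + w * s) * f (0 + w * s)) \<partial>lborel)"
    using w by (intro Bochner_Integration.integral_cong refl) (auto simp: indicator_def zero_le_mult_iff)
  also have "\<dots> = (\<integral>x. indicator {0..w} x * f x \<partial>lborel)"
    using w lborel_integral_real_affine[of w "\<lambda>x. indicator {0..w} x * f x" 0] by simp
  also have "\<dots> = 2 * (\<integral>x. indicator {0..w / 2} x * f x \<partial>lborel)"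
    using lborel_integral_symmetric_half(1)[of "w / 2" "w / 2" f] borel_integral_Icc(2)[OF cf] w fs by simp
  also have "(\<integral>x. indicator {0..w / 2} x * f x \<partial>lborel) = 2 * (\<integral>x. indicator {0..w / 4} x * f x \<partial>lborel)"
    using lborel_integral_symmetric_half(1)[of "w / 4" "w / 4" f] borel_integral_Icc(2)[OF cf] w fs by simp
  finally show ?thesis using pos by (simp add: f_def)
qed

text \<open>One revolution runs twice through [c - r, c + r], and the reflection in c halves this
  interval again; hence the factor 4. The half that is kept lies in the quarter period, to the right
  of c if c = 0 and to the left if c = w / 4, and by \<open>neg\<close> the rest of the quarter
  contributes nothing. Integrability at the turning points is inherited through the change of
  variables.\<close>

lemma integral_oscillation_orbit:
  fixes g h G :: "real \<Rightarrow> real"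
  assumes w: "w > 0" and r: "0 < r" "r < w / 4" and c: "c = 0 \<or> c = w / 4"
    and g: "\<And>x. g x = (r\<^sup>2 - (x - c)\<^sup>2) * h x"
    and h: "continuous_on UNIV h" and pos: "\<And>x. \<bar>x - c\<bar> \<le> r \<Longrightarrow> h x > 0"
    and neg: "\<And>x. 0 \<le> x \<Longrightarrow> x \<le> w / 4 \<Longrightarrow> \<bar>x - c\<bar> \<ge> r \<Longrightarrow> g x \<le> 0"
    and G: "continuous_on UNIV G"
    and sym: "\<And>x. g (- x) = g x" "\<And>x. g (w / 2 - x) = g x" "\<And>x. G (- x) = G x" "\<And>x. G (w / 2 - x) = G x"
  defines "\<theta> \<equiv> \<lambda>s. c - r * cos (2 * pi * s)"
  shows "integral {0..1} (\<lambda>s. G (\<theta> s) * (2 * pi / sqrt (h (\<theta> s)))) =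
    4 * (\<integral>x. indicator {0..w / 4} x * (if g x > 0 then G x / sqrt (g x) else 0) \<partial>lborel)"
proof -
  define f where "f x = (if g x > 0 then G x / sqrt (g x) else 0)" for x
  define q where "q s = G (\<theta> s) * (2 * pi / sqrt (h (\<theta> s)))" for s
  have fs: "f (2 * c - x) = f x" for x using sym c by (auto simp: f_def)
  have rng: "\<bar>\<theta> s - c\<bar> \<le> r" for s
  proof -
    have "\<bar>r * cos (2 * pi * s)\<bar> \<le> r * 1"
      unfolding abs_mult using r abs_cos_le_one by (intro mult_mono) auto
    then show ?thesis by (simp add: \<theta>_def)
  qed
  have c\<theta>: "continuous_on S \<theta>" for S unfolding \<theta>_def by (intro continuous_intros)
  have hn: "h (\<theta> s) \<noteq> 0" for s using pos[OF rng[of s]] by simp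
  have cq: "continuous_on S q" for S
    unfolding q_def using hn
    by (intro continuous_intros continuous_on_compose2[OF G c\<theta>] continuous_on_compose2[OF h c\<theta>]) auto
  have q1: "q (1 - s) = q s" for s
  proof -
    have "\<theta> (1 - s) = \<theta> s" by (simp add: \<theta>_def right_diff_distrib cos_diff)
    then show ?thesis by (simp add: q_def)
  qed
  have "integral {0..1} q = (\<integral>s. indicator {0..1} s * q s \<partial>lborel)"
    by (rule borel_integral_Icc(1)[OF cq])
  also have "\<dots> = 2 * (\<integral>s. indicator {0..1/2} s * q s \<partial>lborel)"
    using lborel_integral_symmetric_half(1)[of "1/2" "1/2" q] borel_integral_Icc(2)[OF cq] q1 by simp
  also have "(\<integral>s. indicator {0..1/2} s * q s \<partial>lborel) = integral {0..1/2} q"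
    by (rule borel_integral_Icc(1)[OF cq, symmetric])
  \<comment> \<open>At the end points the derivative of the cosine vanishes and the substitution
    formula \<open>eq\<close> fails, so the half revolution is taken open.\<close>
  also have "\<dots> = integral {0<..<1/2} q"
    by (rule integral_open_interval_real)
  finally have 1: "integral {0..1} q = 2 * integral {0<..<1/2} q" .
  have img: "\<theta> ` {0<..<1/2} = {c - r<..<c + r}"
  proof (intro equalityI subsetI)
    fix x assume "x \<in> \<theta> ` {0<..<1/2}"
    then obtain s where s: "0 < s" "s < 1/2" "x = \<theta> s" by auto
    have "sin (2 * pi * s) > 0" using s by (intro sin_gt_zero) auto
    then have "(sin (2 * pi * s))\<^sup>2 > 0" by simp
    then have "(cos (2 * pi * s))\<^sup>2 < 1" using sin_cos_squared_add[of "2 * pi * s"] by linarith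
    then have "\<bar>cos (2 * pi * s)\<bar> < 1" by (simp add: abs_square_less_1)
    then have "r * \<bar>cos (2 * pi * s)\<bar> < r * 1" using r by (intro mult_strict_left_mono) auto
    then have "\<bar>r * cos (2 * pi * s)\<bar> < r" using r by (simp add: abs_mult)
    then show "x \<in> {c - r<..<c + r}" by (auto simp: s \<theta>_def)
  next
    fix x assume x: "x \<in> {c - r<..<c + r}"
    define y where "y = (c - x) / r"
    have y: "-1 < y" "y < 1" using x r by (auto simp: y_def field_simps)
    have "\<theta> (arccos y / (2 * pi)) = x" using y r by (simp add: \<theta>_def) (simp add: y_def)
    moreover have "0 < arccos y" "arccos y < pi" using arccos_lt_bounded[OF y] by auto
    ultimately show "x \<in> \<theta> ` {0<..<1/2}"
      by (intro image_eqI[of _ _ "arccos y / (2 * pi)"]) auto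
  qed
  have inj: "inj_on \<theta> {0<..<1/2}"
  proof (rule inj_onI)
    fix s t :: real assume st: "s \<in> {0<..<1/2}" "t \<in> {0<..<1/2}" "\<theta> s = \<theta> t"
    then have "cos (2 * pi * s) = cos (2 * pi * t)" using r by (simp add: \<theta>_def)
    moreover have "0 \<le> 2 * pi * s" "2 * pi * s \<le> pi" "0 \<le> 2 * pi * t" "2 * pi * t \<le> pi"
      using st mult_left_mono[of "2 * s" 1 pi] mult_left_mono[of "2 * t" 1 pi] by auto
    ultimately have "2 * pi * s = 2 * pi * t" using cos_inj_pi by blast
    then show "s = t" by simp
  qed
  define \<theta>' where "\<theta>' s = 2 * pi * r * sin (2 * pi * s)" for s
  have d\<theta>: "(\<theta> has_real_derivative \<theta>' s) (at s within S)" for s S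
    unfolding \<theta>_def \<theta>'_def by (auto intro!: derivative_eq_intros)
  \<comment> \<open>The factor r sin in the derivative cancels against the same factor in the root
    of \<open>g\<close>; this removes the singularity.\<close>
  have eq: "\<bar>\<theta>' s\<bar> * f (\<theta> s) = q s" if s: "s \<in> {0<..<1/2}" for s
  proof -
    have sp: "sin (2 * pi * s) > 0" using s by (intro sin_gt_zero) auto
    have hp: "h (\<theta> s) > 0" by (rule pos[OF rng])
    have "(sin (2 * pi * s))\<^sup>2 = 1 - (cos (2 * pi * s))\<^sup>2" by (rule sin_squared_eq)
    then have "r\<^sup>2 - (\<theta> s - c)\<^sup>2 = (r * sin (2 * pi * s))\<^sup>2"
      by (simp add: \<theta>_def power_mult_distrib right_diff_distrib)
    then have "g (\<theta> s) = (r * sin (2 * pi * s))\<^sup>2 * h (\<theta> s)" by (simp add: g)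
    moreover have "sqrt ((r * sin (2 * pi * s))\<^sup>2 * h (\<theta> s)) = r * sin (2 * pi * s) * sqrt (h (\<theta> s))"
      using r sp by (simp add: real_sqrt_mult)
    ultimately show ?thesis using sp hp r
      by (simp add: f_def \<theta>'_def q_def abs_mult)
  qed
  have "q absolutely_integrable_on {0..1/2}"
    by (intro absolutely_integrable_continuous_real cq)
  then have "q absolutely_integrable_on {0<..<1/2}"
    by (rule set_integrable_subset) auto
  then have "(\<lambda>s. \<bar>\<theta>' s\<bar> * f (\<theta> s)) absolutely_integrable_on {0<..<1/2}"
    by (subst set_integrable_cong[OF refl refl eq]) auto
  moreover have "integral {0<..<1/2} (\<lambda>s. \<bar>\<theta>' s\<bar> * f (\<theta> s)) = integral {0<..<1/2} q"
    by (intro Henstock_Kurzweil_Integration.integral_cong eq)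
  ultimately have A: "f absolutely_integrable_on {c - r<..<c + r} \<and> integral {c - r<..<c + r} f = integral {0<..<1/2} q"
    using has_absolute_integral_change_of_variables_1'[OF _ d\<theta> inj, of f "integral {0<..<1/2} q"] by (simp add: img)
  have [measurable]: "f \<in> borel_measurable borel"
  proof -
    have [measurable]: "G \<in> borel_measurable borel" "h \<in> borel_measurable borel"
      using G h by (auto intro: borel_measurable_continuous_onI)
    show ?thesis unfolding f_def g by measurable
  qed
  have f0: "f x = 0" if "\<bar>x - c\<bar> = r" for x
  proof -
    have "(x - c)\<^sup>2 = r\<^sup>2" using that by (metis power2_abs)
    then show ?thesis by (simp add: f_def g)
  qed
  have ind: "indicator {c - r<..<c + r} x * f x = indicator {c - r..c + r} x * f x" for x
    using f0[of x] by (cases "\<bar>x - c\<bar> = r") (auto simp: indicator_def)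
  have I: "integrable lborel (\<lambda>x. indicator {c - r..c + r} x * f x)"
    using A unfolding set_integrable_def by (simp add: integrable_completion ind)
  have "integral {c - r<..<c + r} f = (\<integral>x. indicator {c - r..c + r} x * f x \<partial>lborel)"
    using A set_lebesgue_integral_eq_integral(2)[of "{c - r<..<c + r}" f]
    unfolding set_lebesgue_integral_def by (simp add: integral_completion ind)
  also have "\<dots> = 2 * (\<integral>x. indicator {0..w / 4} x * f x \<partial>lborel)"
  proof (cases "c = 0")
    case True
    have "f x = 0" if "0 \<le> x" "x \<le> w / 4" "x > r" for x
      using neg[of x] that True by (auto simp: f_def)
    then have "(\<lambda>x. indicator {c..c + r} x * f x) = (\<lambda>x. indicator {0..w / 4} x * f x)"
      using r True by (auto simp: indicator_def fun_eq_iff)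
    then show ?thesis using lborel_integral_symmetric_half[OF I _ fs] r by simp
  next
    case False
    then have cw: "c = w / 4" using c by simp
    have "f x = 0" if "0 \<le> x" "x \<le> w / 4" "x < c - r" for x
      using neg[of x] that cw by (auto simp: f_def)
    then have "(\<lambda>x. indicator {c - r..c} x * f x) = (\<lambda>x. indicator {0..w / 4} x * f x)"
      using r cw by (auto simp: indicator_def fun_eq_iff)
    then show ?thesis using lborel_integral_symmetric_half[OF I _ fs] r by simp
  qed
  finally show ?thesis using 1 A unfolding q_def f_def by simp
qed

section \<open>Covectors on the boundary\<close>

lemma smooth_fun_on_UNIV_derivative:
  assumes "smooth_fun_on UNIV f"
  obtains f' where "\<And>x. (f has_real_derivative f' x) (at x)" "continuous_on UNIV f'"
proof -
  obtain D where D0: "\<And>x. D 0 x = f x"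
    and D: "\<And>n x. (D n has_real_derivative D (Suc n) x) (at x)"
    using assms unfolding smooth_fun_on_def by auto
  have "D 0 = f" using D0 by auto
  then have "(f has_real_derivative D 1 x) (at x)" for x using D[of 0 x] by simp
  moreover have "continuous_on UNIV (D 1)" by (rule DERIV_continuous_on) (rule D)
  ultimately show thesis by (rule that)
qed

lemma fun_periodic_int:
  fixes f :: "real \<Rightarrow> 'a"
  assumes "\<And>x. f (x + w) = f x"
  shows "f (x + of_int m * w) = f x"
proof (induction m rule: int_induct[where k = 0])
  case (step1 i)
  have "f (x + of_int (i + 1) * w) = f (x + of_int i * w + w)" by (simp add: algebra_simps)
  then show ?case using step1 assms by simp
next
  case (step2 i)
  have "f (x + of_int i * w) = f (x + of_int (i - 1) * w + w)" by (simp add: algebra_simps)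
  then show ?case using step2 assms by simp
qed simp

locale classical_table =
  fixes T :: table
  assumes classical: "classical_liouville_table T"
begin

abbreviation "N \<equiv> hgt T"
abbreviation "w1 \<equiv> om1 T"
abbreviation "w2 \<equiv> om2 T"
abbreviation "f1 \<equiv> ph1 T"
abbreviation "f2 \<equiv> ph2 T"

lemma table: "liouville_table T" "condA1 T" "condA2 T" "condA3 T"
  using classical by (auto simp: classical_liouville_table_def liouville_table_def)

lemma sizes: "N > 0" "w1 > 0" "w2 > 0"
  using table(1) by (auto simp: liouville_table_def)

lemma smooth: "smooth_fun_on UNIV f1" "smooth_fun_on UNIV f2"
  using table(1) by (auto simp: liouville_table_def)

lemma even: "f1 (- t) = f1 t" "f2 (- t) = f2 t"
  using table(2) by (auto simp: condA1_def)

lemma half: "f1 (w1 / 2 - t) = f1 t" "f2 (w2 / 2 - t) = f2 t"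
proof -
  show "f1 (w1 / 2 - t) = f1 t" using classical by (simp add: classical_liouville_table_def)
  have "\<forall>t. f2 t = f2 (w2 / 2 - t)" using table(2) unfolding condA1_def by blast
  then show "f2 (w2 / 2 - t) = f2 t" by simp
qed

lemma periodic: "f1 (t + of_int m * w1) = f1 t" "f2 (t + of_int m * w2) = f2 t"
proof -
  show "f1 (t + of_int m * w1) = f1 t"
    by (rule fun_periodic_int) (use table(2) in \<open>auto simp: condA1_def\<close>)
  show "f2 (t + of_int m * w2) = f2 t"
    by (rule fun_periodic_int) (use table(2) in \<open>auto simp: condA1_def\<close>)
qed

lemma f2_le_f1: "f2 b \<le> f1 a"
  using table(2) by (auto simp: condA1_def)

lemma f2_nonneg: "0 \<le> f2 b"
  using table(2) by (auto simp: condA1_def)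

lemma nu1_le_f1: "nu1 T \<le> f1 a" and f2_le_nu1: "f2 b \<le> nu1 T"
proof -
  have "bdd_below (range f1)" using f2_le_f1[of 0] by (auto intro!: bdd_belowI)
  then show "nu1 T \<le> f1 a" unfolding nu1_def by (auto intro!: cInf_lower)
  have "bdd_above (range f2)" using f2_le_f1[of _ 0] by (auto intro!: bdd_aboveI)
  then have "f2 b \<le> Sup (range f2)" by (auto intro!: cSup_upper)
  then show "f2 b \<le> nu1 T" using table(3) unfolding condA2_def by simp
qed

lemma nu1_pos: "nu1 T > 0"
  using table(3) unfolding condA2_def by auto

lemma f1_eq_nu1: "f1 a = nu1 T \<longleftrightarrow> (\<exists>m::int. a = of_int m * (w1 / 2))"
  and f2_eq_nu1: "f2 b = nu1 T \<longleftrightarrow> (\<exists>m::int. b = w2 / 4 + of_int m * (w2 / 2))"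
  and f2_eq_0: "f2 b = 0 \<longleftrightarrow> (\<exists>m::int. b = of_int m * (w2 / 2))"
  using table(3) unfolding condA2_def by auto

lemma f1_eq_f2: "f1 a = f2 b \<longleftrightarrow> f1 a = nu1 T \<and> f2 b = nu1 T"
  using nu1_le_f1[of a] f2_le_nu1[of b] by auto

lemma ph3_N: "ph3 T N = nu3 T" "ph3 T (- N) = nu3 T" "nu3 T < 0"
proof -
  have N: "N \<in> {- N..N}" using sizes by auto
  show 1: "ph3 T N = nu3 T" by (simp add: nu3_def)
  have e: "\<forall>t\<in>{- N..N}. ph3 T (- t) = ph3 T t" using table(2) unfolding condA1_def by blast
  show "ph3 T (- N) = nu3 T" unfolding 1[symmetric] by (rule e[rule_format, OF N])
  have e: "\<forall>t\<in>{- N..N}. ph3 T t \<le> 0" using table(2) unfolding condA1_def by blast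
  have "ph3 T N \<le> 0" by (rule e[rule_format, OF N])
  moreover have e: "\<forall>t\<in>{- N..N}. ph3 T t = nu2 T \<longleftrightarrow> t = 0" and n: "nu2 T = 0"
    using table(3) unfolding condA2_def by blast+
  have "ph3 T N \<noteq> 0" using e[rule_format, OF N] sizes n by auto
  ultimately show "nu3 T < 0" unfolding 1 by simp
qed

lemma ph3_abs: "\<bar>c\<bar> = N \<Longrightarrow> ph3 T c = nu3 T"
proof -
  assume "\<bar>c\<bar> = N"
  then have "c = N \<or> c = - N" by auto
  then show ?thesis using ph3_N by auto
qed

text \<open>The value \<open>nu1 T\<close> separates the ranges of \<open>f2\<close> and
  \<open>f1\<close>, so the two functions can only agree at it, and they take it exactly at the
  coordinates of \<open>branch1 T\<close>. On the boundary, lying off the branch set thus becomes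
  the inequality \<open>f1 a \<noteq> f2 b\<close>, which is used throughout.\<close>

lemma branch1_iff: "\<bar>c\<bar> = N \<Longrightarrow> (a, b, c) \<in> branch1 T \<longleftrightarrow> f1 a = f2 b"
  unfolding f1_eq_f2 f1_eq_nu1 f2_eq_nu1 by (auto simp: branch1_def strip_def)

lemma not_branch2: "\<bar>c\<bar> = N \<Longrightarrow> (a, b, c) \<notin> branch2 T"
  using sizes by (auto simp: branch2_def)

lemma branch_iff: "\<bar>c\<bar> = N \<Longrightarrow> (a, b, c) \<in> branch T \<longleftrightarrow> f1 a = f2 b"
  by (simp add: branch_def branch1_iff not_branch2)

text \<open>The action of the deck transformations on covectors in \<open>d\<theta>\<close>-components; \<open>s = t = 1\<close>,
  \<open>s = t = - 1\<close> and \<open>s = 1, t = - 1\<close> are the identity, \<open>sigma1\<close> and \<open>sigma2\<close> up to period shifts.\<close>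

definition act :: "int \<Rightarrow> int \<Rightarrow> int \<Rightarrow> int \<Rightarrow> rep \<Rightarrow> rep" where
  "act s t m n = (\<lambda>((a, b, c), (e1, e2, e3)).
     ((of_int s * a + of_int m * w1, of_int t * b + of_int n * w2 + (1 - of_int s) / 4 * w2,
       of_int (s * t) * c), (of_int s * e1, of_int t * e2, of_int (s * t) * e3)))"

text \<open>The last term collects the half periods \<open>w2 / 2\<close> that come with s = -1. For
  signs s, s', t' the numerator is always a multiple of 4, so \<open>div\<close> is exact.\<close>

lemma act_act:
  assumes "s \<in> {1, -1}" "t \<in> {1, -1}" "s' \<in> {1, -1}" "t' \<in> {1, -1}"
  shows "act s' t' m' n' (act s t m n r) = act (s' * s) (t' * t) (s' * m + m')
     (t' * n + n' + (t' * (1 - s) + (1 - s') - (1 - s' * s)) div 4) r"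
proof -
  obtain a b c e1 e2 e3 where r: "r = ((a, b, c), (e1, e2, e3))" by (cases r) auto
  show ?thesis using assms
    by (auto simp: act_def r algebra_simps)
qed

lemma act_id: "act 1 1 0 0 r = r"
  by (cases r) (auto simp: act_def)

lemma act_regular:
  assumes "s \<in> {1, -1}" "t \<in> {1, -1}" "\<bar>c\<bar> = N" "act s t m n ((a, b, c), e) = ((a', b', c'), e')"
  shows "\<bar>c'\<bar> = N" "f1 a' = f1 a" "f2 b' = f2 b"
proof -
  obtain e1 e2 e3 where e: "e = (e1, e2, e3)" by (cases e) auto
  have a': "a' = of_int s * a + of_int m * w1"
    and b': "b' = of_int t * b + (1 - of_int s) / 4 * w2 + of_int n * w2"
    and c': "c' = of_int (s * t) * c"
    using assms(4) by (auto simp: act_def e)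
  show "\<bar>c'\<bar> = N" using assms(1-3) by (auto simp: c' abs_mult)
  show "f1 a' = f1 a" unfolding a' periodic using assms(1) even by auto
  \<comment> \<open>Evenness and the symmetry about \<open>w2 / 4\<close> make \<open>w2 / 2\<close>
    a period; this absorbs the half shift of \<open>sigma1\<close>.\<close>
  have "f2 (t' + w2 / 2) = f2 t'" for t'
  proof -
    have "f2 (t' + w2 / 2) = f2 (w2 / 2 - (- t'))" by (simp add: add.commute)
    also have "\<dots> = f2 t'" by (simp only: half even)
    finally show ?thesis .
  qed
  then show "f2 b' = f2 b" unfolding b' periodic using assms(1,2) even half by auto
qed

text \<open>Off the branch set the point and its images all fall under the last case of
  \<open>lsigma1\<close> and \<open>lsigma2\<close>, so the representatives form an orbit of a group
  acting linearly on the components.\<close>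

lemma covec_regular:
  assumes "\<bar>c\<bar> = N" "f1 a \<noteq> f2 b"
  shows "covec T ((a, b, c), e) = {act s t m n ((a, b, c), e) | s t m n. s \<in> {1, -1} \<and> t \<in> {1, -1}}"
    (is "_ = ?A")
proof -
  obtain e1 e2 e3 where e: "e = (e1, e2, e3)" by (cases e) auto
  define r where "r = ((a, b, c), e)"
  have nb: "(a', b', c') \<notin> branch1 T" "(a', b', c') \<notin> branch2 T"
    if "\<bar>c'\<bar> = N" "f1 a' \<noteq> f2 b'" for a' b' c'
    using that branch1_iff not_branch2 by auto
  have e2: "f1 a \<noteq> f2 (- b)" "\<bar>- c\<bar> = N" using assms even by auto
  have id: "lshift T m n (id r) = act 1 1 m n r" for m n
    by (simp add: r_def e lshift_def shift_def act_def)
  have 1: "lshift T m n (lsigma1 T r) = act (-1) (-1) m n r" for m n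
    using nb[OF assms] by (simp add: r_def e lshift_def shift_def act_def lsigma1_def sigma1_def)
  have 2: "lshift T m n (lsigma2 T r) = act 1 (-1) m n r" for m n
    using nb[OF assms] by (simp add: r_def e lshift_def shift_def act_def lsigma2_def sigma2_def)
  have 12: "lshift T m n ((lsigma1 T \<circ> lsigma2 T) r) = act (-1) 1 m n r" for m n
    using nb[OF assms] nb[OF e2(2,1)]
    by (simp add: r_def e lshift_def shift_def act_def lsigma2_def sigma2_def lsigma1_def sigma1_def)
  have "covec T r = (\<Union>m n. {lshift T m n (id r), lshift T m n (lsigma1 T r),
      lshift T m n (lsigma2 T r), lshift T m n ((lsigma1 T \<circ> lsigma2 T) r)})"
    unfolding covec_def by blast
  also have "\<dots> = {act s t m n r | s t m n. s \<in> {1, -1} \<and> t \<in> {1, -1}}"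
    unfolding id 1 2 12 by blast
  finally show ?thesis unfolding r_def .
qed

lemma covec_eq:
  assumes "\<bar>c\<bar> = N" "f1 a \<noteq> f2 b" and r': "r' \<in> covec T ((a, b, c), e)"
  shows "covec T r' = covec T ((a, b, c), e)"
proof -
  have sub: "r'' \<in> covec T r" if h: "\<bar>c\<bar> = N" "f1 a \<noteq> f2 b" "r = ((a, b, c), e)"
      "r' \<in> covec T r" "r'' \<in> covec T r'" for r r' r'' a b c e
  proof -
    obtain s t m n where st: "s \<in> {1, -1}" "t \<in> {1, -1}" and r': "r' = act s t m n r"
      using h(4) unfolding h(3) covec_regular[OF h(1,2)] by blast
    obtain a' b' c' e' where r'': "r' = ((a', b', c'), e')" by (cases r') auto
    have "act s t m n ((a, b, c), e) = ((a', b', c'), e')" using r' r'' h(3) by simp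
    from act_regular[OF st h(1) this] h(2) have "\<bar>c'\<bar> = N" "f1 a' \<noteq> f2 b'" by auto
    from covec_regular[OF this] h(5) obtain s' t' m' n' where
      "s' \<in> {1, -1}" "t' \<in> {1, -1}" "r'' = act s' t' m' n' r'"
      unfolding r'' by auto
    moreover have "s' * s \<in> {1, -1}" "t' * t \<in> {1, -1}" using calculation st by auto
    ultimately show ?thesis
      unfolding h(3) covec_regular[OF h(1,2)] using act_act[OF st] unfolding r' h(3) by blast
  qed
  obtain s t m n where st: "s \<in> {1, -1}" "t \<in> {1, -1}" and act: "r' = act s t m n ((a, b, c), e)"
    using r' assms by (auto simp: covec_regular)
  obtain a' b' c' e' where r'': "r' = ((a', b', c'), e')" by (cases r') auto
  from act_regular[OF st assms(1)] act r'' assms(2) have reg: "\<bar>c'\<bar> = N" "f1 a' \<noteq> f2 b'" by metis+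
  have "((a, b, c), e) \<in> covec T r'"
  proof -
    \<comment> \<open>The translation part of the inverse: signs are their own inverses, and
      \<open>n'\<close> cancels both the shift and the carry of \<open>act_act\<close>.\<close>
    define n' where "n' = - t * n - ((t * (1 - s) + (1 - s) - (1 - s * s)) div 4)"
    have "act s t (- s * m) n' r' = act (s * s) (t * t) 0 0 ((a, b, c), e)"
      unfolding act act_act[OF st st] n'_def by simp
    also have "s * s = 1" using st by auto
    also have "t * t = 1" using st by auto
    also note act_id
    finally show ?thesis using st covec_regular[OF reg] r'' by (metis (mono_tags, lifting) mem_Collect_eq)
  qed
  then show ?thesis using sub[OF assms(1,2) refl r'] sub[OF reg r''] by blast
qed

lemma covec_self: "r \<in> covec T r"
proof -
  have "r = lshift T 0 0 (id r)" by (cases r) (auto simp: lshift_def shift_def)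
  then show ?thesis unfolding covec_def by blast
qed

definition bdry_covec :: "real \<Rightarrow> real \<Rightarrow> real \<Rightarrow> real \<Rightarrow> brep set" where
  "bdry_covec a b p1 p2 = restr (covec T ((a, b, N), (p1, p2, 0)))"

lemma restr_covec_explicit:
  assumes "f1 a \<noteq> f2 b"
  shows "restr (covec T ((a, b, N), (p1, p2, p3))) =
    {((of_int s * a + of_int m * w1, of_int t * b + of_int n * w2 + (1 - of_int s) / 4 * w2,
       of_int (s * t) * N), (of_int s * p1, of_int t * p2)) | s t m n. s \<in> {1, -1} \<and> t \<in> {1, -1}}"
proof -
  have "\<bar>N\<bar> = N" using sizes by simp
  have image: "f ` {act s t m n r | s t m n. s \<in> {1, -1} \<and> t \<in> {1, -1}} =
      {f (act s t m n r) | s t m n. s \<in> {1, -1} \<and> t \<in> {1, -1}}" for f :: "rep \<Rightarrow> brep" and r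
    by blast
  show ?thesis
    unfolding restr_def covec_regular[OF \<open>\<bar>N\<bar> = N\<close> assms] image by (simp add: act_def)
qed

section \<open>Boundary covectors as classes of coordinates on the plane
  \<open>\<theta>\<^sub>3 = hgt T\<close>\<close>

lemma restr_covec:
  assumes "f1 a \<noteq> f2 b"
  shows "restr (covec T ((a, b, N), (p1, p2, p3))) = bdry_covec a b p1 p2"
  unfolding bdry_covec_def restr_covec_explicit[OF assms] ..

text \<open>These are the transformations \<open>act\<close> with s = t, the ones that preserve the
  third coordinate. Up to periods only \<open>sigma1\<close> survives: the boundary is a torus
  modulo this one involution.\<close>

definition rel :: "bcoord \<Rightarrow> bcoord \<Rightarrow> bool" where
  "rel z z' \<longleftrightarrow> (\<exists>s::int. \<exists>m n. s \<in> {1, -1} \<and>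
     fst (fst z') = of_int s * fst (fst z) + of_int m * w1 \<and>
     snd (fst z') = of_int s * snd (fst z) + of_int n * w2 + (1 - of_int s) / 4 * w2 \<and>
     fst (snd z') = of_int s * fst (snd z) \<and> snd (snd z') = of_int s * snd (snd z))"

definition bdry_class :: "bcoord \<Rightarrow> brep set" where
  "bdry_class z = bdry_covec (fst (fst z)) (snd (fst z)) (fst (snd z)) (snd (snd z))"

definition regular :: "bcoord set" where
  "regular = {z. f1 (fst (fst z)) \<noteq> f2 (snd (fst z))}"

lemma bdry_class_simp [simp]: "bdry_class ((a, b), (p1, p2)) = bdry_covec a b p1 p2"
  by (simp add: bdry_class_def)

lemma regular_iff: "((a, b), p) \<in> regular \<longleftrightarrow> f1 a \<noteq> f2 b"
  by (simp add: regular_def)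

lemma bdry_class_eq_iff:
  assumes "z \<in> regular"
  shows "bdry_class z = bdry_class z' \<longleftrightarrow> rel z z'"
proof -
  obtain a b p1 p2 where z: "z = ((a, b), (p1, p2))" by (cases z) auto
  obtain a' b' p1' p2' where z': "z' = ((a', b'), (p1', p2'))" by (cases z') auto
  have reg: "f1 a \<noteq> f2 b" using assms by (simp add: z regular_iff)
  have NN: "\<bar>N\<bar> = N" using sizes by simp
  show ?thesis
  proof
    assume eq: "bdry_class z = bdry_class z'"
    have "((a', b', N), (p1', p2')) \<in> bdry_covec a' b' p1' p2'"
      using imageI[OF covec_self[of "((a', b', N), (p1', p2', 0))"], of "\<lambda>(x, e1, e2, e3). (x, e1, e2)"]
      unfolding bdry_covec_def restr_def by simp
    then have "((a', b', N), (p1', p2')) \<in> bdry_covec a b p1 p2" using eq by (simp add: z z')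
    then obtain s t m n where st: "s \<in> {1, -1}" "t \<in> {1, -1::int}"
      and e: "a' = of_int s * a + of_int m * w1"
        "b' = of_int t * b + of_int n * w2 + (1 - of_int s) / 4 * w2"
        "N = of_int (s * t) * N" "p1' = of_int s * p1" "p2' = of_int t * p2"
      unfolding bdry_covec_def restr_covec_explicit[OF reg] by auto
    \<comment> \<open>Both lifts have third coordinate N > 0, so s t = 1.\<close>
    have "s = t" using st e(3) sizes by auto
    then show "rel z z'" unfolding rel_def z z' using st e by auto
  next
    assume "rel z z'"
    then obtain s m n where s: "s \<in> {1, -1}"
      and e: "a' = of_int s * a + of_int m * w1"
        "b' = of_int s * b + of_int n * w2 + (1 - of_int s) / 4 * w2"
        "p1' = of_int s * p1" "p2' = of_int s * p2"
      unfolding rel_def z z' by auto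
    have "((a', b', N), (p1', p2', 0)) = act s s m n ((a, b, N), (p1, p2, 0))"
      using s unfolding e act_def by auto
    then have "((a', b', N), (p1', p2', 0)) \<in> covec T ((a, b, N), (p1, p2, 0))"
      unfolding covec_regular[OF NN reg] using s by blast
    from covec_eq[OF NN reg this] show "bdry_class z = bdry_class z'" by (simp add: z z' bdry_covec_def)
  qed
qed

lemma rel_regular: "rel z z' \<Longrightarrow> z' \<in> regular \<longleftrightarrow> z \<in> regular"
proof -
  assume "rel z z'"
  then obtain s m n where s: "s \<in> {1, -1}"
    and e: "fst (fst z') = of_int s * fst (fst z) + of_int m * w1"
       "snd (fst z') = of_int s * snd (fst z) + of_int n * w2 + (1 - of_int s) / 4 * w2"
    unfolding rel_def by auto
  have "act s s m n ((fst (fst z), snd (fst z), N), (0, 0, 0)) =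
      ((fst (fst z'), snd (fst z'), N), (0, 0, 0))"
    unfolding act_def e using s by auto
  from act_regular[OF s s _ this] sizes show ?thesis by (simp add: regular_def)
qed

lemma proj_eq: "proj T x = (\<Union>m n. {shift T m n x, shift T m n (sigma1 T x),
      shift T m n (sigma2 x), shift T m n (sigma1 T (sigma2 x))})"
proof -
  have "proj T x = (\<Union>m n. (\<lambda>h. shift T m n (h x)) ` {id, sigma1 T, sigma2, sigma1 T \<circ> sigma2})"
    unfolding proj_def by blast
  then show ?thesis by simp
qed

lemma covec_eq_Union: "covec T r = (\<Union>m n. {lshift T m n r, lshift T m n (lsigma1 T r),
      lshift T m n (lsigma2 T r), lshift T m n (lsigma1 T (lsigma2 T r))})"
proof -
  have "covec T r = (\<Union>m n. (\<lambda>h. lshift T m n (h r)) ` {id, lsigma1 T, lsigma2 T, lsigma1 T \<circ> lsigma2 T})"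
    unfolding covec_def by blast
  then show ?thesis by simp
qed

lemma foot_restr_covec: "foot (restr (covec T (x, e))) = proj T x"
proof -
  have f: "fst (lshift T m n r) = shift T m n (fst r)" "fst (lsigma1 T r) = sigma1 T (fst r)"
    "fst (lsigma2 T r) = sigma2 (fst r)" for m n r
    by (cases r; auto simp: lshift_def lsigma1_def lsigma2_def)+
  have "foot (restr (covec T (x, e))) = fst ` covec T (x, e)"
    unfolding foot_def restr_def by (force simp: image_iff)
  also have "\<dots> = proj T x"
    unfolding covec_eq_Union proj_eq by (simp add: image_UN f)
  finally show ?thesis .
qed

lemma foot_bdry_covec: "foot (bdry_covec a b p1 p2) = proj T (a, b, N)"
  unfolding bdry_covec_def by (rule foot_restr_covec)

lemma proj_bdry: "proj T (a, b, N) \<in> bdry T"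
  using sizes by (auto simp: bdry_def)

lemma restr_covec_TGamma: "restr (covec T ((a, b, N), e)) \<in> TGamma T"
proof -
  have "(a, b, N) \<in> strip T" using sizes by (simp add: strip_def)
  then have "covec T ((a, b, N), e) \<in> TX T" unfolding TX_def by blast
  moreover have "foot (covec T ((a, b, N), e)) \<in> bdry T"
    using foot_restr_covec[of "(a, b, N)" e] proj_bdry[of a b]
    by (simp add: foot_def restr_def image_image split_beta)
  ultimately show ?thesis unfolding TGamma_def by blast
qed

lemma bdry_covec_TGamma: "bdry_covec a b p1 p2 \<in> TGamma T"
  unfolding bdry_covec_def by (rule restr_covec_TGamma)

text \<open>\<phi>1 - \<phi>2 is deck invariant, so regularity of a point can be read off from any
  lift, before \<open>covec_regular\<close> is available.\<close>

lemma fst_covec_regular: "x' \<in> proj T (a, b, c) \<Longrightarrow> f1 (fst x') - f2 (fst (snd x')) = f1 a - f2 b"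
proof -
  assume "x' \<in> proj T (a, b, c)"
  then obtain m n where "x' \<in> {shift T m n (a, b, c), shift T m n (sigma1 T (a, b, c)),
      shift T m n (sigma2 (a, b, c)), shift T m n (sigma1 T (sigma2 (a, b, c)))}"
    unfolding proj_eq by blast
  moreover have "f2 (w2 / 2 + b) = f2 b" using half(2)[of "- b"] even by simp
  moreover have "f1 (of_int m * w1 - a) = f1 a" "f2 (of_int n * w2 - b) = f2 b"
    using periodic(1)[of "- a" m] periodic(2)[of "- b" n] even by simp_all
  ultimately show ?thesis
    using even half periodic by (auto simp: shift_def sigma1_def sigma2_def)
qed

lemma the_elem_image_const: "x \<in> A \<Longrightarrow> (\<And>y. y \<in> A \<Longrightarrow> f y = v) \<Longrightarrow> the_elem (f ` A) = v"
  by (metis empty_iff the_elem_image_unique)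

text \<open>The three forms are diagonal, so the signs introduced by deck transformations square
  away.\<close>

lemma on_cov_covec:
  assumes reg: "f1 a \<noteq> f2 b" and Q: "Q \<in> {gform T, Iform1 T, Iform2 T}"
  shows "on_cov T Q (covec T ((a, b, N), (p1, p2, p3))) = Q (a, b, N) (sharp T (a, b, N) (p1, p2, p3))"
  unfolding on_cov_def
proof (rule the_elem_image_const[OF covec_self])
  fix r assume "r \<in> covec T ((a, b, N), (p1, p2, p3))"
  moreover have NN: "\<bar>N\<bar> = N" using sizes by simp
  ultimately obtain s t m n where st: "s \<in> {1, -1}" "t \<in> {1, -1}"
    and r: "r = act s t m n ((a, b, N), (p1, p2, p3))"
    unfolding covec_regular[OF NN reg] by blast
  obtain a' b' c' e' where r': "r = ((a', b', c'), e')" by (cases r) auto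
  have "act s t m n ((a, b, N), (p1, p2, p3)) = ((a', b', c'), e')" using r r' by simp
  from act_regular[OF st NN this] have c: "\<bar>c'\<bar> = N" and ab: "f1 a' = f1 a" "f2 b' = f2 b" by auto
  have e': "e' = (of_int s * p1, of_int t * p2, of_int (s * t) * p3)"
    using r r' by (simp add: act_def)
  have "(a', b', c') \<notin> branch T" using branch_iff[OF c] ab reg by simp
  moreover have "(of_int s)\<^sup>2 = (1::real)" "(of_int t)\<^sup>2 = (1::real)" using st by auto
  ultimately show "on_rep T Q r = Q (a, b, N) (sharp T (a, b, N) (p1, p2, p3))"
    using Q unfolding on_rep_def r' e'
    by (auto simp: ab ph3_abs[OF c] ph3_N power_mult_distrib power_divide)
qed

section \<open>Metric, inward lift and integrals off the branch set\<close>

definition P1 where "P1 a b = (f1 a - f2 b) * (f1 a - nu3 T)"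
definition P2 where "P2 a b = (f1 a - f2 b) * (f2 b - nu3 T)"
definition P3 where "P3 a b = (f1 a - nu3 T) * (f2 b - nu3 T)"
definition tangential_norm2 where "tangential_norm2 a b p1 p2 = p1\<^sup>2 / P1 a b + p2\<^sup>2 / P2 a b"

lemma Pi_eqs: "Pi1 T (a, b, N) = P1 a b" "Pi2 T (a, b, N) = P2 a b" "Pi3 T (a, b, N) = P3 a b"
  by (auto simp: P1_def P2_def P3_def ph3_N)

lemma P_pos: "P3 a b > 0" "f1 a \<noteq> f2 b \<Longrightarrow> P1 a b > 0" "f1 a \<noteq> f2 b \<Longrightarrow> P2 a b > 0"
proof -
  have "f1 a - nu3 T > 0" "f2 b - nu3 T > 0"
    using nu1_le_f1[of a] nu1_pos ph3_N(3) f2_nonneg[of b] by auto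
  moreover have "f1 a - f2 b > 0" if "f1 a \<noteq> f2 b" using f2_le_f1[of b a] that by simp
  ultimately show "P3 a b > 0" "f1 a \<noteq> f2 b \<Longrightarrow> P1 a b > 0" "f1 a \<noteq> f2 b \<Longrightarrow> P2 a b > 0"
    by (auto simp: P1_def P2_def P3_def)
qed

lemma gform_sharp:
  assumes "f1 a \<noteq> f2 b"
  shows "gform T (a, b, N) (sharp T (a, b, N) (p1, p2, p3)) = tangential_norm2 a b p1 p2 + p3\<^sup>2 / P3 a b"
proof -
  have *: "P * (p / P)\<^sup>2 = p\<^sup>2 / P" if "P > 0" for P p :: real
    using that by (simp add: power2_eq_square)
  show ?thesis
    using P_pos[of a b] assms *
    by (simp add: Pi_eqs tangential_norm2_def del: Pi1.simps Pi2.simps Pi3.simps)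
qed

lemma bnorm2_bdry_covec:
  assumes "f1 a \<noteq> f2 b"
  shows "bnorm2 T (bdry_covec a b p1 p2) = tangential_norm2 a b p1 p2"
proof -
  have "(\<lambda>(x, e1, e2). on_rep T (gform T) (x, e1, e2, 0)) ` bdry_covec a b p1 p2 =
     on_rep T (gform T) ` (covec T ((a, b, N), (p1, p2, 0)))"
  proof -
    have NN: "\<bar>N\<bar> = N" using sizes by simp
    have 0: "snd (snd (snd r)) = 0" if "r \<in> covec T ((a, b, N), (p1, p2, 0))" for r
      using that unfolding covec_regular[OF NN assms] act_def by auto
    have "(case (\<lambda>(x, e1, e2, e3). (x, e1, e2)) r of (x, e1, e2) \<Rightarrow> on_rep T (gform T) (x, e1, e2, 0))
        = on_rep T (gform T) r" if "r \<in> covec T ((a, b, N), (p1, p2, 0))" for r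
    proof -
      obtain x e1 e2 e3 where r: "r = (x, e1, e2, e3)" by (cases r) auto
      have "e3 = 0" using 0[OF that] by (simp add: r)
      then show ?thesis by (simp add: r)
    qed
    then show ?thesis unfolding bdry_covec_def restr_def image_image by (intro image_cong refl)
  qed
  then have "bnorm2 T (bdry_covec a b p1 p2) = on_cov T (gform T) (covec T ((a, b, N), (p1, p2, 0)))"
    by (simp add: bnorm2_def on_cov_def)
  then show ?thesis unfolding on_cov_covec[OF assms insertI1] gform_sharp[OF assms] by simp
qed

lemma bdry_covec_BGamma_iff: "f1 a \<noteq> f2 b \<Longrightarrow> bdry_covec a b p1 p2 \<in> BGamma T \<longleftrightarrow> tangential_norm2 a b p1 p2 < 1"
  by (simp add: BGamma_def bdry_covec_TGamma bnorm2_bdry_covec)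

text \<open>A deck transformation with s t = -1 reverses both the third component and the sign of
  \<theta>3 in \<open>inward_normal\<close>; the two reversals cancel.\<close>

lemma normal_pairing_covec:
  assumes reg: "f1 a \<noteq> f2 b"
  shows "normal_pairing T (covec T ((a, b, N), (p1, p2, p3))) = - p3 / sqrt (P3 a b)"
  unfolding normal_pairing_def
proof (rule the_elem_image_const[OF covec_self])
  fix r assume "r \<in> covec T ((a, b, N), (p1, p2, p3))"
  moreover have NN: "\<bar>N\<bar> = N" using sizes by simp
  ultimately obtain s t m n where st: "s \<in> {1, -1}" "t \<in> {1, -1}"
    and r: "r = act s t m n ((a, b, N), (p1, p2, p3))"
    unfolding covec_regular[OF NN reg] by blast
  obtain a' b' c' e' where r': "r = ((a', b', c'), e')" by (cases r) auto
  have "act s t m n ((a, b, N), (p1, p2, p3)) = ((a', b', c'), e')" using r r' by simp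
  from act_regular[OF st NN this] have c: "\<bar>c'\<bar> = N" and ab: "f1 a' = f1 a" "f2 b' = f2 b" by auto
  have e': "e' = (of_int s * p1, of_int t * p2, of_int (s * t) * p3)" "c' = of_int (s * t) * N"
    using r r' by (auto simp: act_def)
  have "Pi3 T (a', b', c') = P3 a b" by (simp add: ab ph3_abs[OF c] P3_def)
  moreover have "sgn c' = of_int (s * t)" using st sizes unfolding e' by auto
  ultimately have "e' \<bullet> inward_normal T (a', b', c') = - (of_int (s * t) * of_int (s * t)) * p3 / sqrt (P3 a b)"
    unfolding e'(1) inward_normal_def by simp
  also have "of_int (s * t) * of_int (s * t) = (1::real)" using st by auto
  finally show "(case r of (x, e) \<Rightarrow> e \<bullet> inward_normal T x) = - p3 / sqrt (P3 a b)"
    unfolding r' by simp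
qed

text \<open>Any candidate has a representative over the lift (a, b, N) with the given tangential
  components, so only its third component is free. Unit norm fixes its square, and at \<theta>3 = N
  inward means decreasing \<theta>3, hence the negative root.\<close>

lemma pi_plus_bdry_covec:
  assumes reg: "f1 a \<noteq> f2 b" and "tangential_norm2 a b p1 p2 < 1"
  shows "pi_plus T (bdry_covec a b p1 p2) =
    covec T ((a, b, N), (p1, p2, - sqrt (P3 a b * (1 - tangential_norm2 a b p1 p2))))" (is "_ = covec T ((a, b, N), (p1, p2, ?p3))")
  unfolding pi_plus_def
proof (rule the_equality)
  have pos: "P3 a b > 0" "P3 a b * (1 - tangential_norm2 a b p1 p2) > 0" using P_pos(1)[of a b] assms(2) by auto
  have "(a, b, N) \<in> strip T" using sizes by (simp add: strip_def)
  then have "covec T ((a, b, N), (p1, p2, ?p3)) \<in> TX T" unfolding TX_def by blast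
  moreover have "tangential_norm2 a b p1 p2 + ?p3\<^sup>2 / P3 a b = 1" using pos by simp
  ultimately show "covec T ((a, b, N), (p1, p2, ?p3)) \<in> TX T \<and>
     restr (covec T ((a, b, N), (p1, p2, ?p3))) = bdry_covec a b p1 p2 \<and>
     on_cov T (gform T) (covec T ((a, b, N), (p1, p2, ?p3))) = 1 \<and>
     normal_pairing T (covec T ((a, b, N), (p1, p2, ?p3))) > 0"
    using restr_covec[OF reg] on_cov_covec[OF reg, of "gform T"] gform_sharp[OF reg]
      normal_pairing_covec[OF reg] pos by simp
next
  have pos: "P3 a b > 0" "P3 a b * (1 - tangential_norm2 a b p1 p2) > 0" using P_pos(1)[of a b] assms(2) by auto
  fix \<zeta> assume \<zeta>: "\<zeta> \<in> TX T \<and> restr \<zeta> = bdry_covec a b p1 p2 \<and> on_cov T (gform T) \<zeta> = 1 \<and> normal_pairing T \<zeta> > 0"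
  then obtain x e where xe: "\<zeta> = covec T (x, e)" unfolding TX_def by auto
  have "((a, b, N), (p1, p2)) \<in> bdry_covec a b p1 p2"
    using imageI[OF covec_self[of "((a, b, N), (p1, p2, 0))"], of "\<lambda>(x, e1, e2, e3). (x, e1, e2)"]
    unfolding bdry_covec_def restr_def by simp
  then have "((a, b, N), (p1, p2)) \<in> restr \<zeta>" using \<zeta> by simp
  then obtain p3 where p3: "((a, b, N), (p1, p2, p3)) \<in> \<zeta>" unfolding restr_def by auto
  obtain x1 x2 x3 where x: "x = (x1, x2, x3)" by (cases x) auto
  have "(a, b, N) \<in> foot (restr \<zeta>)" using p3 unfolding foot_def restr_def by force
  then have "(a, b, N) \<in> proj T x" unfolding xe foot_restr_covec .
  then have ab: "f1 a - f2 b = f1 x1 - f2 x2" and N: "\<bar>x3\<bar> = N"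
    using fst_covec_regular[of "(a, b, N)" x1 x2 x3] sizes
    by (auto simp: x proj_eq shift_def sigma1_def sigma2_def)
  have "f1 x1 \<noteq> f2 x2" using ab reg by simp
  from covec_eq[OF N this] have \<zeta>': "\<zeta> = covec T ((a, b, N), (p1, p2, p3))"
    using p3 unfolding xe x by metis
  have "tangential_norm2 a b p1 p2 + p3\<^sup>2 / P3 a b = 1" "p3 < 0"
    using \<zeta> unfolding \<zeta>' normal_pairing_covec[OF reg]
    using on_cov_covec[OF reg, of "gform T"] gform_sharp[OF reg] pos
    by (auto simp: divide_less_0_iff)
  then have "p3\<^sup>2 = P3 a b * (1 - tangential_norm2 a b p1 p2)" using pos by (simp add: field_simps)
  then have "\<bar>p3\<bar> = sqrt (P3 a b * (1 - tangential_norm2 a b p1 p2))" by (metis real_sqrt_abs)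
  then have "p3 = ?p3" using \<open>p3 < 0\<close> by simp
  then show "\<zeta> = covec T ((a, b, N), (p1, p2, ?p3))" using \<zeta>' by simp
qed

lemma normal_pairing_bdry_covec:
  assumes "f1 a \<noteq> f2 b" "tangential_norm2 a b p1 p2 < 1"
  shows "normal_pairing T (pi_plus T (bdry_covec a b p1 p2)) = sqrt (1 - tangential_norm2 a b p1 p2)"
  unfolding pi_plus_bdry_covec[OF assms] normal_pairing_covec[OF assms(1)]
  using P_pos(1)[of a b] by (simp add: real_sqrt_mult)

definition F1_reg where "F1_reg a b p1 p2 = f1 a + f2 b - (p1\<^sup>2 + p2\<^sup>2) / (f1 a - f2 b)"
definition F2_reg where "F2_reg a b p1 p2 = f1 a * f2 b - (f2 b * p1\<^sup>2 + f1 a * p2\<^sup>2) / (f1 a - f2 b)"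

text \<open>Unit norm eliminates the third component. In \<open>F1\<close>, for instance, p1^2 /
  \<open>P1 a b\<close> is left with the coefficient -(\<open>f1 a\<close> - \<open>nu3 T\<close>),
  which cancels a factor of \<open>P1 a b\<close>; thus \<open>nu3 T\<close> disappears from both
  integrals.\<close>

lemma F_bdry_covec:
  assumes reg: "f1 a \<noteq> f2 b" and "tangential_norm2 a b p1 p2 < 1"
  shows "F1 T (bdry_covec a b p1 p2) = F1_reg a b p1 p2" "F2 T (bdry_covec a b p1 p2) = F2_reg a b p1 p2"
proof -
  define p3 where "p3 = - sqrt (P3 a b * (1 - tangential_norm2 a b p1 p2))"
  have pos: "P3 a b > 0" "P1 a b > 0" "P2 a b > 0" using P_pos[of a b] reg by auto
  have p3: "p3\<^sup>2 / P3 a b = 1 - tangential_norm2 a b p1 p2" using pos assms(2) by (simp add: p3_def)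
  have *: "P * (p / P)\<^sup>2 = p\<^sup>2 / P" if "P > 0" for P p :: real
    using that by (simp add: power2_eq_square)
  define x1 x2 where "x1 = p1\<^sup>2 / P1 a b" and "x2 = p2\<^sup>2 / P2 a b"
  have p: "p1\<^sup>2 = x1 * P1 a b" "p2\<^sup>2 = x2 * P2 a b" using pos by (auto simp: x1_def x2_def)
  have d: "(p1\<^sup>2 + p2\<^sup>2) / (f1 a - f2 b) = x1 * (f1 a - nu3 T) + x2 * (f2 b - nu3 T)"
    "(f2 b * p1\<^sup>2 + f1 a * p2\<^sup>2) / (f1 a - f2 b) = f2 b * x1 * (f1 a - nu3 T) + f1 a * x2 * (f2 b - nu3 T)"
    using reg unfolding p P1_def P2_def by (auto simp: divide_simps) (auto simp: algebra_simps)
  have tangential_norm2: "tangential_norm2 a b p1 p2 = x1 + x2" by (simp add: tangential_norm2_def x1_def x2_def)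
  have "F1 T (bdry_covec a b p1 p2) = (f2 b + nu3 T) * x1 + (f1 a + nu3 T) * x2 + (f1 a + f2 b) * (1 - tangential_norm2 a b p1 p2)"
    unfolding F1_def pi_plus_bdry_covec[OF assms] p3_def[symmetric] p3[symmetric] x1_def x2_def
    using on_cov_covec[OF reg, of "Iform1 T"] *[OF pos(1)] *[OF pos(2)] *[OF pos(3)]
    by (simp add: Pi_eqs ph3_N mult.assoc del: Pi1.simps Pi2.simps Pi3.simps)
  then show "F1 T (bdry_covec a b p1 p2) = F1_reg a b p1 p2"
    unfolding F1_reg_def d tangential_norm2 by (simp add: algebra_simps)
  have "F2 T (bdry_covec a b p1 p2) = f2 b * nu3 T * x1 + f1 a * nu3 T * x2 + f1 a * f2 b * (1 - tangential_norm2 a b p1 p2)"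
    unfolding F2_def pi_plus_bdry_covec[OF assms] p3_def[symmetric] p3[symmetric] x1_def x2_def
    using on_cov_covec[OF reg, of "Iform2 T"] *[OF pos(1)] *[OF pos(2)] *[OF pos(3)]
    by (simp add: Pi_eqs ph3_N mult.assoc del: Pi1.simps Pi2.simps Pi3.simps)
  then show "F2 T (bdry_covec a b p1 p2) = F2_reg a b p1 p2"
    unfolding F2_reg_def d tangential_norm2 by (simp add: algebra_simps)
qed

end

section \<open>Boundary charts\<close>

text \<open>The branch cut of \<open>csqrt\<close> is invisible to sets that are symmetric in the sign of the root.\<close>

lemma open_csqrt_vimage:
  fixes W :: "(complex \<times> 'b::metric_space) set"
  assumes W: "open W" and sym: "\<And>w e. (w, e) \<in> W \<Longrightarrow> (- w, e) \<in> W"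
  shows "open {((y1, y2), e). (csqrt (Complex y1 y2), e) \<in> W}" (is "open ?S")
proof (subst open_subopen, rule ballI)
  fix z assume "z \<in> ?S"
  then obtain y1 y2 e where z: "z = ((y1, y2), e)" and e: "(csqrt (Complex y1 y2), e) \<in> W" by auto
  define w0 where "w0 = csqrt (Complex y1 y2)"
  obtain A B where AB': "open A" "open B" "(w0, e) \<in> A \<times> B" and sub: "A \<times> B \<subseteq> W"
    by (rule open_prod_elim[OF W e[folded w0_def]])
  then have AB: "open A" "open B" "w0 \<in> A" "e \<in> B" by auto
  obtain \<epsilon> where \<epsilon>: "\<epsilon> > 0" "ball w0 \<epsilon> \<subseteq> A" using AB(1,3) open_contains_ball_eq by blast
  have cont: "continuous_on UNIV (\<lambda>y. Complex (fst y) (snd y))"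
    by (intro continuous_intros)
  define Y where "Y = {y. dist (Complex (fst y) (snd y)) (Complex y1 y2) < \<epsilon>\<^sup>2}"
  have "open Y" unfolding Y_def by (intro open_Collect_less continuous_intros cont)
  then have "open (Y \<times> B)" using AB by (intro open_Times)
  moreover have "z \<in> Y \<times> B" using AB \<epsilon> by (simp add: z Y_def)
  moreover have "Y \<times> B \<subseteq> ?S"
  proof
    fix z' assume "z' \<in> Y \<times> B"
    then obtain u1 u2 e' where z': "z' = ((u1, u2), e')" "(u1, u2) \<in> Y" "e' \<in> B" by auto
    define w where "w = csqrt (Complex u1 u2)"
    \<comment> \<open>The squares differ by less than \<epsilon>^2, so one of w and -w is within
      \<epsilon> of w0, and the symmetry of W makes either one good enough.\<close>
    have "(w - w0) * (w + w0) = w\<^sup>2 - w0\<^sup>2" by (simp add: power2_eq_square algebra_simps)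
    also have "\<dots> = Complex u1 u2 - Complex y1 y2" by (simp add: w_def w0_def)
    finally have "cmod (w - w0) * cmod (w + w0) < \<epsilon>\<^sup>2"
      using z'(2) by (simp add: Y_def dist_norm flip: norm_mult)
    then have "cmod (w - w0) < \<epsilon> \<or> cmod (w + w0) < \<epsilon>"
      using mult_mono[of \<epsilon> "cmod (w - w0)" \<epsilon> "cmod (w + w0)"] \<epsilon>(1)
      unfolding power2_eq_square by linarith
    then have "w \<in> ball w0 \<epsilon> \<or> - w \<in> ball w0 \<epsilon>"
      by (simp add: dist_norm norm_minus_commute add.commute)
    then have "(w, e') \<in> W \<or> (- w, e') \<in> W" using \<epsilon>(2) sub z'(3) by blast
    then have "(w, e') \<in> W" using sym[of "- w" e'] by auto
    then show "z' \<in> ?S" by (simp add: z' w_def)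
  qed
  ultimately show "\<exists>U. open U \<and> z \<in> U \<and> U \<subseteq> ?S" by blast
qed

context classical_table
begin

lemma continuous_f: "continuous_on UNIV f1" "continuous_on UNIV f2"
  using smooth smooth_fun_on_UNIV_derivative DERIV_continuous_on by metis+

lemma continuous_on_f [continuous_intros]:
  "continuous_on S g \<Longrightarrow> continuous_on S (\<lambda>x. f1 (g x))"
  "continuous_on S g \<Longrightarrow> continuous_on S (\<lambda>x. f2 (g x))"
  using continuous_on_compose2[OF continuous_f(1)] continuous_on_compose2[OF continuous_f(2)] by auto

lemma open_regular: "open regular"
proof -
  have "regular = {z. f1 (fst (fst z)) \<noteq> f2 (snd (fst z))}" by (simp add: regular_def)
  also have "open \<dots>" by (intro open_Collect_neq continuous_intros)
  finally show ?thesis .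
qed

lemma regular_chart:
  assumes "f1 a0 \<noteq> f2 b0"
  shows "z \<in> bparam_dom T (a0, b0, N) \<longleftrightarrow> z \<in> regular" "bparam T (a0, b0, N) z = bdry_class z"
proof -
  have NN: "\<bar>N\<bar> = N" using sizes by simp
  obtain a b p1 p2 where z: "z = ((a, b), (p1, p2))" by (cases z) auto
  have nb: "(a0, b0, N) \<notin> branch1 T" "(a0, b0, N) \<notin> branch2 T"
    using branch1_iff[OF NN] not_branch2[OF NN] assms by auto
  show "z \<in> bparam_dom T (a0, b0, N) \<longleftrightarrow> z \<in> regular"
    using nb NN branch_iff[OF NN]
    by (simp add: z bparam_dom_def chart_dom_def strip_def regular_def)
  show "bparam T (a0, b0, N) z = bdry_class z"
    using nb by (simp add: z bparam_def param_def bdry_covec_def)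
qed

text \<open>With the complex chart coordinate w^2, this is the lift at w together with the covector
  e pulled back by squaring. At w = 0 the pull-back is zero whatever e is, so only the value ((a0,
  b0), (0, 0)) occurs over a branch point.\<close>

definition branch_coord :: "real \<Rightarrow> real \<Rightarrow> complex \<times> (real \<times> real) \<Rightarrow> bcoord" where
  "branch_coord a0 b0 = (\<lambda>(w, e). ((a0 + Re w, b0 + Im w),
     (2 * Re w * fst e + 2 * Im w * snd e, - 2 * Im w * fst e + 2 * Re w * snd e)))"

lemma branch_chart:
  assumes "f1 a0 = f2 b0" and w: "w = csqrt (Complex y1 y2)"
  shows "((y1, y2), e) \<in> bparam_dom T (a0, b0, N) \<longleftrightarrow> branch_coord a0 b0 (w, e) \<in> regular \<or> w = 0"
    and "branch_coord a0 b0 (w, e) \<in> regular \<Longrightarrow> bparam T (a0, b0, N) ((y1, y2), e) = bdry_class (branch_coord a0 b0 (w, e))"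
    and "w = 0 \<Longrightarrow> bparam T (a0, b0, N) ((y1, y2), e) = bdry_covec a0 b0 (fst e) (snd e)"
proof -
  have NN: "\<bar>N\<bar> = N" using sizes by simp
  have b1: "(a0, b0, N) \<in> branch1 T" using branch1_iff[OF NN] assms by simp
  have wz: "w = 0 \<longleftrightarrow> Re w = 0 \<and> Im w = 0" by (simp add: complex_eq_iff)
  obtain e1 e2 where e: "e = (e1, e2)" by (cases e)
  have lift: "lift T (a0, b0, N) (y1, y2, N) = (a0 + Re w, b0 + Im w, N)"
    using b1 by (simp add: w)
  have axis: "axis T (a0, b0, N) = {(a0, b0, z) | z. True}" using b1 by simp
  show "((y1, y2), e) \<in> bparam_dom T (a0, b0, N) \<longleftrightarrow> branch_coord a0 b0 (w, e) \<in> regular \<or> w = 0"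
    unfolding bparam_dom_def prod.case mem_Collect_eq lift chart_dom_def axis
    using NN by (auto simp: branch_iff[OF NN] strip_def regular_def branch_coord_def wz)
  have pull: "pull T (a0, b0, N) (a0 + Re w, b0 + Im w, N) (e1, e2, 0)
      = (2 * Re w * e1 + 2 * Im w * e2, - 2 * Im w * e1 + 2 * Re w * e2, 0)"
    using b1 by simp
  show "bparam T (a0, b0, N) ((y1, y2), e) = bdry_class (branch_coord a0 b0 (w, e))"
    if "branch_coord a0 b0 (w, e) \<in> regular"
  proof -
    have "(a0 + Re w, b0 + Im w, N) \<notin> branch T"
      using that by (simp add: branch_iff[OF NN] regular_def branch_coord_def)
    then show ?thesis
      unfolding bparam_def param_def prod.case e lift pull branch_coord_def
      by (simp only: if_False pull prod.case bdry_class_simp bdry_covec_def fst_conv snd_conv)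
  qed
  show "bparam T (a0, b0, N) ((y1, y2), e) = bdry_covec a0 b0 (fst e) (snd e)" if "w = 0"
  proof -
    have "(a0 + Re w, b0 + Im w, N) \<in> branch T"
      using that assms by (simp add: branch_iff[OF NN])
    then show ?thesis
      unfolding bparam_def param_def prod.case e lift
      using that by (simp add: bdry_covec_def)
  qed
qed

lemma open_branch_dom:
  assumes "f1 a0 = f2 b0"
  shows "open {w :: complex. f1 (a0 + Re w) \<noteq> f2 (b0 + Im w) \<or> w = 0}" (is "open ?D")
proof -
  obtain m n :: int where mn: "a0 = of_int m * (w1 / 2)" "b0 = w2 / 4 + of_int n * (w2 / 2)"
    using assms unfolding f1_eq_f2 f1_eq_nu1 f2_eq_nu1 by auto
  \<comment> \<open>Lifts of branch points form a lattice with spacings \<open>w1 / 2\<close> and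
    \<open>w2 / 2\<close>, so this ball contains no lift but its centre.\<close>
  define \<epsilon> where "\<epsilon> = min (w1 / 2) (w2 / 2)"
  have small: "j = k" if "\<bar>of_int j * h - of_int k * h\<bar> < h" "h > 0" for j k :: int and h :: real
  proof -
    have "\<bar>of_int j * h - of_int k * h\<bar> = \<bar>of_int (j - k)\<bar> * h"
      using that(2) by (simp add: abs_mult flip: left_diff_distrib)
    then have "\<bar>of_int (j - k)\<bar> * h < 1 * h" using that(1) by linarith
    then have "\<bar>of_int (j - k)\<bar> < (1::real)" using that(2) by (simp only: mult_less_cancel_right_pos)
    then show ?thesis by linarith
  qed
  have "ball 0 \<epsilon> \<subseteq> ?D"
  proof
    fix w :: complex assume "w \<in> ball 0 \<epsilon>"
    then have "cmod w < \<epsilon>" by simp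
    then have lt: "\<bar>Re w\<bar> < w1 / 2" "\<bar>Im w\<bar> < w2 / 2"
      using abs_Re_le_cmod[of w] abs_Im_le_cmod[of w] by (auto simp: \<epsilon>_def)
    show "w \<in> ?D"
    proof (rule ccontr)
      assume neg: "w \<notin> ?D"
      then obtain m' n' :: int where "a0 + Re w = of_int m' * (w1 / 2)" "b0 + Im w = w2 / 4 + of_int n' * (w2 / 2)"
        unfolding mem_Collect_eq de_Morgan_disj not_not f1_eq_f2 f1_eq_nu1 f2_eq_nu1 by auto
      then have R: "Re w = of_int m' * (w1 / 2) - of_int m * (w1 / 2)"
        "Im w = of_int n' * (w2 / 2) - of_int n * (w2 / 2)" using mn by auto
      have "m' = m" "n' = n"
        using small[of m' "w1/2" m] small[of n' "w2/2" n] lt sizes unfolding R by auto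
      then have "w = 0" using R by (simp add: complex_eq_iff)
      then show False using neg by simp
    qed
  qed
  then have "?D = {w :: complex. f1 (a0 + Re w) \<noteq> f2 (b0 + Im w)} \<union> ball 0 \<epsilon>"
    using sizes by (auto simp: \<epsilon>_def)
  moreover have "open {w :: complex. f1 (a0 + Re w) \<noteq> f2 (b0 + Im w)}"
    by (intro open_Collect_neq continuous_intros)
  ultimately show ?thesis by auto
qed

text \<open>A criterion in the flat coordinates: V is the preimage of W under
  \<open>bdry_class\<close>, and invariance under \<open>rel\<close> contains invariance under the
  half-turn about a branch point, which is what \<open>open_csqrt_vimage\<close> asks for. Over the
  branch set, membership in W must not depend on the covector.\<close>

lemma openin_TGammaI:
  assumes W: "W \<subseteq> TGamma T" and V: "open V" and inv: "\<And>z z'. rel z z' \<Longrightarrow> z \<in> V \<Longrightarrow> z' \<in> V"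
    and reg: "\<And>z. z \<in> regular \<Longrightarrow> bdry_class z \<in> W \<longleftrightarrow> z \<in> V"
    and br: "\<And>a b e1 e2. f1 a = f2 b \<Longrightarrow> bdry_covec a b e1 e2 \<in> W \<longleftrightarrow> ((a, b), (0, 0)) \<in> V"
  shows "openin (TGamma_top T) W"
  unfolding openin_TGamma_top
proof (intro conjI W ballI)
  fix c assume "c \<in> bcenter T"
  then obtain a0 b0 where c: "c = (a0, b0, N)" by (auto simp: bcenter_def)
  show "open {z \<in> bparam_dom T c. bparam T c z \<in> W}"
  proof (cases "f1 a0 = f2 b0")
    case False
    have "{z \<in> bparam_dom T c. bparam T c z \<in> W} = regular \<inter> V"
      using reg by (auto simp: c regular_chart[OF False])
    then show ?thesis using open_regular V by auto
  next
    case True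
    define D where "D = {w. f1 (a0 + Re w) \<noteq> f2 (b0 + Im w) \<or> w = 0}"
    define Z where "Z = {x. fst x \<in> D \<and> branch_coord a0 b0 x \<in> V}"
    obtain m n :: int where mn: "a0 = of_int m * (w1 / 2)" "b0 = w2 / 4 + of_int n * (w2 / 2)"
      using True unfolding f1_eq_f2 f1_eq_nu1 f2_eq_nu1 by auto
    have "continuous_on UNIV (branch_coord a0 b0)"
      unfolding branch_coord_def split_beta by (intro continuous_intros)
    then have "open (branch_coord a0 b0 -` V)" by (rule open_vimage[OF V])
    moreover have "open (fst -` D :: (complex \<times> (real \<times> real)) set)"
      unfolding D_def by (intro open_vimage_fst open_branch_dom True)
    moreover have "Z = fst -` D \<inter> branch_coord a0 b0 -` V" by (auto simp: Z_def)
    ultimately have "open Z" by auto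
    \<comment> \<open>The half-turn is the involution composed with the translation that fixes the
      branch point, so m and n are the indices of that point.\<close>
    have rel: "rel (branch_coord a0 b0 (w, e)) (branch_coord a0 b0 (- w, e))" for w e
      unfolding rel_def branch_coord_def
      by (rule exI[of _ "-1"], rule exI[of _ m], rule exI[of _ n]) (simp add: mn algebra_simps)
    have D: "w \<in> D \<longleftrightarrow> branch_coord a0 b0 (w, e) \<in> regular \<or> w = 0" for w e
      by (simp add: D_def branch_coord_def regular_def)
    have sym: "(- w, e) \<in> Z" if "(w, e) \<in> Z" for w e
      using that inv[OF rel] rel_regular[OF rel[of w e]] D[of w e] D[of "- w" e] by (auto simp: Z_def)
    have eq: "((y1, y2), e) \<in> bparam_dom T c \<and> bparam T c ((y1, y2), e) \<in> W \<longleftrightarrow>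
        (csqrt (Complex y1 y2), e) \<in> Z" for y1 y2 e
    proof -
      define w where "w = csqrt (Complex y1 y2)"
      note bc = branch_chart[OF True w_def, of e]
      consider "branch_coord a0 b0 (w, e) \<in> regular" | "w = 0" "branch_coord a0 b0 (w, e) \<notin> regular"
        | "branch_coord a0 b0 (w, e) \<notin> regular" "w \<noteq> 0" by blast
      then show ?thesis
      proof cases
        case 1
        then show ?thesis using bc reg[OF 1] D[of w e] by (simp add: c Z_def flip: w_def)
      next
        case 2
        have "branch_coord a0 b0 (w, e) = ((a0, b0), (0, 0))" using 2 by (simp add: branch_coord_def)
        then show ?thesis using bc(1,3) 2 br[OF True] D[of w e] by (simp add: c Z_def flip: w_def)
      next
        case 3
        then show ?thesis using bc(1) D[of w e] by (simp add: c Z_def flip: w_def)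
      qed
    qed
    have "{z \<in> bparam_dom T c. bparam T c z \<in> W} = {((y1, y2), e). (csqrt (Complex y1 y2), e) \<in> Z}"
      using eq by auto
    then show ?thesis using open_csqrt_vimage[OF \<open>open Z\<close> sym] by simp
  qed
qed

lemma topspace_TGamma: "topspace (TGamma_top T) = TGamma T"
proof -
  have "openin (TGamma_top T) (TGamma T)"
    by (rule openin_TGammaI[where V = UNIV]) (auto simp: bdry_class_def bdry_covec_TGamma)
  then show ?thesis
    by (metis openin_TGamma_top openin_subset openin_topspace subset_antisym)
qed

text \<open>A chart with a centre off the branch set is \<theta> itself, and its domain is the whole
  regular part. Hence the one chart centred at (0, 0, N) serves for every torus below.\<close>

lemma chart0_regular: "f1 0 \<noteq> f2 0"
proof -
  have "f2 0 = 0" unfolding f2_eq_0 by (rule exI[of _ 0]) simp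
  then show ?thesis using nu1_le_f1[of 0] nu1_pos by auto
qed

lemma chart0_bcenter: "(0, 0, N) \<in> bcenter T"
  by (simp add: bcenter_def)

lemmas chart0 = regular_chart[OF chart0_regular]

lemma continuous_map_bdry_class:
  fixes \<psi> :: "real \<times> real \<Rightarrow> bcoord"
  assumes "continuous_on UNIV \<psi>" "\<And>s. \<psi> s \<in> regular"
  shows "continuous_map euclidean (TGamma_top T) (\<lambda>s. bdry_class (\<psi> s))"
  unfolding continuous_map_def
proof (intro conjI allI impI)
  show "(\<lambda>s. bdry_class (\<psi> s)) \<in> topspace euclidean \<rightarrow> topspace (TGamma_top T)"
    by (simp add: topspace_TGamma bdry_class_def bdry_covec_TGamma)
  fix U assume "openin (TGamma_top T) U"
  then have "open {z \<in> bparam_dom T (0, 0, N). bparam T (0, 0, N) z \<in> U}"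
    using chart0_bcenter by (simp add: openin_TGamma_top)
  then have "open {z \<in> regular. bdry_class z \<in> U}" by (simp add: chart0)
  then have "open (\<psi> -` {z \<in> regular. bdry_class z \<in> U})" by (rule open_vimage[OF _ assms(1)])
  moreover have "\<psi> -` {z \<in> regular. bdry_class z \<in> U} = {s. bdry_class (\<psi> s) \<in> U}" using assms(2) by auto
  ultimately show "openin euclidean {s \<in> topspace euclidean. bdry_class (\<psi> s) \<in> U}" by simp
qed

end

section \<open>Liouville tori and the Leray form\<close>

lemma wedge22_wedge11:
  "wedge22 (wedge11 a b) (wedge11 c d) u v w z = - wedge22 (wedge11 a c) (wedge11 b d) u v w z"
  by (simp add: wedge22_def wedge11_def algebra_simps)

lemma F1_reg_derivative_identity:
  fixes d :: real
  assumes "d \<noteq> 0" "x = y + d" "H = x + y - E / d"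
  shows "x1 * u + y1 * v - ((2 * p1 * l + 2 * p2 * m) * d - E * (x1 * u - y1 * v)) / (d * d) =
    (- (2 * p2 * m + (2 * y - H) * y1 * v) - (2 * p1 * l - (2 * x - H) * x1 * u)) / d"
  unfolding assms(2,3) using assms(1) by (simp add: field_simps)

lemma F2_reg_derivative_identity:
  fixes d :: real
  assumes "d \<noteq> 0" "x = y + d" "H = x + y - (p1\<^sup>2 + p2\<^sup>2) / d"
  shows "x * (y1 * v) + x1 * u * y - ((y * (2 * p1 * l) + y1 * v * p1\<^sup>2 + (x * (2 * p2 * m) + x1 * u * p2\<^sup>2)) * d
      - (y * p1\<^sup>2 + x * p2\<^sup>2) * (x1 * u - y1 * v)) / (d * d) =
    (- x * (2 * p2 * m + (2 * y - H) * y1 * v) - y * (2 * p1 * l - (2 * x - H) * x1 * u)) / d"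
  unfolding assms(2,3) using assms(1) by (simp add: field_simps power2_eq_square)

context classical_table
begin

lemma deriv_f: "(f1 has_real_derivative deriv f1 x) (at x)" "(f2 has_real_derivative deriv f2 x) (at x)"
proof -
  show "(f1 has_real_derivative deriv f1 x) (at x)"
    using smooth_fun_on_UNIV_derivative[OF smooth(1)] DERIV_imp_deriv by metis
  show "(f2 has_real_derivative deriv f2 x) (at x)"
    using smooth_fun_on_UNIV_derivative[OF smooth(2)] DERIV_imp_deriv by metis
qed

text \<open>Implicit differentiation of p1^2 = \<phi>1^2 - F1 \<phi>1 + F2 and p2^2 = - \<phi>2^2 +
  F1 \<phi>2 - F2 gives the forms A = dF2 - \<phi>1 dF1 and B = \<phi>2 dF1 - dF2, each involving
  the differentials of one degree of freedom only. \<open>D1_form\<close> and \<open>D2_form\<close>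
  solve this system for dF1 and dF2.\<close>

definition A_form :: "bcoord \<Rightarrow> bcoord \<Rightarrow> real" where
  "A_form = (\<lambda>((a, b), (p1, p2)) ((u1, u2), (l1, l2)).
     2 * p1 * l1 - (2 * f1 a - F1_reg a b p1 p2) * deriv f1 a * u1)"

definition B_form :: "bcoord \<Rightarrow> bcoord \<Rightarrow> real" where
  "B_form = (\<lambda>((a, b), (p1, p2)) ((u1, u2), (l1, l2)).
     2 * p2 * l2 + (2 * f2 b - F1_reg a b p1 p2) * deriv f2 b * u2)"

definition D1_form :: "bcoord \<Rightarrow> bcoord \<Rightarrow> real" where
  "D1_form z v = (- B_form z v - A_form z v) / (f1 (fst (fst z)) - f2 (snd (fst z)))"

definition D2_form :: "bcoord \<Rightarrow> bcoord \<Rightarrow> real" where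
  "D2_form z v = (- f1 (fst (fst z)) * B_form z v - f2 (snd (fst z)) * A_form z v) / (f1 (fst (fst z)) - f2 (snd (fst z)))"

lemma has_derivative_FF:
  assumes "f1 a \<noteq> f2 b"
  shows "((\<lambda>z. F1_reg (fst (fst z)) (snd (fst z)) (fst (snd z)) (snd (snd z))) has_derivative
      D1_form ((a, b), (p1, p2))) (at ((a, b), (p1, p2)))"
    and "((\<lambda>z. F2_reg (fst (fst z)) (snd (fst z)) (fst (snd z)) (snd (snd z))) has_derivative
      D2_form ((a, b), (p1, p2))) (at ((a, b), (p1, p2)))"
proof -
  have f1': "((\<lambda>z::bcoord. f1 (fst (fst z))) has_derivative (\<lambda>v. deriv f1 a * fst (fst v))) (at ((a, b), (p1, p2)))"
    by (rule has_derivative_compose[where g = f1, OF _ has_field_derivative_imp_has_derivative])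
      (auto intro!: derivative_eq_intros deriv_f)
  have f2': "((\<lambda>z::bcoord. f2 (snd (fst z))) has_derivative (\<lambda>v. deriv f2 b * snd (fst v))) (at ((a, b), (p1, p2)))"
    by (rule has_derivative_compose[where g = f2, OF _ has_field_derivative_imp_has_derivative])
      (auto intro!: derivative_eq_intros deriv_f)
  have p: "((\<lambda>z::bcoord. (fst (snd z))\<^sup>2) has_derivative (\<lambda>v. 2 * p1 * fst (snd v))) (at ((a, b), (p1, p2)))"
    "((\<lambda>z::bcoord. (snd (snd z))\<^sup>2) has_derivative (\<lambda>v. 2 * p2 * snd (snd v))) (at ((a, b), (p1, p2)))"
    by (auto intro!: derivative_eq_intros)
  note dd = has_derivative_diff[OF f1' f2']
  define d where "d = f1 a - f2 b"
  have d: "d \<noteq> 0" "f1 a = f2 b + d" using assms by (auto simp: d_def)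
  show "((\<lambda>z. F1_reg (fst (fst z)) (snd (fst z)) (fst (snd z)) (snd (snd z))) has_derivative
      D1_form ((a, b), (p1, p2))) (at ((a, b), (p1, p2)))"
    unfolding F1_reg_def
    by (rule has_derivative_eq_rhs[OF has_derivative_diff[OF has_derivative_add[OF f1' f2']
        has_derivative_divide'[OF has_derivative_add[OF p] dd]]])
      (use assms in simp, rule ext, simp only: D1_form_def A_form_def B_form_def F1_reg_def split_beta
        fst_conv snd_conv d_def[symmetric] F1_reg_derivative_identity[OF d refl])
  show "((\<lambda>z. F2_reg (fst (fst z)) (snd (fst z)) (fst (snd z)) (snd (snd z))) has_derivative
      D2_form ((a, b), (p1, p2))) (at ((a, b), (p1, p2)))"
    unfolding F2_reg_def
    by (rule has_derivative_eq_rhs[OF has_derivative_diff[OF has_derivative_mult[OF f1' f2']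
        has_derivative_divide'[OF has_derivative_add[OF has_derivative_mult[OF f2' p(1)] has_derivative_mult[OF f1' p(2)]] dd]]])
      (use assms in simp, rule ext, simp only: D2_form_def A_form_def B_form_def F1_reg_def split_beta
        fst_conv snd_conv d_def[symmetric] F2_reg_derivative_identity[OF d refl])
qed

text \<open>The explicit expressions agree with \<open>F1\<close> and \<open>F2\<close> only where
  the tangential norm is below 1; that set is open, so the derivatives agree there.\<close>

lemma dF_chart0:
  assumes z: "z \<in> regular" and n: "tangential_norm2 (fst (fst z)) (snd (fst z)) (fst (snd z)) (snd (snd z)) < 1"
  shows "dF T (0, 0, N) z (D1_form z) (D2_form z)"
proof -
  obtain a b p1 p2 where z': "z = ((a, b), (p1, p2))" by (cases z) auto
  define V where "V = regular \<inter> {z. tangential_norm2 (fst (fst z)) (snd (fst z)) (fst (snd z)) (snd (snd z)) < 1}"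
  have "continuous_on regular (\<lambda>z. tangential_norm2 (fst (fst z)) (snd (fst z)) (fst (snd z)) (snd (snd z)))"
  proof -
    have nz: "P1 (fst (fst z)) (snd (fst z)) \<noteq> 0" "P2 (fst (fst z)) (snd (fst z)) \<noteq> 0" if "z \<in> regular" for z
      using P_pos(2,3)[of "fst (fst z)" "snd (fst z)"] that by (auto simp: regular_def)
    have c: "continuous_on regular (\<lambda>z. P1 (fst (fst z)) (snd (fst z)))"
      "continuous_on regular (\<lambda>z. P2 (fst (fst z)) (snd (fst z)))"
      unfolding P1_def P2_def by (intro continuous_intros)+
    show ?thesis unfolding tangential_norm2_def by (intro continuous_intros c ballI nz)
  qed
  then have "open V" unfolding V_def
    using continuous_open_preimage[OF _ open_regular, of "\<lambda>z. tangential_norm2 (fst (fst z)) (snd (fst z)) (fst (snd z)) (snd (snd z))" "{..<1}"]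
    by (simp add: vimage_def Int_def)
  have zV: "z \<in> V" using z n by (simp add: V_def)
  have F: "F1_reg (fst (fst z)) (snd (fst z)) (fst (snd z)) (snd (snd z)) = F1 T (bparam T (0, 0, N) z)"
    "F2_reg (fst (fst z)) (snd (fst z)) (fst (snd z)) (snd (snd z)) = F2 T (bparam T (0, 0, N) z)" if "z \<in> V" for z
    using that F_bdry_covec[of "fst (fst z)" "snd (fst z)"] unfolding chart0(2) bdry_class_def V_def regular_def by auto
  have "f1 a \<noteq> f2 b" using z by (simp add: z' regular_iff)
  note D = has_derivative_FF[OF this, of p1 p2, folded z']
  show ?thesis
    unfolding dF_def
    by (intro conjI has_derivative_transform_within_open[OF D(1) \<open>open V\<close> zV F(1)]
        has_derivative_transform_within_open[OF D(2) \<open>open V\<close> zV F(2)])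
qed

lemma rel_f:
  assumes "rel z z'"
  shows "f1 (fst (fst z')) = f1 (fst (fst z))" "f2 (snd (fst z')) = f2 (snd (fst z))"
    "(fst (snd z'))\<^sup>2 = (fst (snd z))\<^sup>2" "(snd (snd z'))\<^sup>2 = (snd (snd z))\<^sup>2"
proof -
  obtain s m n where s: "s \<in> {1, -1}"
    and e: "fst (fst z') = of_int s * fst (fst z) + of_int m * w1"
       "snd (fst z') = of_int s * snd (fst z) + of_int n * w2 + (1 - of_int s) / 4 * w2"
       "fst (snd z') = of_int s * fst (snd z)" "snd (snd z') = of_int s * snd (snd z)"
    using assms unfolding rel_def by auto
  have "act s s m n ((fst (fst z), snd (fst z), N), (0, 0, 0)) =
      ((fst (fst z'), snd (fst z'), N), (0, 0, 0))"
    unfolding act_def e using s by auto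
  from act_regular[OF s s _ this] sizes
  show "f1 (fst (fst z')) = f1 (fst (fst z))" "f2 (snd (fst z')) = f2 (snd (fst z))" by simp_all
  show "(fst (snd z'))\<^sup>2 = (fst (snd z))\<^sup>2" "(snd (snd z'))\<^sup>2 = (snd (snd z))\<^sup>2"
    unfolding e using s by auto
qed

end

text \<open>The sign of the deck-invariant function \<open>S\<close> separates the torus from the rest of its level set.
  The connected component is obtained as a closed set that is relatively open because of \<open>S\<close>; since \<open>\<kappa>\<^sub>2 \<noteq> \<nu>\<^sub>1\<close>,
  it avoids the branch set, so the limits in the definition of \<open>on_rep\<close> there never have to be computed.\<close>

locale torus = classical_table +
  fixes k1 k2 :: real and g1' g2' \<theta>1 \<theta>2 q1 q2 e1 e2 :: "real \<Rightarrow> real" and S :: "bcoord \<Rightarrow> real"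
  assumes k1: "nu3 T < k1" "k1 < 0" and k2: "0 < k2" "k2 \<noteq> nu1 T" "k2 < nu0 T"
    and O1: "orbit (\<lambda>x. (f1 x - k1) * (f1 x - k2)) g1' \<theta>1 q1 e1"
    and O2: "orbit (\<lambda>x. (f2 x - k1) * (k2 - f2 x)) g2' \<theta>2 q2 e2"
    and cont_S: "continuous_on UNIV S" and S_rel: "rel z z' \<Longrightarrow> S z' = S z"
    and S_nonzero: "(fst (snd z))\<^sup>2 = (f1 (fst (fst z)) - k1) * (f1 (fst (fst z)) - k2) \<Longrightarrow>
       (snd (snd z))\<^sup>2 = (f2 (snd (fst z)) - k1) * (k2 - f2 (snd (fst z))) \<Longrightarrow> S z \<noteq> 0"
    and S_pos: "S ((\<theta>1 s, \<theta>2 t), (q1 s, q2 t)) > 0"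
    and rel_iff: "rel ((\<theta>1 s, \<theta>2 t), (q1 s, q2 t)) ((\<theta>1 s', \<theta>2 t'), (q1 s', q2 t')) \<longleftrightarrow>
       s - s' \<in> \<int> \<and> t - t' \<in> \<int>"
    and surj: "p1\<^sup>2 = (f1 a - k1) * (f1 a - k2) \<Longrightarrow> p2\<^sup>2 = (f2 b - k1) * (k2 - f2 b) \<Longrightarrow>
       S ((a, b), (p1, p2)) > 0 \<Longrightarrow> \<exists>s t. rel ((a, b), (p1, p2)) ((\<theta>1 s, \<theta>2 t), (q1 s, q2 t))"
begin

sublocale O1: orbit "\<lambda>x. (f1 x - k1) * (f1 x - k2)" g1' \<theta>1 q1 e1 by (rule O1)
sublocale O2: orbit "\<lambda>x. (f2 x - k1) * (k2 - f2 x)" g2' \<theta>2 q2 e2 by (rule O2)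

definition energy :: "bcoord \<Rightarrow> bool" where
  "energy z \<longleftrightarrow> (fst (snd z))\<^sup>2 = (f1 (fst (fst z)) - k1) * (f1 (fst (fst z)) - k2) \<and>
    (snd (snd z))\<^sup>2 = (f2 (snd (fst z)) - k1) * (k2 - f2 (snd (fst z)))"

text \<open>The weak inequality makes the set closed. As S has no zero on the energy surface it may
  be replaced by the strict one, which makes the set relatively open.\<close>

definition Lam :: "bcoord set" where "Lam = {z. energy z \<and> S z \<ge> 0}"

definition \<psi> :: "real \<times> real \<Rightarrow> bcoord" where
  "\<psi> s = ((\<theta>1 (fst s), \<theta>2 (snd s)), (q1 (fst s), q2 (snd s)))"

definition \<Psi> :: "real \<times> real \<Rightarrow> brep set" where "\<Psi> s = bdry_class (\<psi> s)"

text \<open>The quadratic polynomial with roots k1 and k2, evaluated at \<open>nu3 T\<close>: the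
  separated equation for the squared normal component \<open>p\<^sub>3\<^sup>2\<close>, which is
  therefore constant on the torus.\<close>

definition Q3 :: real where "Q3 = (nu3 T - k1) * (nu3 T - k2)"

lemma Q3_pos: "Q3 > 0"
  unfolding Q3_def using k1 k2 by (intro mult_neg_neg) auto

text \<open>Nonnegative squares force \<open>f2 b \<le> k2 \<le> f1 a\<close>. Equality of the outer
  terms would make all three equal to \<open>nu1 T\<close>, which is excluded for k2.\<close>

lemma energy_regular:
  assumes "energy ((a, b), (p1, p2))"
  shows "f1 a \<noteq> f2 b" "tangential_norm2 a b p1 p2 = 1 - Q3 / P3 a b" "tangential_norm2 a b p1 p2 < 1"
    "F1_reg a b p1 p2 = k1 + k2" "F2_reg a b p1 p2 = k1 * k2"
proof -
  have p: "p1\<^sup>2 = (f1 a - k1) * (f1 a - k2)" "p2\<^sup>2 = (f2 b - k1) * (k2 - f2 b)"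
    using assms by (auto simp: energy_def)
  have pos: "f1 a - k1 > 0" "f2 b - k1 > 0"
    using nu1_le_f1[of a] nu1_pos f2_nonneg[of b] k1 by auto
  have "f1 a \<ge> k2" "f2 b \<le> k2"
    using pos p zero_le_power2[of p1] zero_le_power2[of p2] by (auto simp: zero_le_mult_iff)
  then have ne: "f1 a \<noteq> f2 b" using k2(2) nu1_le_f1[of a] f2_le_nu1[of b] by auto
  then show "f1 a \<noteq> f2 b" .
  define x y v where "x = f1 a" and "y = f2 b" and "v = nu3 T"
  have nz: "x - y \<noteq> 0" "x - v \<noteq> 0" "y - v \<noteq> 0"
    using ne nu1_le_f1[of a] nu1_pos f2_nonneg[of b] ph3_N(3) by (auto simp: x_def y_def v_def)
  show n: "tangential_norm2 a b p1 p2 = 1 - Q3 / P3 a b"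
    unfolding tangential_norm2_def p P1_def P2_def P3_def Q3_def x_def[symmetric] y_def[symmetric] v_def[symmetric]
    using nz by (simp add: divide_simps) (simp add: algebra_simps)
  show "tangential_norm2 a b p1 p2 < 1" unfolding n using Q3_pos P_pos(1) by simp
  show "F1_reg a b p1 p2 = k1 + k2"
    unfolding F1_reg_def p x_def[symmetric] y_def[symmetric] using nz(1)
    by (simp add: divide_simps) (simp add: algebra_simps)
  show "F2_reg a b p1 p2 = k1 * k2"
    unfolding F2_reg_def p x_def[symmetric] y_def[symmetric] using nz(1)
    by (simp add: divide_simps) (simp add: algebra_simps)
qed

text \<open>The two integrals are a linear system for p1^2 and p2^2 whose determinant is \<phi>1 -
  \<phi>2 up to sign.\<close>

lemma energyI:
  assumes "f1 a \<noteq> f2 b" "F1_reg a b p1 p2 = k1 + k2" "F2_reg a b p1 p2 = k1 * k2"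
  shows "energy ((a, b), (p1, p2))"
proof -
  define x y d where "x = f1 a" and "y = f2 b" and "d = x - y"
  have d: "d \<noteq> 0" using assms by (auto simp: d_def x_def y_def)
  have 1: "p1\<^sup>2 + p2\<^sup>2 = (x + y - (k1 + k2)) * d"
    using assms(2) d unfolding F1_reg_def x_def[symmetric] y_def[symmetric] d_def[symmetric]
    by (simp add: field_simps)
  have 2: "y * p1\<^sup>2 + x * p2\<^sup>2 = (x * y - k1 * k2) * d"
    using assms(3) d unfolding F2_reg_def x_def[symmetric] y_def[symmetric] d_def[symmetric]
    by (simp add: field_simps)
  have "d * p1\<^sup>2 = x * (p1\<^sup>2 + p2\<^sup>2) - (y * p1\<^sup>2 + x * p2\<^sup>2)" by (simp add: d_def algebra_simps)
  also have "\<dots> = d * ((x - k1) * (x - k2))" unfolding 1 2 by (simp add: algebra_simps)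
  finally have p1: "p1\<^sup>2 = (x - k1) * (x - k2)" using d by simp
  have "d * p2\<^sup>2 = (y * p1\<^sup>2 + x * p2\<^sup>2) - y * (p1\<^sup>2 + p2\<^sup>2)" by (simp add: d_def algebra_simps)
  also have "\<dots> = d * ((y - k1) * (k2 - y))" unfolding 1 2 by (simp add: algebra_simps)
  finally have "p2\<^sup>2 = (y - k1) * (k2 - y)" using d by simp
  then show ?thesis using p1 by (simp add: energy_def x_def y_def)
qed

lemma energy_\<psi>: "energy (\<psi> s)"
  using O1.energy O2.energy by (simp add: energy_def \<psi>_def)

lemma energy_imp_regular: "energy z \<Longrightarrow> z \<in> regular"
proof -
  assume e: "energy z"
  obtain a b p1 p2 where z: "z = ((a, b), (p1, p2))" by (cases z) auto
  show ?thesis using energy_regular(1)[OF e[unfolded z]] by (simp add: z regular_iff)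
qed

lemma \<psi>_regular: "\<psi> s \<in> regular"
  by (rule energy_imp_regular[OF energy_\<psi>])

lemma continuous_\<psi>: "continuous_on UNIV \<psi>"
  unfolding \<psi>_def
  by (intro continuous_intros continuous_on_compose2[OF O1.cont_theta] continuous_on_compose2[OF O1.cont_p]
    continuous_on_compose2[OF O2.cont_theta] continuous_on_compose2[OF O2.cont_p]) auto

lemma \<Psi>_eq_iff: "\<Psi> s = \<Psi> t \<longleftrightarrow> fst s - fst t \<in> \<int> \<and> snd s - snd t \<in> \<int>"
  unfolding \<Psi>_def bdry_class_eq_iff[OF \<psi>_regular] unfolding \<psi>_def by (rule rel_iff)

lemma Lam_rel: "rel z z' \<Longrightarrow> z' \<in> Lam \<longleftrightarrow> z \<in> Lam"
  using rel_f[of z z'] S_rel[of z z'] by (simp add: Lam_def energy_def)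

lemma bdry_class_mem_iff:
  assumes "z \<in> regular" "V \<subseteq> regular" "\<And>z z'. rel z z' \<Longrightarrow> z' \<in> V \<longleftrightarrow> z \<in> V"
  shows "bdry_class z \<in> bdry_class ` V \<longleftrightarrow> z \<in> V"
proof
  assume "bdry_class z \<in> bdry_class ` V"
  then obtain z' where "z' \<in> V" "bdry_class z = bdry_class z'" by auto
  then show "z \<in> V" using bdry_class_eq_iff[OF assms(1)] assms(3) by auto
qed auto

lemma branch_not_mem:
  assumes "f1 a = f2 b" "V \<subseteq> regular"
  shows "bdry_covec a b p1 p2 \<notin> bdry_class ` V"
proof
  assume "bdry_covec a b p1 p2 \<in> bdry_class ` V"
  then obtain z' where z': "z' \<in> V" "bdry_class z' = bdry_class ((a, b), (p1, p2))" by auto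
  then have "rel z' ((a, b), (p1, p2))" using bdry_class_eq_iff[of z' "((a, b), (p1, p2))"] assms(2) by blast
  from rel_regular[OF this] show False using z'(1) assms by (auto simp: regular_iff)
qed

lemma Lam_regular: "Lam \<subseteq> regular"
  using energy_imp_regular by (auto simp: Lam_def)

lemma range_\<Psi>: "range \<Psi> = bdry_class ` Lam"
proof (intro equalityI subsetI)
  fix \<xi> assume "\<xi> \<in> range \<Psi>"
  then obtain s where "\<xi> = bdry_class (\<psi> s)" by (auto simp: \<Psi>_def)
  moreover have "\<psi> s \<in> Lam" using energy_\<psi>[of s] S_pos less_imp_le by (auto simp: Lam_def \<psi>_def)
  ultimately show "\<xi> \<in> bdry_class ` Lam" by auto
next
  fix \<xi> assume "\<xi> \<in> bdry_class ` Lam"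
  then obtain z where z: "z \<in> Lam" "\<xi> = bdry_class z" by auto
  obtain a b p1 p2 where z': "z = ((a, b), (p1, p2))" by (cases z) auto
  have e: "energy z" "S z > 0" using z S_nonzero[of z] by (auto simp: Lam_def energy_def less_le)
  then obtain s t where "rel z (\<psi> (s, t))"
    using surj[of p1 a p2 b] by (auto simp: energy_def z' \<psi>_def)
  then have "\<xi> = \<Psi> (s, t)" using bdry_class_eq_iff energy_imp_regular[OF e(1)] z by (simp add: \<Psi>_def)
  then show "\<xi> \<in> range \<Psi>" by auto
qed

definition Lv :: "brep set set" where
  "Lv = {\<xi> \<in> BGamma T. F1 T \<xi> = k1 + k2 \<and> F2 T \<xi> = k1 * k2}"

lemma bdry_class_Lam_facts:
  assumes "energy z"
  shows "bdry_class z \<in> BGamma T" "F1 T (bdry_class z) = k1 + k2" "F2 T (bdry_class z) = k1 * k2"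
proof -
  obtain a b p1 p2 where z': "z = ((a, b), (p1, p2))" by (cases z) auto
  note r = energy_regular[OF assms[unfolded z']]
  show "bdry_class z \<in> BGamma T" "F1 T (bdry_class z) = k1 + k2" "F2 T (bdry_class z) = k1 * k2"
    unfolding z' using r F_bdry_covec[OF r(1,3)] by (simp_all add: bdry_covec_BGamma_iff)
qed

lemma Lambda_eq: "bdry_class ` Lam = Lv \<inter> bdry_class ` {z \<in> regular. S z > 0}"
proof (intro equalityI subsetI)
  fix \<xi> assume "\<xi> \<in> bdry_class ` Lam"
  then obtain z where z: "z \<in> Lam" "\<xi> = bdry_class z" by auto
  have e: "energy z" "S z > 0" using z S_nonzero[of z] by (auto simp: Lam_def energy_def less_le)
  then show "\<xi> \<in> Lv \<inter> bdry_class ` {z \<in> regular. S z > 0}"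
    using bdry_class_Lam_facts[OF e(1)] energy_imp_regular[OF e(1)] by (auto simp: Lv_def z)
next
  fix \<xi> assume x: "\<xi> \<in> Lv \<inter> bdry_class ` {z \<in> regular. S z > 0}"
  then obtain z where z: "z \<in> regular" "S z > 0" "\<xi> = bdry_class z" by auto
  obtain a b p1 p2 where z': "z = ((a, b), (p1, p2))" by (cases z) auto
  have r: "f1 a \<noteq> f2 b" using z by (simp add: z' regular_iff)
  have "tangential_norm2 a b p1 p2 < 1" using x z bdry_covec_BGamma_iff[OF r] by (simp add: Lv_def z')
  from F_bdry_covec[OF r this] have "energy z"
    using x z unfolding z' by (intro energyI r) (simp_all add: Lv_def z')
  then show "\<xi> \<in> bdry_class ` Lam" using z by (auto simp: Lam_def)
qed

lemma continuous_\<Psi>: "continuous_map euclidean (TGamma_top T) \<Psi>"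
  unfolding \<Psi>_def using continuous_\<psi> \<psi>_regular by (rule continuous_map_bdry_class)

lemma \<Psi>_cbox: "\<Psi> ` cbox (0, 0) (1, 1) = range \<Psi>"
proof (intro equalityI subsetI)
  fix \<xi> assume "\<xi> \<in> range \<Psi>"
  then obtain s t where "\<xi> = \<Psi> (s, t)" by auto
  also have "\<dots> = \<Psi> (frac s, frac t)" unfolding \<Psi>_eq_iff by (simp add: frac_def)
  finally show "\<xi> \<in> \<Psi> ` cbox (0, 0) (1, 1)"
    using frac_lt_1[of s] frac_lt_1[of t] by (auto simp: less_imp_le intro!: image_eqI[of _ _ "(frac s, frac t)"])
qed auto

section \<open>Independence of the integrals and the component of the level set\<close>

lemma g1'_eq: "g1' x = (2 * f1 x - (k1 + k2)) * deriv f1 x"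
proof -
  have "((\<lambda>x. (f1 x - k1) * (f1 x - k2)) has_real_derivative
      (2 * f1 x - (k1 + k2)) * deriv f1 x) (at x)"
    by (rule derivative_eq_intros deriv_f refl)+ (simp add: algebra_simps)
  then show ?thesis using O1.der_g by (rule DERIV_unique[symmetric])
qed

lemma g2'_eq: "g2' x = - (2 * f2 x - (k1 + k2)) * deriv f2 x"
proof -
  have "((\<lambda>x. (f2 x - k1) * (k2 - f2 x)) has_real_derivative
      - (2 * f2 x - (k1 + k2)) * deriv f2 x) (at x)"
    by (rule derivative_eq_intros deriv_f refl)+ (simp add: algebra_simps)
  then show ?thesis using O2.der_g by (rule DERIV_unique[symmetric])
qed

definition h1 where "h1 s = g1' (\<theta>1 (fst s)) / 2"
definition h2 where "h2 s = g2' (\<theta>2 (snd s)) / 2"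
abbreviation r1 where "r1 s \<equiv> q1 (fst s)"
abbreviation r2 where "r2 s \<equiv> q2 (snd s)"
definition gap where "gap s = f1 (\<theta>1 (fst s)) - f2 (\<theta>2 (snd s))"

lemma gap_pos: "gap s > 0"
  using \<psi>_regular[of s] f2_le_f1[of "\<theta>2 (snd s)" "\<theta>1 (fst s)"] by (simp add: gap_def \<psi>_def regular_iff less_le)

lemma F1_reg_\<psi>: "F1_reg (\<theta>1 (fst s)) (\<theta>2 (snd s)) (r1 s) (r2 s) = k1 + k2"
  using energy_regular(4) energy_\<psi>[of s] by (simp add: \<psi>_def)

lemma A_form_\<psi>: "A_form (\<psi> s) v = 2 * (r1 s * fst (snd v) - h1 s * fst (fst v))"
  unfolding A_form_def \<psi>_def h1_def g1'_eq by (simp add: split_beta F1_reg_\<psi>)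

lemma B_form_\<psi>: "B_form (\<psi> s) v = 2 * (r2 s * snd (snd v) - h2 s * snd (fst v))"
proof -
  show ?thesis
    unfolding B_form_def \<psi>_def h2_def g2'_eq
    by (simp add: split_beta F1_reg_\<psi> field_simps)
qed

lemma wedge_D_forms: "wedge11 (D1_form (\<psi> s)) (D2_form (\<psi> s)) u v =
  wedge11 (A_form (\<psi> s)) (B_form (\<psi> s)) u v / gap s"
proof -
  have identity: "((- b - a) / d * ((- x * b' - y * a') / d) - (- b' - a') / d * ((- x * b - y * a) / d)) = (a * b' - a' * b) / d"
    if "d \<noteq> 0" "x = y + d" for a b a' b' x y d :: real
    unfolding that(2) using that(1) by (simp add: field_simps)
  moreover have d: "gap s \<noteq> 0" "f1 (\<theta>1 (fst s)) = f2 (\<theta>2 (snd s)) + gap s"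
    using gap_pos[of s] by (auto simp: gap_def)
  moreover have e: "fst (fst (\<psi> s)) = \<theta>1 (fst s)" "snd (fst (\<psi> s)) = \<theta>2 (snd s)" by (auto simp: \<psi>_def)
  show ?thesis unfolding wedge11_def D1_form_def D2_form_def e gap_def[symmetric] by (rule identity[OF d])
qed

lemma nondegenerate: "(r1 s)\<^sup>2 + (h1 s)\<^sup>2 > 0" "(r2 s)\<^sup>2 + (h2 s)\<^sup>2 > 0"
  using O1.regular[of "fst s"] O2.regular[of "snd s"]
  by (auto simp: h1_def h2_def sum_power2_gt_zero_iff)

lemma dF_\<psi>: "dF T (0, 0, N) (\<psi> s) (D1_form (\<psi> s)) (D2_form (\<psi> s))"
  using energy_regular(3) energy_\<psi>[of s] by (intro dF_chart0 \<psi>_regular) (simp add: \<psi>_def)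

lemma independent_at_\<Psi>: "independent_at T (\<Psi> s)"
proof -
  \<comment> \<open>The Hamiltonian directions of the two degrees of freedom, rotated by a right
    angle; the forms A and B take the squared lengths as values, up to the factor 2.\<close>
  define u v where "u = ((- h1 s, 0 :: real), (r1 s, 0 :: real))" and "v = ((0 :: real, - h2 s), (0 :: real, r2 s))"
  have "A_form (\<psi> s) u = 2 * ((r1 s)\<^sup>2 + (h1 s)\<^sup>2)" "B_form (\<psi> s) u = 0"
    "A_form (\<psi> s) v = 0" "B_form (\<psi> s) v = 2 * ((r2 s)\<^sup>2 + (h2 s)\<^sup>2)"
    by (simp_all add: A_form_\<psi> B_form_\<psi> u_def v_def power2_eq_square)
  then have "wedge11 (D1_form (\<psi> s)) (D2_form (\<psi> s)) u v \<noteq> 0"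
    unfolding wedge_D_forms using nondegenerate[of s] gap_pos[of s] by (simp add: wedge11_def)
  moreover have "\<psi> s \<in> bparam_dom T (0, 0, N)" "bparam T (0, 0, N) (\<psi> s) = \<Psi> s"
    using \<psi>_regular by (simp_all add: chart0 \<Psi>_def)
  ultimately show ?thesis unfolding independent_at_def using chart0_bcenter dF_\<psi> by blast
qed

lemma liouville_torus_range: "liouville_torus T (range \<Psi>)"
  unfolding liouville_torus_def
proof (intro conjI ballI)
  let ?\<Lambda> = "bdry_class ` Lam" and ?Y = "subtopology (TGamma_top T) Lv"
  show "compactin (TGamma_top T) (range \<Psi>)"
    unfolding \<Psi>_cbox[symmetric]
    by (rule image_compactin[OF _ continuous_\<Psi>]) (simp add: compact_cbox)
  have "connectedin euclidean (UNIV :: (real \<times> real) set)" by (simp add: convex_connected)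
  from connectedin_continuous_map_image[OF continuous_\<Psi> this]
  have conn: "connectedin (TGamma_top T) ?\<Lambda>" unfolding range_\<Psi> .
  have LamLv: "?\<Lambda> \<subseteq> Lv" unfolding Lambda_eq by auto
  then have connY: "connectedin ?Y ?\<Lambda>" using conn by (simp add: connectedin_subtopology)
  have TG: "bdry_class ` V \<subseteq> TGamma T" for V by (auto simp: bdry_class_def bdry_covec_TGamma)
  have "openin (TGamma_top T) (bdry_class ` {z \<in> regular. S z > 0})"
  proof (rule openin_TGammaI[where V = "{z \<in> regular. S z > 0}", OF TG])
    have "open {z. S z > 0}" using cont_S by (intro open_Collect_less continuous_intros)
    then show "open {z \<in> regular. S z > 0}" using open_regular by (auto simp: Collect_conj_eq)
    have inv: "z' \<in> {z \<in> regular. S z > 0} \<longleftrightarrow> z \<in> {z \<in> regular. S z > 0}" if "rel z z'" for z z'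
      using S_rel[OF that] rel_regular[OF that] by simp
    then show "z' \<in> {z \<in> regular. S z > 0}" if "rel z z'" "z \<in> {z \<in> regular. S z > 0}" for z z'
      using that by blast
    show "bdry_class z \<in> bdry_class ` {z \<in> regular. S z > 0} \<longleftrightarrow> z \<in> {z \<in> regular. S z > 0}" if "z \<in> regular" for z
      by (rule bdry_class_mem_iff[OF that _ inv]) auto
    show "bdry_covec a b e1 e2 \<in> bdry_class ` {z \<in> regular. S z > 0} \<longleftrightarrow> ((a, b), (0, 0)) \<in> {z \<in> regular. S z > 0}"
      if "f1 a = f2 b" for a b e1 e2
      using branch_not_mem[OF that, of "{z \<in> regular. S z > 0}"] that by (auto simp: regular_iff)
  qed
  then have openY: "openin ?Y ?\<Lambda>"
    unfolding openin_subtopology Lambda_eq by (auto simp: Int_commute)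
  have "openin (TGamma_top T) (TGamma T - ?\<Lambda>)"
  proof (rule openin_TGammaI[where V = "- Lam"])
    have c: "continuous_on UNIV (\<lambda>z::bcoord. f1 (fst (fst z)))" "continuous_on UNIV (\<lambda>z::bcoord. f2 (snd (fst z)))"
      by (intro continuous_intros)+
    have "closed {z::bcoord. (fst (snd z))\<^sup>2 = (f1 (fst (fst z)) - k1) * (f1 (fst (fst z)) - k2)}"
      "closed {z::bcoord. (snd (snd z))\<^sup>2 = (f2 (snd (fst z)) - k1) * (k2 - f2 (snd (fst z)))}"
      "closed {z. S z \<ge> 0}"
      by (intro closed_Collect_eq closed_Collect_le continuous_intros c cont_S)+
    then have "closed Lam" unfolding Lam_def energy_def by (intro closed_Collect_conj)
    then show "open (- Lam)" by auto
    show "z' \<in> - Lam" if "rel z z'" "z \<in> - Lam" for z z' using Lam_rel that by auto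
    show "bdry_class z \<in> TGamma T - ?\<Lambda> \<longleftrightarrow> z \<in> - Lam" if "z \<in> regular" for z
      using bdry_class_mem_iff[OF that Lam_regular Lam_rel] TG[of "{z}"] by auto
    show "bdry_covec a b e1 e2 \<in> TGamma T - ?\<Lambda> \<longleftrightarrow> ((a, b), (0, 0)) \<in> - Lam" if "f1 a = f2 b" for a b e1 e2
      using branch_not_mem[OF that Lam_regular] Lam_regular that bdry_covec_TGamma by (auto simp: regular_iff)
  qed auto
  then have "closedin (TGamma_top T) ?\<Lambda>"
    using TG[of Lam] by (simp add: closedin_def topspace_TGamma)
  then have closedY: "closedin ?Y ?\<Lambda>"
    using LamLv by (simp add: closedin_subset_topspace closedin_subtopology_Int_subset closedin_closed_subtopology
      closedin_subtopology) (metis inf.absorb1)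
  define \<xi> where "\<xi> = \<Psi> (0, 0)"
  have \<xi>: "\<xi> \<in> ?\<Lambda>" unfolding range_\<Psi>[symmetric] \<xi>_def by simp
  have \<xi>Y: "\<xi> \<in> topspace ?Y" using \<xi> openin_subset[OF openY] by auto
  have C: "connected_component_of_set ?Y \<xi> \<in> connected_components_of ?Y"
    using \<xi>Y by (simp add: connected_component_in_connected_components_of)
  have \<xi>C: "\<xi> \<in> connected_component_of_set ?Y \<xi>" using \<xi>Y by (simp add: connected_component_of_refl)
  have "?\<Lambda> \<subseteq> connected_component_of_set ?Y \<xi>"
    by (rule connected_components_of_maximal[OF C connY]) (use \<xi> \<xi>C in \<open>auto simp: disjnt_def\<close>)
  moreover have "connected_component_of_set ?Y \<xi> \<subseteq> ?\<Lambda>"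
    using connectedin_clopen_cases[OF connectedin_connected_components_of[OF C] closedY openY] \<xi> \<xi>C
    by (auto simp: disjnt_def)
  ultimately have "range \<Psi> \<in> connected_components_of ?Y" using C unfolding range_\<Psi> by simp
  then show "\<exists>c1 c2. range \<Psi> \<in> connected_components_of
      (subtopology (TGamma_top T) {\<xi> \<in> BGamma T. F1 T \<xi> = c1 \<and> F2 T \<xi> = c2})"
    unfolding Lv_def by blast
next
  fix \<xi> assume "\<xi> \<in> range \<Psi>"
  then show "independent_at T \<xi>" using independent_at_\<Psi> by auto
qed

text \<open>\<open>a_form\<close> and \<open>b_form\<close> are dual to the Hamiltonian vector fields \<open>r1 \<partial>\<theta>\<^sub>1 + h1 \<partial>p\<^sub>1\<close> and \<open>r2 \<partial>\<theta>\<^sub>2 + h2 \<partial>p\<^sub>2\<close>,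
  which span the tangent planes of the torus; \<open>A_form\<close> and \<open>B_form\<close> are the differentials of
  \<open>p\<^sub>1\<^sup>2 - g1 \<theta>\<^sub>1\<close> and \<open>p\<^sub>2\<^sup>2 - g2 \<theta>\<^sub>2\<close> and satisfy \<open>A \<and> B = (\<phi>\<^sub>1 - \<phi>\<^sub>2) dF\<^sub>1 \<and> dF\<^sub>2\<close>.\<close>

definition a_form :: "real \<times> real \<Rightarrow> bcoord \<Rightarrow> real" where
  "a_form s v = (r1 s * fst (fst v) + h1 s * fst (snd v)) / ((r1 s)\<^sup>2 + (h1 s)\<^sup>2)"

definition b_form :: "real \<times> real \<Rightarrow> bcoord \<Rightarrow> real" where
  "b_form s v = (r2 s * snd (fst v) + h2 s * snd (snd v)) / ((r2 s)\<^sup>2 + (h2 s)\<^sup>2)"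

definition leray :: "real \<times> real \<Rightarrow> bcoord \<Rightarrow> bcoord \<Rightarrow> real" where
  "leray s u v = - (gap s / 2) * wedge11 (a_form s) (b_form s) u v"

text \<open>The covectors (p, h) and (-h, p) are orthogonal of equal length, so after normalization
  by the squared length their wedge is a constant multiple of the area form.\<close>

lemma wedge_dual:
  fixes p h :: real
  assumes "p\<^sup>2 + h\<^sup>2 > 0"
  shows "(p * u + h * l) / (p\<^sup>2 + h\<^sup>2) * (2 * (p * l' - h * u')) - (p * u' + h * l') / (p\<^sup>2 + h\<^sup>2) * (2 * (p * l - h * u))
    = - 2 * (l * u' - l' * u)"
proof -
  have 1: "(p * u + h * l) * (2 * (p * l' - h * u')) - (p * u' + h * l') * (2 * (p * l - h * u))
    = (- 2 * (l * u' - l' * u)) * (p\<^sup>2 + h\<^sup>2)" by (simp add: algebra_simps power2_eq_square)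
  have 2: "x / d * y - x' / d * y' = (x * y - x' * y') / d" for x y x' y' d :: real
    by (simp add: diff_divide_distrib)
  have "p\<^sup>2 + h\<^sup>2 \<noteq> 0" using assms by linarith
  then show ?thesis unfolding 2 1 by (rule nonzero_mult_div_cancel_right)
qed

lemma two_form_leray: "two_form (leray s)"
proof -
  have lin: "linear (a_form s)" "linear (b_form s)"
    unfolding a_form_def b_form_def
    by (auto intro!: linearI simp: algebra_simps add_divide_distrib)
  show ?thesis
    unfolding two_form_def bilinear_def leray_def wedge11_def
    by (intro conjI allI linearI)
      (simp_all add: linear_add[OF lin(1)] linear_add[OF lin(2)] linear_scale[OF lin(1)] linear_scale[OF lin(2)] field_simps)
qed

text \<open>The symplectic form is the sum of the area forms \<sigma>1 and \<sigma>2, so its square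
  is 2 \<sigma>1 \<sigma>2. The wedge of \<open>a_form\<close>, \<open>b_form\<close>, A and B is -4
  \<sigma>1 \<sigma>2, and dF1 dF2 is A B divided by \<open>gap s\<close>. This explains the
  constant -(\<open>gap s\<close> / 2) in \<open>leray\<close>.\<close>

lemma leray_wedge: "wedge22 (leray s) (wedge11 (D1_form (\<psi> s)) (D2_form (\<psi> s))) = wedge22 symp symp"
proof (intro ext)
  fix u v w z :: bcoord
  define \<sigma>1 \<sigma>2 where "\<sigma>1 u v = fst (snd u) * fst (fst v) - fst (snd v) * fst (fst u)"
    and "\<sigma>2 u v = snd (snd u) * snd (fst v) - snd (snd v) * snd (fst u)" for u v :: bcoord
  have aA: "wedge11 (a_form s) (A_form (\<psi> s)) u v = - 2 * \<sigma>1 u v" for u v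
    unfolding wedge11_def a_form_def A_form_\<psi> \<sigma>1_def by (rule wedge_dual[OF nondegenerate(1)])
  have bB: "wedge11 (b_form s) (B_form (\<psi> s)) u v = - 2 * \<sigma>2 u v" for u v
    unfolding wedge11_def b_form_def B_form_\<psi> \<sigma>2_def by (rule wedge_dual[OF nondegenerate(2)])
  have "wedge22 (leray s) (wedge11 (D1_form (\<psi> s)) (D2_form (\<psi> s))) u v w z
    = - (1 / 2) * wedge22 (wedge11 (a_form s) (b_form s)) (wedge11 (A_form (\<psi> s)) (B_form (\<psi> s))) u v w z"
    using gap_pos[of s] unfolding wedge22_def leray_def wedge_D_forms by (simp add: field_simps)
  also have "\<dots> = (1 / 2) * wedge22 (wedge11 (a_form s) (A_form (\<psi> s))) (wedge11 (b_form s) (B_form (\<psi> s))) u v w z"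
    unfolding wedge22_wedge11[of "a_form s" "b_form s"] by simp
  also have "\<dots> = 2 * wedge22 \<sigma>1 \<sigma>2 u v w z"
    unfolding wedge22_def aA bB by (simp add: algebra_simps)
  also have "\<dots> = wedge22 symp symp u v w z"
  proof -
    have symp: "symp u v = \<sigma>1 u v + \<sigma>2 u v" for u v
      by (cases u; cases v) (auto simp: symp_def \<sigma>1_def \<sigma>2_def inner_prod_def)
    have sq: "\<sigma>1 u v * \<sigma>1 w z - \<sigma>1 u w * \<sigma>1 v z + \<sigma>1 u z * \<sigma>1 v w = 0"
      "\<sigma>2 u v * \<sigma>2 w z - \<sigma>2 u w * \<sigma>2 v z + \<sigma>2 u z * \<sigma>2 v w = 0" for u v w z
      by (simp_all add: \<sigma>1_def \<sigma>2_def algebra_simps)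
    show ?thesis unfolding wedge22_def symp using sq[of u v w z] by (simp add: algebra_simps)
  qed
  finally show "wedge22 (leray s) (wedge11 (D1_form (\<psi> s)) (D2_form (\<psi> s))) u v w z = wedge22 symp symp u v w z" .
qed

definition \<psi>' :: "real \<times> real \<Rightarrow> real \<times> real \<Rightarrow> bcoord" where
  "\<psi>' s x = ((e1 (fst s) * r1 s * fst x, e2 (snd s) * r2 s * snd x), (e1 (fst s) * h1 s * fst x, e2 (snd s) * h2 s * snd x))"

lemma has_derivative_\<psi>: "(\<psi> has_derivative \<psi>' s) (at s)"
proof -
  have c: "((\<lambda>s::real \<times> real. f (fst s)) has_derivative (\<lambda>x. D * fst x)) (at s)"
    if "(f has_real_derivative D) (at (fst s))" for f D
    using has_derivative_compose[of fst fst s UNIV f "times D"] that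
    by (simp add: has_field_derivative_def has_derivative_fst)
  have c': "((\<lambda>s::real \<times> real. f (snd s)) has_derivative (\<lambda>x. D * snd x)) (at s)"
    if "(f has_real_derivative D) (at (snd s))" for f D
    using has_derivative_compose[of snd snd s UNIV f "times D"] that
    by (simp add: has_field_derivative_def has_derivative_snd)
  show ?thesis
    unfolding \<psi>_def \<psi>'_def h1_def h2_def
    by (intro has_derivative_Pair c c' O1.der_theta O1.der_p O2.der_theta O2.der_p)
qed

text \<open>On the coordinate tangent vectors \<open>a_form\<close> and \<open>b_form\<close> take
  the time densities e1 and e2 as values. The negative sign is one of orientation and cancels in the
  normalized Radon transform.\<close>

definition \<delta> :: "real \<times> real \<Rightarrow> real" where
  "\<delta> s = - (gap s / 2) * (e1 (fst s) * e2 (snd s))"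

lemma leray_\<psi>': "leray s (\<psi>' s (1, 0)) (\<psi>' s (0, 1)) = \<delta> s"
proof -
  have a: "a_form s (\<psi>' s (1, 0)) = e1 (fst s)" "b_form s (\<psi>' s (0, 1)) = e2 (snd s)"
    "a_form s (\<psi>' s (0, 1)) = 0" "b_form s (\<psi>' s (1, 0)) = 0"
  proof -
    have *: "(p * (e * p) + h * (e * h)) / (p\<^sup>2 + h\<^sup>2) = e" if "p\<^sup>2 + h\<^sup>2 > 0" for p h e :: real
    proof -
      have 1: "p * (e * p) + h * (e * h) = e * (p\<^sup>2 + h\<^sup>2)" by (simp add: power2_eq_square algebra_simps)
      have "p\<^sup>2 + h\<^sup>2 \<noteq> 0" using that by linarith
      then show ?thesis unfolding 1 by (rule nonzero_mult_div_cancel_right)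
    qed
    show "a_form s (\<psi>' s (1, 0)) = e1 (fst s)" "b_form s (\<psi>' s (0, 1)) = e2 (snd s)"
      "a_form s (\<psi>' s (0, 1)) = 0" "b_form s (\<psi>' s (1, 0)) = 0"
      using *[OF nondegenerate(1)[of s]] *[OF nondegenerate(2)[of s]]
      by (simp_all add: a_form_def b_form_def \<psi>'_def)
  qed
  show ?thesis by (simp add: leray_def wedge11_def a \<delta>_def)
qed

lemma inj_\<psi>': "inj (\<psi>' s)"
proof (rule injI)
  fix x y assume eq: "\<psi>' s x = \<psi>' s y"
  have cancel: "x1 = y1" if "e * p * x1 = e * p * y1" "e * h * x1 = e * h * y1" "e > 0" "p\<^sup>2 + h\<^sup>2 > 0"
    for e p h x1 y1 :: real
    using that by (auto simp: sum_power2_gt_zero_iff)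
  have "e1 (fst s) * r1 s * fst x = e1 (fst s) * r1 s * fst y" "e1 (fst s) * h1 s * fst x = e1 (fst s) * h1 s * fst y"
    "e2 (snd s) * r2 s * snd x = e2 (snd s) * r2 s * snd y" "e2 (snd s) * h2 s * snd x = e2 (snd s) * h2 s * snd y"
    using eq unfolding \<psi>'_def prod.inject by blast+
  then have "fst x = fst y" "snd x = snd y"
    using cancel[OF _ _ O1.e_pos nondegenerate(1)] cancel[OF _ _ O2.e_pos nondegenerate(2)] by blast+
  then show "x = y" by (rule prod_eqI)
qed

lemma cont_fst: "continuous_on UNIV f \<Longrightarrow> continuous_on UNIV (\<lambda>s::real \<times> real. f (fst s))"
  and cont_snd: "continuous_on UNIV f \<Longrightarrow> continuous_on UNIV (\<lambda>s::real \<times> real. f (snd s))" for f :: "real \<Rightarrow> real"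
  by (rule continuous_on_compose2[where t = UNIV], assumption, intro continuous_intros, simp)+

lemma torus_param_\<Psi>: "torus_param T (range \<Psi>) \<Psi> \<delta>"
  unfolding torus_param_def
proof (intro conjI allI)
  show "\<Psi> s = \<Psi> t \<longleftrightarrow> fst s - fst t \<in> \<int> \<and> snd s - snd t \<in> \<int>" for s t by (rule \<Psi>_eq_iff)
  fix s0 :: "real \<times> real"
  note C = cont_fst[OF O1.cont_e] cont_fst[OF O1.cont_p] cont_snd[OF O2.cont_e] cont_snd[OF O2.cont_p]
    cont_fst[OF continuous_on_compose2[OF O1.cont_g' O1.cont_theta subset_UNIV]]
    cont_snd[OF continuous_on_compose2[OF O2.cont_g' O2.cont_theta subset_UNIV]]
  have "(\<lambda>s. \<psi>' s (1, 0)) = (\<lambda>s. ((e1 (fst s) * r1 s, 0), (e1 (fst s) * (g1' (\<theta>1 (fst s)) / 2), 0)))"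
    "(\<lambda>s. \<psi>' s (0, 1)) = (\<lambda>s. ((0, e2 (snd s) * r2 s), (0, e2 (snd s) * (g2' (\<theta>2 (snd s)) / 2))))"
    by (simp_all add: \<psi>'_def h1_def h2_def)
  then have "continuous_on UNIV (\<lambda>s. \<psi>' s (1, 0))" "continuous_on UNIV (\<lambda>s. \<psi>' s (0, 1))"
    by (simp only:, intro continuous_on_Pair continuous_on_mult continuous_on_const continuous_on_divide C, simp)+
  moreover have "\<psi> s \<in> bparam_dom T (0, 0, N)" "bparam T (0, 0, N) (\<psi> s) = \<Psi> s" for s
    using \<psi>_regular by (simp_all add: chart0 \<Psi>_def)
  moreover have form: "\<exists>D1 D2 \<alpha>. dF T (0, 0, N) (\<psi> s) D1 D2 \<and> two_form \<alpha> \<and>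
      wedge22 \<alpha> (wedge11 D1 D2) = wedge22 symp symp \<and> \<delta> s = \<alpha> (\<psi>' s (1, 0)) (\<psi>' s (0, 1))" for s
    by (rule exI[of _ "D1_form (\<psi> s)"], rule exI[of _ "D2_form (\<psi> s)"], rule exI[of _ "leray s"])
      (intro conjI dF_\<psi> two_form_leray leray_wedge leray_\<psi>'[symmetric])
  ultimately show "\<exists>c\<in>bcenter T. \<exists>U \<psi> \<psi>'. open U \<and> s0 \<in> U \<and>
        continuous_on U (\<lambda>s. \<psi>' s (1, 0)) \<and> continuous_on U (\<lambda>s. \<psi>' s (0, 1)) \<and>
        (\<forall>s\<in>U. \<psi> s \<in> bparam_dom T c \<and> bparam T c (\<psi> s) = \<Psi> s \<and>
           (\<psi> has_derivative \<psi>' s) (at s) \<and> inj (\<psi>' s) \<and>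
           (\<exists>D1 D2 \<alpha>. dF T c (\<psi> s) D1 D2 \<and> two_form \<alpha> \<and>
              wedge22 \<alpha> (wedge11 D1 D2) = wedge22 symp symp \<and>
              \<delta> s = \<alpha> (\<psi>' s (1, 0)) (\<psi>' s (0, 1))))"
    by (intro bexI[OF _ chart0_bcenter] exI[of _ UNIV] exI[of _ \<psi>] exI[of _ \<psi>'] conjI ballI open_UNIV UNIV_I
      has_derivative_\<psi> inj_\<psi>' form)
qed simp

section \<open>The Radon transform of one torus\<close>

lemma \<Psi>_mem_U: "range \<Psi> \<subseteq> U1 T \<union> U2 T"
proof
  fix \<xi> assume "\<xi> \<in> range \<Psi>"
  then obtain s where \<xi>: "\<xi> = bdry_class (\<psi> s)" by (auto simp: \<Psi>_def)
  note E = bdry_class_Lam_facts[OF energy_\<psi>[of s], folded \<xi>]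
  have "foot \<xi> \<notin> proj T ` branch1 T"
  proof
    assume "foot \<xi> \<in> proj T ` branch1 T"
    then obtain a b c where abc: "(a, b, c) \<in> branch1 T" "proj T (a, b, c) = proj T (\<theta>1 (fst s), \<theta>2 (snd s), N)"
      by (auto simp: \<xi> bdry_class_def foot_bdry_covec \<psi>_def)
    have "(\<theta>1 (fst s), \<theta>2 (snd s), N) \<in> proj T (\<theta>1 (fst s), \<theta>2 (snd s), N)"
      unfolding proj_eq by (intro UN_I[of 0]) (auto simp: shift_def)
    then have "f1 a = f2 b \<longrightarrow> gap s = 0"
      using fst_covec_regular[of "(\<theta>1 (fst s), \<theta>2 (snd s), N)" a b c] abc(2) by (simp add: gap_def)
    moreover have "f1 a = f2 b"
      unfolding f1_eq_f2 f1_eq_nu1 f2_eq_nu1 using abc(1) by (auto simp: branch1_def)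
    ultimately show False using gap_pos[of s] by simp
  qed
  moreover have "roots_at T \<xi> k1 k2"
    using k1 k2 E unfolding roots_at_def by (auto simp: power2_eq_square algebra_simps)
  ultimately show "\<xi> \<in> U1 T \<union> U2 T"
    using E(1) k1 k2 unfolding U1_def U2_def by (auto simp: neq_iff)
qed

text \<open>The density is continuous and negative. Nonvanishing matters because division by zero
  yields 0, and then a vanishing transform would carry no information about K.\<close>

lemma integral_\<delta>_nonzero: "integral (cbox (0, 0) (1, 1)) \<delta> \<noteq> 0"
proof
  assume 0: "integral (cbox (0, 0) (1, 1)) \<delta> = 0"
  have "continuous_on UNIV (\<lambda>s. - \<delta> s)"
    unfolding \<delta>_def gap_def
    by (intro continuous_on_minus continuous_on_mult continuous_on_divide continuous_on_diff continuous_on_const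
        cont_fst[OF O1.cont_e] cont_snd[OF O2.cont_e]
        cont_fst[OF continuous_on_compose2[OF continuous_f(1) O1.cont_theta subset_UNIV]]
        cont_snd[OF continuous_on_compose2[OF continuous_f(2) O2.cont_theta subset_UNIV]]) simp
  then have c: "continuous_on (cbox (0, 0) (1, 1)) (\<lambda>s. - \<delta> s)"
    by (rule continuous_on_subset) simp
  have pos: "- \<delta> s > 0" for s
    using gap_pos[of s] O1.e_pos[of "fst s"] O2.e_pos[of "snd s"] by (simp add: \<delta>_def)
  have "((\<lambda>s. - \<delta> s) has_integral 0) (cbox (0, 0) (1, 1))"
    using integrable_integral[OF integrable_continuous[OF c]] 0 by simp
  then have "- \<delta> (0, 0) = 0"
    by (rule has_integral_0_cbox_imp_0[OF c less_imp_le[OF pos]]) (auto simp: box_ne_empty Basis_prod_def)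
  then show False using pos[of "(0, 0)"] by simp
qed

lemma normal_pairing_\<Psi>: "normal_pairing T (pi_plus T (\<Psi> s)) = sqrt (Q3 / P3 (\<theta>1 (fst s)) (\<theta>2 (snd s)))"
proof -
  have "energy ((\<theta>1 (fst s), \<theta>2 (snd s)), (q1 (fst s), q2 (snd s)))" using energy_\<psi>[of s] by (simp add: \<psi>_def)
  from energy_regular[OF this] show ?thesis
    using normal_pairing_bdry_covec by (simp add: \<Psi>_def \<psi>_def)
qed

text \<open>By \<open>normal_pairing_\<Psi>\<close> the inverse normal pairing is sqrt (P3) / sqrt
  (Q3) with \<open>Q3\<close> constant on the torus. So in both cases \<mu> is a constant times a
  function W of the base point that does not depend on the torus.\<close>

lemma radon_integral_eq_0:
  fixes K :: "pt set \<Rightarrow> real" and \<mu> :: "brep set \<Rightarrow> real" and W :: "real \<Rightarrow> real \<Rightarrow> real"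
  assumes \<mu>: "((\<forall>\<xi>\<in>BGamma T. \<mu> \<xi> = 1) \<and> W = (\<lambda>a b. 1)) \<or>
         ((\<forall>\<xi>\<in>BGamma T. \<mu> \<xi> = inverse (normal_pairing T (pi_plus T \<xi>))) \<and> W = (\<lambda>a b. sqrt (P3 a b)))"
    and K: "\<And>\<Lambda> r. liouville_torus T \<Lambda> \<Longrightarrow> \<Lambda> \<subseteq> U1 T \<union> U2 T \<Longrightarrow> has_radon_transform T K \<mu> \<Lambda> r \<Longrightarrow> r = 0"
  shows "integral (cbox (0, 0) (1, 1)) (\<lambda>s. K (proj T (\<theta>1 (fst s), \<theta>2 (snd s), N)) * W (\<theta>1 (fst s)) (\<theta>2 (snd s)) *
     (f1 (\<theta>1 (fst s)) - f2 (\<theta>2 (snd s))) * e1 (fst s) * e2 (snd s)) = 0" (is "integral _ ?f = 0")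
proof -
  let ?g = "\<lambda>s. K (foot (\<Psi> s)) * \<mu> (\<Psi> s) * \<delta> s"
  have "has_radon_transform T K \<mu> (range \<Psi>) (1 / integral (cbox (0, 0) (1, 1)) \<delta> * integral (cbox (0, 0) (1, 1)) ?g)"
    unfolding has_radon_transform_def using torus_param_\<Psi> by blast
  from K[OF liouville_torus_range \<Psi>_mem_U this] integral_\<delta>_nonzero
  have 0: "integral (cbox (0, 0) (1, 1)) ?g = 0" by simp
  obtain c where c: "c \<noteq> 0" "\<And>s. \<mu> (\<Psi> s) = c * W (\<theta>1 (fst s)) (\<theta>2 (snd s))"
  proof -
    have B: "\<Psi> s \<in> BGamma T" for s using bdry_class_Lam_facts(1)[OF energy_\<psi>[of s]] by (simp add: \<Psi>_def)
    show thesis using \<mu>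
    proof
      assume "(\<forall>\<xi>\<in>BGamma T. \<mu> \<xi> = 1) \<and> W = (\<lambda>a b. 1)"
      then show thesis using B by (intro that[of 1]) auto
    next
      assume *: "(\<forall>\<xi>\<in>BGamma T. \<mu> \<xi> = inverse (normal_pairing T (pi_plus T \<xi>))) \<and> W = (\<lambda>a b. sqrt (P3 a b))"
      show thesis
      proof (rule that[of "1 / sqrt Q3"])
        show "1 / sqrt Q3 \<noteq> 0" using Q3_pos by simp
        show "\<mu> (\<Psi> s) = 1 / sqrt Q3 * W (\<theta>1 (fst s)) (\<theta>2 (snd s))" for s
          using * B[of s] normal_pairing_\<Psi>[of s] by (simp add: real_sqrt_divide)
      qed
    qed
  qed
  have "?g = (\<lambda>s. (- c / 2) * ?f s)"
    unfolding c(2) \<delta>_def gap_def by (auto simp: \<Psi>_def bdry_class_def foot_bdry_covec \<psi>_def fun_eq_iff)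
  then have "(- c / 2) * integral (cbox (0, 0) (1, 1)) ?f = 0" using 0 by (simp only: integral_mult_right)
  then show ?thesis using c(1) by simp
qed

end

section \<open>The two families of tori\<close>

lemma smooth_fun_on_uminus_const:
  assumes "smooth_fun_on UNIV f"
  shows "smooth_fun_on UNIV (\<lambda>x. - f x)" "smooth_fun_on UNIV (\<lambda>x. f x - k)"
proof -
  obtain D where D0: "\<And>x. D 0 x = f x"
    and D: "\<And>n x. (D n has_real_derivative D (Suc n) x) (at x)"
    using assms unfolding smooth_fun_on_def by auto
  show "smooth_fun_on UNIV (\<lambda>x. - f x)"
    unfolding smooth_fun_on_def
    by (rule exI[of _ "\<lambda>n x. - D n x"]) (auto simp: D0 intro!: DERIV_minus D)
  have "((\<lambda>x. D n x - (if n = 0 then k else 0)) has_real_derivative D (Suc n) x) (at x)" for n x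
    using DERIV_diff[OF D DERIV_const] by simp
  then show "smooth_fun_on UNIV (\<lambda>x. f x - k)"
    unfolding smooth_fun_on_def
    by (intro exI[of _ "\<lambda>n x. D n x - (if n = 0 then k else 0)"]) (auto simp: D0)
qed

text \<open>Hadamard's lemma is applied at the two symmetric roots. At the roots the sign of
  \<open>h\<close> is read off from f' (c + r) = - 2 r h (c + r) and its mirror image, which uses
  that the roots are simple; between them it is the sign of f.\<close>

lemma symmetric_smooth_factor:
  assumes f: "smooth_fun_on UNIV f" and sym: "\<And>x. f (2 * c - x) = f x" and r: "r > 0"
    and root: "f (c + r) = 0" and D: "(f has_real_derivative D) (at (c + r))" "D < 0"
    and pos: "\<And>x. \<bar>x - c\<bar> < r \<Longrightarrow> f x > 0"
  obtains h where "smooth_fun_on UNIV h" "\<And>x. f x = (r\<^sup>2 - (x - c)\<^sup>2) * h x"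
    "\<And>x. \<bar>x - c\<bar> \<le> r \<Longrightarrow> h x > 0"
proof -
  obtain k where k: "smooth_fun_on UNIV k" "\<And>x. f x = (x - (c + r)) * k x"
    using smooth_fun_on_UNIV_div_linear[OF f root] by blast
  have "f (c - r) = 0" using sym[of "c + r"] root by simp
  then have "k (c - r) = 0" using k(2)[of "c - r"] r by simp
  from smooth_fun_on_UNIV_div_linear[OF k(1) this]
  obtain l where l: "smooth_fun_on UNIV l" "\<And>x. k x = (x - (c - r)) * l x" by blast
  define h where "h x = - l x" for x
  have hs: "smooth_fun_on UNIV h" unfolding h_def by (rule smooth_fun_on_uminus_const[OF l(1)])
  have fh: "f x = (r\<^sup>2 - (x - c)\<^sup>2) * h x" for x
    unfolding k(2) l(2) h_def by (simp add: power2_eq_square algebra_simps)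
  obtain h' where h': "\<And>x. (h has_real_derivative h' x) (at x)"
    using smooth_fun_on_UNIV_derivative[OF hs] by blast
  have df: "(f has_real_derivative - 2 * (x - c) * h x + (r\<^sup>2 - (x - c)\<^sup>2) * h' x) (at x)" for x
    unfolding fh[abs_def] by (auto intro!: derivative_eq_intros h')
  have "- 2 * r * h (c + r) = D"
    using DERIV_unique[OF df[of "c + r"] D(1)] by simp
  then have "- (2 * r * h (c + r)) < 0" using D(2) by linarith
  then have h1: "h (c + r) > 0" using r by (simp add: zero_less_mult_iff)
  have "((\<lambda>x. f (2 * c - x)) has_real_derivative D * (- 1)) (at (c - r))"
    by (rule DERIV_chain2[of f]) (use D(1) in \<open>auto intro!: derivative_eq_intros simp: algebra_simps\<close>)
  then have "(f has_real_derivative - D) (at (c - r))" unfolding sym by simp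
  from DERIV_unique[OF df[of "c - r"] this] have "2 * r * h (c - r) = - D" by simp
  then have "2 * r * h (c - r) > 0" using D(2) by linarith
  then have h2: "h (c - r) > 0" using r by (simp add: zero_less_mult_iff)
  have "h x > 0" if x: "\<bar>x - c\<bar> \<le> r" for x
  proof -
    consider "\<bar>x - c\<bar> < r" | "x = c + r" | "x = c - r" using x by linarith
    then show ?thesis
    proof cases
      case 1
      then have "(x - c)\<^sup>2 < r\<^sup>2" using power_strict_mono[of "\<bar>x - c\<bar>" r 2] by simp
      then show ?thesis using pos[OF 1] unfolding fh by (simp add: zero_less_mult_iff)
    qed (use h1 h2 in auto)
  qed
  then show thesis using that hs fh by blast
qed

text \<open>[0, w / 4] is a fundamental domain of the group generated by the reflections in 0 and w
  / 4. The quantifier over H stands inside so that one representative serves all invariant functions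
  at once.\<close>

lemma symmetric_reduce:
  fixes w x :: real
  assumes "w > 0"
  obtains x' where "0 \<le> x'" "x' \<le> w / 4"
    "\<forall>H :: real \<Rightarrow> real. (\<forall>t. H (- t) = H t) \<and> (\<forall>t. H (w / 2 - t) = H t) \<longrightarrow> H x' = H x"
proof -
  define n where "n = \<lfloor>x / (w / 2)\<rfloor>"
  define y where "y = x - of_int n * (w / 2)"
  have y: "0 \<le> y" "y \<le> w / 2"
    using floor_divide_lower[of "w / 2" x] floor_divide_upper[of "w / 2" x] assms
    by (auto simp: y_def n_def algebra_simps)
  have H: "H y = H x" if "\<And>t. H (- t) = H t" "\<And>t. H (w / 2 - t) = H t" for H :: "real \<Rightarrow> real"
  proof -
    have "H (t + w / 2) = H t" for t
      using that(2)[of "- t"] that(1)[of t] by (simp add: add.commute)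
    from fun_periodic_int[where f = H, OF this, of y n] show ?thesis by (simp add: y_def)
  qed
  show thesis
  proof (cases "y \<le> w / 4")
    case True
    then show thesis using that[of y] y H by auto
  next
    case False
    have "H (w / 2 - y) = H x" if "\<And>t. H (- t) = H t" "\<And>t. H (w / 2 - t) = H t" for H :: "real \<Rightarrow> real"
      using H[OF that] that(2)[of y] by simp
    then show thesis using that[of "w / 2 - y"] y False by auto
  qed
qed

context classical_table
begin

lemma f1_mono: "0 \<le> a \<Longrightarrow> a < a' \<Longrightarrow> a' \<le> w1 / 4 \<Longrightarrow> f1 a < f1 a'"
  and f2_mono: "0 \<le> a \<Longrightarrow> a < a' \<Longrightarrow> a' \<le> w2 / 4 \<Longrightarrow> f2 a < f2 a'"
proof -
  have d: "\<forall>t. 0 < t \<and> t < w1 / 4 \<longrightarrow> deriv f1 t > 0" "\<forall>t. 0 < t \<and> t < w2 / 4 \<longrightarrow> deriv f2 t > 0"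
    using classical by (auto simp: classical_liouville_table_def)
  show "f1 a < f1 a'" if "0 \<le> a" "a < a'" "a' \<le> w1 / 4"
    by (rule DERIV_pos_imp_increasing_open[OF that(2)])
      (use d(1) deriv_f(1) that in \<open>force intro: continuous_on_subset[OF continuous_f(1)]\<close>)+
  show "f2 a < f2 a'" if "0 \<le> a" "a < a'" "a' \<le> w2 / 4"
    by (rule DERIV_pos_imp_increasing_open[OF that(2)])
      (use d(2) deriv_f(2) that in \<open>force intro: continuous_on_subset[OF continuous_f(2)]\<close>)+
qed

lemma f_values: "f1 0 = nu1 T" "f2 0 = 0" "f2 (w2 / 4) = nu1 T" "f1 (w1 / 4) = nu0 T" "f1 a \<le> nu0 T"
proof -
  show "f1 0 = nu1 T" unfolding f1_eq_nu1 by (rule exI[of _ 0]) simp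
  show "f2 0 = 0" unfolding f2_eq_0 by (rule exI[of _ 0]) simp
  show "f2 (w2 / 4) = nu1 T" unfolding f2_eq_nu1 by (rule exI[of _ 0]) simp
  have le: "f1 a \<le> f1 (w1 / 4)" for a
  proof -
    obtain a' where a': "0 \<le> a'" "a' \<le> w1 / 4"
      "\<forall>H :: real \<Rightarrow> real. (\<forall>t. H (- t) = H t) \<and> (\<forall>t. H (w1 / 2 - t) = H t) \<longrightarrow> H a' = H a"
      by (rule symmetric_reduce[OF sizes(2), where x = a])
    have "f1 a' = f1 a" using a'(3) even(1) half(1) by blast
    moreover have "f1 a' \<le> f1 (w1 / 4)"
    proof (cases "a' < w1 / 4")
      case True
      then show ?thesis using f1_mono[of a' "w1 / 4"] a'(1) by simp
    next
      case False
      then have "a' = w1 / 4" using a'(2) by linarith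
      then show ?thesis by (simp only: order_refl)
    qed
    ultimately show ?thesis by simp
  qed
  then show 1: "f1 (w1 / 4) = nu0 T" unfolding nu0_def
    by (intro cSup_eq_maximum[symmetric]) auto
  show "f1 a \<le> nu0 T" using le 1 by simp
qed

text \<open>On the open quarter period the derivative is positive, so the level k is attained there
  exactly once and transversally. The reflection in \<open>w1 / 4\<close> supplies the other turning
  point.\<close>

lemma f1_oscillation:
  assumes "nu1 T < k" "k < nu0 T"
  obtains r h where "0 < r" "r < w1 / 4" "smooth_fun_on UNIV h"
    "\<And>x. f1 x - k = (r\<^sup>2 - (x - w1 / 4)\<^sup>2) * h x" "\<And>x. \<bar>x - w1 / 4\<bar> \<le> r \<Longrightarrow> h x > 0"
    "\<And>x. 0 \<le> x \<Longrightarrow> x \<le> w1 / 2 \<Longrightarrow> \<bar>x - w1 / 4\<bar> > r \<Longrightarrow> f1 x < k"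
proof -
  obtain x0 where x0: "0 \<le> x0" "x0 \<le> w1 / 4" "f1 x0 = k"
    using IVT'[of f1 0 k "w1 / 4"] assms f_values sizes continuous_on_subset[OF continuous_f(1)] by auto
  have "x0 \<noteq> 0" "x0 \<noteq> w1 / 4" using x0(3) assms f_values(1,4) by (metis less_irrefl)+
  then have x0': "0 < x0" "x0 < w1 / 4" using x0 by auto
  define r where "r = w1 / 4 - x0"
  have sym: "f1 (2 * (w1 / 4) - x) - k = f1 x - k" for x using half(1)[of x] by simp
  have up: "f1 x < k" if "0 \<le> x" "x < x0" for x using f1_mono[of x x0] that x0 by simp
  have lo: "f1 x > k" if "x0 < x" "x \<le> w1 / 4" for x using f1_mono[of x0 x] that x0 by simp
  have d: "deriv f1 x0 > 0" using classical x0' by (simp add: classical_liouville_table_def)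
  have "((\<lambda>x. f1 (w1 / 2 - x)) has_real_derivative deriv f1 x0 * (- 1)) (at (w1 / 2 - x0))"
    by (rule DERIV_chain2[of f1]) (use deriv_f(1)[of x0] in \<open>auto intro!: derivative_eq_intros\<close>)
  then have D: "((\<lambda>x. f1 x - k) has_real_derivative - deriv f1 x0) (at (w1 / 4 + r))"
    unfolding half r_def by (auto intro!: derivative_eq_intros simp: algebra_simps)
  have pos: "f1 x - k > 0" if "\<bar>x - w1 / 4\<bar> < r" for x
    using lo[of x] lo[of "w1 / 2 - x"] half(1)[of x] that by (cases "x \<le> w1 / 4") (auto simp: r_def)
  have root: "f1 (w1 / 4 + r) - k = 0" using half(1)[of x0] x0 by (simp add: r_def)
  have r: "0 < r" "r < w1 / 4" using x0' by (auto simp: r_def)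
  obtain h where "smooth_fun_on UNIV h" "\<And>x. f1 x - k = (r\<^sup>2 - (x - w1 / 4)\<^sup>2) * h x"
    "\<And>x. \<bar>x - w1 / 4\<bar> \<le> r \<Longrightarrow> h x > 0"
    by (rule symmetric_smooth_factor[OF smooth_fun_on_uminus_const(2)[OF smooth(1)] sym r(1) root D _ pos]) (use d in auto)
  moreover have "f1 x < k" if "0 \<le> x" "x \<le> w1 / 2" "\<bar>x - w1 / 4\<bar> > r" for x
    using up[of x] up[of "w1 / 2 - x"] half(1)[of x] that by (cases "x \<le> w1 / 4") (auto simp: r_def)
  ultimately show thesis using that[OF r] by blast
qed

lemma f2_oscillation:
  assumes "0 < k" "k < nu1 T"
  obtains r h where "0 < r" "r < w2 / 4" "smooth_fun_on UNIV h"
    "\<And>x. k - f2 x = (r\<^sup>2 - (x - 0)\<^sup>2) * h x" "\<And>x. \<bar>x - 0\<bar> \<le> r \<Longrightarrow> h x > 0"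
    "\<And>x. - w2 / 4 \<le> x \<Longrightarrow> x \<le> w2 / 4 \<Longrightarrow> \<bar>x - 0\<bar> > r \<Longrightarrow> f2 x > k"
proof -
  obtain x0 where x0: "0 \<le> x0" "x0 \<le> w2 / 4" "f2 x0 = k"
    using IVT'[of f2 0 k "w2 / 4"] assms f_values sizes continuous_on_subset[OF continuous_f(2)] by auto
  have "x0 \<noteq> 0" "x0 \<noteq> w2 / 4" using x0(3) assms f_values(2,3) by (metis less_irrefl)+
  then have x0': "0 < x0" "x0 < w2 / 4" using x0 by auto
  have up: "f2 x < k" if "0 \<le> x" "x < x0" for x using f2_mono[of x x0] that x0 by simp
  have lo: "f2 x > k" if "x0 < x" "x \<le> w2 / 4" for x using f2_mono[of x0 x] that x0 by simp
  have d: "deriv f2 x0 > 0" using classical x0' by (simp add: classical_liouville_table_def)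
  have D: "((\<lambda>x. k - f2 x) has_real_derivative - deriv f2 x0) (at (0 + x0))"
    using deriv_f(2)[of x0] by (auto intro!: derivative_eq_intros)
  have sm: "smooth_fun_on UNIV (\<lambda>x. k - f2 x)"
    using smooth_fun_on_uminus_const(1)[OF smooth_fun_on_uminus_const(2)[OF smooth(2), of k]] by simp
  have sym: "k - f2 (2 * 0 - x) = k - f2 x" for x using even(2)[of x] by simp
  have pos: "k - f2 x > 0" if "\<bar>x - 0\<bar> < x0" for x
    using up[of x] up[of "- x"] even(2)[of x] that by (cases "0 \<le> x") auto
  obtain h where "smooth_fun_on UNIV h" "\<And>x. k - f2 x = (x0\<^sup>2 - (x - 0)\<^sup>2) * h x"
    "\<And>x. \<bar>x - 0\<bar> \<le> x0 \<Longrightarrow> h x > 0"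
    by (rule symmetric_smooth_factor[OF sm sym x0'(1) _ D _ pos]) (use d x0 in auto)
  moreover have "f2 x > k" if "- w2 / 4 \<le> x" "x \<le> w2 / 4" "\<bar>x - 0\<bar> > x0" for x
    using lo[of x] lo[of "- x"] even(2)[of x] that by (cases "0 \<le> x") auto
  ultimately show thesis using that[OF x0'] by blast
qed

end

section \<open>Vanishing of the Abel integrals over the fundamental rectangle\<close>

locale radon_data = classical_table +
  fixes K :: "pt set \<Rightarrow> real" and \<mu> :: "brep set \<Rightarrow> real" and W F :: "real \<Rightarrow> real \<Rightarrow> real"
  assumes weight: "((\<forall>\<xi>\<in>BGamma T. \<mu> \<xi> = 1) \<and> W = (\<lambda>a b. 1)) \<or>
         ((\<forall>\<xi>\<in>BGamma T. \<mu> \<xi> = inverse (normal_pairing T (pi_plus T \<xi>))) \<and> W = (\<lambda>a b. sqrt (P3 a b)))"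
    and vanishing: "\<And>\<Lambda> r. liouville_torus T \<Lambda> \<Longrightarrow> \<Lambda> \<subseteq> U1 T \<union> U2 T \<Longrightarrow> has_radon_transform T K \<mu> \<Lambda> r \<Longrightarrow> r = 0"
    and F_eq: "F a b = K (proj T (a, b, N)) * W a b * (f1 a - f2 b)"
    and cont_F: "continuous_on UNIV (\<lambda>x. F (fst x) (snd x))"
    and F_sym: "F (- a) b = F a b" "F (w1 / 2 - a) b = F a b" "F a (- b) = F a b" "F a (w2 / 2 - b) = F a b"
begin

text \<open>The density 1 / (p1 p2) regrouped by parameters: the root containing k1 is smooth, and
  the factors containing k2 form the Abel kernel, which also encodes the region \<phi>2 < k2 <
  \<phi>1.\<close>

definition abel_integral :: "real \<Rightarrow> real \<Rightarrow> real" where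
  "abel_integral k1 k2 = (\<integral>a. \<integral>b. indicator (cbox (0, 0) (w1 / 4, w2 / 4)) (a, b) *
     (F a b / sqrt ((f1 a - k1) * (f2 b - k1))) * abel_kernel (f1 a) (f2 b) k2 \<partial>lborel \<partial>lborel)"

end

text \<open>\<open>avg1\<close> and \<open>avg2\<close> hide whether a degree of freedom rotates or
  oscillates, so that one argument covers both families.\<close>

lemma (in torus) abel_integral_eq_0:
  assumes "radon_data T K \<mu> W F"
    and avg1: "\<And>G. continuous_on UNIV G \<Longrightarrow> (\<And>x. G (- x) = G x) \<Longrightarrow> (\<And>x. G (w1 / 2 - x) = G x) \<Longrightarrow>
      integral {0..1} (\<lambda>s. G (\<theta>1 s) * e1 s) = 4 * (\<integral>x. indicator {0..w1 / 4} x *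
        (if (f1 x - k1) * (f1 x - k2) > 0 then G x / sqrt ((f1 x - k1) * (f1 x - k2)) else 0) \<partial>lborel)"
    and avg2: "\<And>G. continuous_on UNIV G \<Longrightarrow> (\<And>x. G (- x) = G x) \<Longrightarrow> (\<And>x. G (w2 / 2 - x) = G x) \<Longrightarrow>
      integral {0..1} (\<lambda>s. G (\<theta>2 s) * e2 s) = 4 * (\<integral>x. indicator {0..w2 / 4} x *
        (if (f2 x - k1) * (k2 - f2 x) > 0 then G x / sqrt ((f2 x - k1) * (k2 - f2 x)) else 0) \<partial>lborel)"
  shows "radon_data.abel_integral T F k1 k2 = 0"
proof -
  interpret radon_data T K \<mu> W F by (rule assms(1))
  define I where "I a = integral (cbox 0 1) (\<lambda>t. F a (\<theta>2 t) * e2 t)" for a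
  define R1 where "R1 x = (if (f1 x - k1) * (f1 x - k2) > 0 then 1 / sqrt ((f1 x - k1) * (f1 x - k2)) else 0)" for x
  define R2 where "R2 x = (if (f2 x - k1) * (k2 - f2 x) > 0 then 1 / sqrt ((f2 x - k1) * (k2 - f2 x)) else 0)" for x
  have cF: "continuous_on S' (\<lambda>x. F (u x) (v x))" if "continuous_on S' u" "continuous_on S' v"
    for S' and u v :: "'z::topological_space \<Rightarrow> real"
    using continuous_on_compose2[OF cont_F continuous_on_Pair[OF that] subset_UNIV] by simp
  have c\<theta>: "continuous_on S' (\<lambda>x. \<theta>1 (fst x))" "continuous_on S' (\<lambda>x. \<theta>2 (snd x))"
     "continuous_on S' (\<lambda>x. e1 (fst x))" "continuous_on S' (\<lambda>x. e2 (snd x))" for S' :: "(real \<times> real) set"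
    by (rule continuous_on_subset[OF cont_fst[OF O1.cont_theta]] continuous_on_subset[OF cont_snd[OF O2.cont_theta]]
        continuous_on_subset[OF cont_fst[OF O1.cont_e]] continuous_on_subset[OF cont_snd[OF O2.cont_e]], simp)+
  have "0 = integral (cbox (0, 0) (1, 1)) (\<lambda>s. F (\<theta>1 (fst s)) (\<theta>2 (snd s)) * e1 (fst s) * e2 (snd s))"
    using radon_integral_eq_0[OF weight vanishing] by (simp add: F_eq)
  also have "\<dots> = integral (cbox 0 1) (\<lambda>s. integral (cbox 0 1) (\<lambda>t. F (\<theta>1 s) (\<theta>2 t) * e1 s * e2 t))"
  proof -
    have "continuous_on (cbox (0, 0) (1, 1)) (\<lambda>s. F (\<theta>1 (fst s)) (\<theta>2 (snd s)) * e1 (fst s) * e2 (snd s))"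
      by (rule continuous_on_mult[OF continuous_on_mult[OF cF[OF c\<theta>(1,2)] c\<theta>(3)] c\<theta>(4)])
    from integral_prod_continuous[OF this] show ?thesis by simp
  qed
  \<comment> \<open>The average over the second orbit is a continuous, symmetric function
    \<open>I\<close> of the first angle; so \<open>avg1\<close> applies to it, and
    \<open>avg2\<close> afterwards to its values.\<close>
  also have "\<dots> = integral {0..1} (\<lambda>s. I (\<theta>1 s) * e1 s)"
    by (simp add: I_def mult_ac flip: integral_mult_right)
  also have "\<dots> = 4 * (\<integral>x. indicator {0..w1 / 4} x *
        (if (f1 x - k1) * (f1 x - k2) > 0 then I x / sqrt ((f1 x - k1) * (f1 x - k2)) else 0) \<partial>lborel)"
  proof (rule avg1)
    have "continuous_on (UNIV \<times> cbox 0 1) (\<lambda>(a, t). F a (\<theta>2 t) * e2 t)"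
      unfolding split_beta
      by (intro continuous_on_mult cF c\<theta> continuous_on_fst continuous_on_id)
    then show "continuous_on UNIV I" unfolding I_def by (rule integral_continuous_on_param)
    show "I (- x) = I x" "I (w1 / 2 - x) = I x" for x by (simp_all add: I_def F_sym)
  qed
  also have "\<dots> = 4 * (\<integral>a. 4 * (\<integral>b. indicator (cbox (0, 0) (w1 / 4, w2 / 4)) (a, b) * (F a b / sqrt ((f1 a - k1) * (f2 b - k1))) *
    abel_kernel (f1 a) (f2 b) k2 \<partial>lborel) \<partial>lborel)"
  proof -
    have "indicator {0..w1 / 4} a *
        (if (f1 a - k1) * (f1 a - k2) > 0 then I a / sqrt ((f1 a - k1) * (f1 a - k2)) else 0) =
      4 * (\<integral>b. indicator (cbox (0, 0) (w1 / 4, w2 / 4)) (a, b) * (F a b / sqrt ((f1 a - k1) * (f2 b - k1))) *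
         abel_kernel (f1 a) (f2 b) k2 \<partial>lborel)" for a
    proof -
      have pos: "f1 a - k1 > 0" "f2 b - k1 > 0" for b
        using nu1_le_f1[of a] nu1_pos f2_nonneg[of b] k1 by auto
      have kern: "indicator {0..w1 / 4} a * R1 a * (indicator {0..w2 / 4} b * (F a b * R2 b)) =
        indicator (cbox (0, 0) (w1 / 4, w2 / 4)) (a, b) * (F a b / sqrt ((f1 a - k1) * (f2 b - k1))) * abel_kernel (f1 a) (f2 b) k2" for b
      proof -
        have ind: "indicator (cbox (0, 0) (w1 / 4, w2 / 4)) (a, b) = (indicator {0..w1 / 4} a * indicator {0..w2 / 4} b :: real)"
          by (auto simp: indicator_def cbox_Pair_eq)
        \<comment> \<open>Since k1 lies below both functions, the two radicands are positive exactly
          for \<phi>2 < k2 < \<phi>1, the support of the kernel.\<close>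
        have R: "R1 a * R2 b = abel_kernel (f1 a) (f2 b) k2 / sqrt ((f1 a - k1) * (f2 b - k1))"
          using pos(2)[of b] pos(1)
          by (auto simp: R1_def R2_def abel_kernel_def indicator_def zero_less_mult_iff real_sqrt_mult)
        have "indicator {0..w1 / 4} a * R1 a * (indicator {0..w2 / 4} b * (F a b * R2 b)) =
          indicator {0..w1 / 4} a * indicator {0..w2 / 4} b * F a b * (R1 a * R2 b)"
          by (simp only: mult_ac)
        then show ?thesis unfolding ind R by simp
      qed
      have "I a = 4 * (\<integral>b. indicator {0..w2 / 4} b *
        (if (f2 b - k1) * (k2 - f2 b) > 0 then F a b / sqrt ((f2 b - k1) * (k2 - f2 b)) else 0) \<partial>lborel)"
        unfolding I_def cbox_interval by (rule avg2) (auto intro!: cF continuous_intros simp: F_sym)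
      also have "\<dots> = 4 * (\<integral>b. indicator {0..w2 / 4} b * (F a b * R2 b) \<partial>lborel)"
        by (simp add: R2_def if_distrib cong: if_cong)
      finally have I: "I a = 4 * (\<integral>b. indicator {0..w2 / 4} b * (F a b * R2 b) \<partial>lborel)" .
      have "indicator {0..w1 / 4} a *
        (if (f1 a - k1) * (f1 a - k2) > 0 then I a / sqrt ((f1 a - k1) * (f1 a - k2)) else 0) = indicator {0..w1 / 4} a * R1 a * I a"
        by (simp add: R1_def)
      also have "\<dots> = 4 * (\<integral>b. indicator {0..w1 / 4} a * R1 a * (indicator {0..w2 / 4} b * (F a b * R2 b)) \<partial>lborel)"
        unfolding I by (subst integral_mult_right_zero) simp
      finally show ?thesis unfolding kern .
    qed
    then show ?thesis by simp
  qed
  finally show ?thesis by (simp add: abel_integral_def)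
qed

section \<open>Deck-invariant functions that tell the tori on one level apart\<close>

context classical_table
begin

text \<open>For oscillating \<theta>1 the sine is positive on the component around
  \<open>w1 / 4\<close> and negative on the one around \<open>3 * w1 / 4\<close>. The involution
  exchanges these components and reverses p2, so only the product descends to the quotient.\<close>

lemma sin_rel: "rel z z' \<Longrightarrow> sin (2 * pi * (fst (fst z') / w1)) * snd (snd z') = sin (2 * pi * (fst (fst z) / w1)) * snd (snd z)"
proof -
  assume "rel z z'"
  then obtain s m where s: "s \<in> {1, -1}"
    and e: "fst (fst z') = of_int s * fst (fst z) + of_int m * w1" "snd (snd z') = of_int s * snd (snd z)"
    unfolding rel_def by auto
  have "2 * pi * (fst (fst z') / w1) = of_int s * (2 * pi * (fst (fst z) / w1)) + of_int m * (2 * pi)"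
    unfolding e using sizes by (simp add: field_simps)
  then have "sin (2 * pi * (fst (fst z') / w1)) = sin (of_int s * (2 * pi * (fst (fst z) / w1)))"
    by (simp only: fun_periodic_int[of sin "2 * pi", OF sin_periodic])
  then show ?thesis unfolding e using s by auto
qed

text \<open>The counterpart for oscillating \<theta>2, whose components lie around 0 and
  \<open>w2 / 2\<close> and are exchanged while p1 is reversed.\<close>

lemma cos_rel: "rel z z' \<Longrightarrow> cos (2 * pi * (snd (fst z') / w2)) * fst (snd z') = cos (2 * pi * (snd (fst z) / w2)) * fst (snd z)"
proof -
  assume "rel z z'"
  then obtain s n where s: "s \<in> {1, -1}"
    and e: "snd (fst z') = of_int s * snd (fst z) + of_int n * w2 + (1 - of_int s) / 4 * w2"
      "fst (snd z') = of_int s * fst (snd z)"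
    unfolding rel_def by auto
  have "2 * pi * (snd (fst z') / w2) = of_int s * (2 * pi * (snd (fst z) / w2)) + (1 - of_int s) / 2 * pi + of_int n * (2 * pi)"
    unfolding e using sizes by (simp add: field_simps)
  then have "cos (2 * pi * (snd (fst z') / w2)) = cos (of_int s * (2 * pi * (snd (fst z) / w2)) + (1 - of_int s) / 2 * pi)"
    by (simp only: fun_periodic_int[of cos "2 * pi", OF cos_periodic])
  then show ?thesis unfolding e using s by auto
qed

lemma small_multiple: "\<bar>of_int m * w\<bar> < w \<Longrightarrow> w > 0 \<Longrightarrow> m = (0::int)" for w :: real
  by (simp add: abs_mult)

lemma rel_shiftI:
  "a' = a + of_int m * w1 \<Longrightarrow> b' = b + of_int n * w2 \<Longrightarrow> rel ((a, b), (p1, p2)) ((a', b'), (p1, p2))"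
  unfolding rel_def by (intro exI[of _ 1] exI[of _ m] exI[of _ n]) simp

lemma rel_flipI:
  "a' = - a + of_int m * w1 \<Longrightarrow> b' = - b + of_int n * w2 + w2 / 2 \<Longrightarrow> rel ((a, b), (p1, p2)) ((a', b'), (- p1, - p2))"
  unfolding rel_def by (intro exI[of _ "-1"] exI[of _ m] exI[of _ n]) simp

lemma rel_sign: "rel ((a, b), (p1, p2)) ((a', b'), (p1', p2')) \<Longrightarrow> p1 > 0 \<and> p1' > 0 \<or> p2 > 0 \<and> p2' > 0 \<Longrightarrow>
  p1' = p1 \<and> p2' = p2 \<and> (\<exists>m n::int. a' = a + of_int m * w1 \<and> b' = b + of_int n * w2)"
  unfolding rel_def by auto

lemma energy_bounds:
  assumes k1: "k1 < 0" and "p1\<^sup>2 = (f1 a - k1) * (f1 a - k)" "p2\<^sup>2 = (f2 b - k1) * (k - f2 b)"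
  shows "f1 a \<ge> k" "f2 b \<le> k"
proof -
  have pos: "f1 a - k1 > 0" "f2 b - k1 > 0"
    using nu1_le_f1[of a] nu1_pos f2_nonneg[of b] k1 by auto
  then show "f1 a \<ge> k" "f2 b \<le> k"
    using assms zero_le_power2[of p1] zero_le_power2[of p2] by (auto simp: zero_le_mult_iff)
qed

end

text \<open>The energy is split into a factor q without zeros and a factor f with the turning
  points, so that the same construction serves \<theta>1 on the second family and \<theta>2 on the
  first.\<close>

lemma smooth_oscillation_orbit:
  fixes f q h :: "real \<Rightarrow> real"
  assumes w: "w > 0" and r: "0 < r" "r < w / 4" and c: "c = 0 \<or> c = w / 4"
    and q: "smooth_fun_on UNIV q" "\<And>x. q x > 0"
    and h: "smooth_fun_on UNIV h" "\<And>x. f x = (r\<^sup>2 - (x - c)\<^sup>2) * h x" "\<And>x. \<bar>x - c\<bar> \<le> r \<Longrightarrow> h x > 0"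
    and neg: "\<And>x. 0 \<le> x \<Longrightarrow> x \<le> w / 4 \<Longrightarrow> \<bar>x - c\<bar> > r \<Longrightarrow> f x \<le> 0"
    and sym: "\<And>x. f (- x) = f x" "\<And>x. f (w / 2 - x) = f x" "\<And>x. q (- x) = q x" "\<And>x. q (w / 2 - x) = q x"
  obtains g' \<theta> p e where "orbit (\<lambda>x. q x * f x) g' \<theta> p e"
    "\<And>s t. \<theta> s = \<theta> t \<and> p s = p t \<longleftrightarrow> s - t \<in> \<int>"
    "\<And>x y. \<bar>x - c\<bar> \<le> r \<Longrightarrow> y\<^sup>2 = q x * f x \<Longrightarrow> \<exists>s. \<theta> s = x \<and> p s = y"
    "\<And>s. \<bar>\<theta> s - c\<bar> \<le> r"
    "\<And>G. continuous_on UNIV G \<Longrightarrow> (\<And>x. G (- x) = G x) \<Longrightarrow> (\<And>x. G (w / 2 - x) = G x) \<Longrightarrow>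
      integral {0..1} (\<lambda>s. G (\<theta> s) * e s) =
      4 * (\<integral>x. indicator {0..w / 4} x * (if q x * f x > 0 then G x / sqrt (q x * f x) else 0) \<partial>lborel)"
proof -
  obtain q' where q': "\<And>x. (q has_real_derivative q' x) (at x)" "continuous_on UNIV q'"
    using smooth_fun_on_UNIV_derivative[OF q(1)] by blast
  obtain h' where h': "\<And>x. (h has_real_derivative h' x) (at x)" "continuous_on UNIV h'"
    using smooth_fun_on_UNIV_derivative[OF h(1)] by blast
  define l l' where "l x = q x * h x" and "l' x = q' x * h x + h' x * q x" for x
  have dl: "(l has_real_derivative l' x) (at x)" for x
    unfolding l_def l'_def by (auto intro!: derivative_eq_intros q'(1) h'(1))
  have cont: "continuous_on UNIV q" "continuous_on UNIV h" "continuous_on UNIV l"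
    using q'(1) h'(1) dl by (auto intro: DERIV_continuous_on)
  have cl': "continuous_on UNIV l'" unfolding l'_def by (intro continuous_intros q'(2) h'(2) cont)
  have lpos: "l x > 0" if "\<bar>x - c\<bar> \<le> r" for x using h(3)[OF that] q(2) by (simp add: l_def)
  have g: "q x * f x = (r\<^sup>2 - (x - c)\<^sup>2) * l x" for x by (simp add: l_def h(2))
  have le: "q x * f x \<le> 0" if x: "0 \<le> x" "x \<le> w / 4" "\<bar>x - c\<bar> \<ge> r" for x
  proof (cases "\<bar>x - c\<bar> > r")
    case True
    then show ?thesis using neg[OF x(1,2)] q(2)[of x] by (simp add: mult_le_0_iff)
  next
    case False
    then have "\<bar>x - c\<bar> = r" using x(3) by linarith
    then have "(x - c)\<^sup>2 = r\<^sup>2" by (metis power2_abs)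
    then show ?thesis by (simp add: g)
  qed
  note raw = oscillation_orbit[OF r(1) g dl cl' lpos]
  show thesis
  proof (rule that)
    show "orbit (\<lambda>x. q x * f x) (\<lambda>x. - 2 * (x - c) * l x + (r\<^sup>2 - (x - c)\<^sup>2) * l' x) (\<lambda>s. c - r * cos (2 * pi * s))
      (\<lambda>s. r * sin (2 * pi * s) * sqrt (l (c - r * cos (2 * pi * s)))) (\<lambda>s. 2 * pi / sqrt (l (c - r * cos (2 * pi * s))))"
      by (rule raw(1))
  qed (rule raw(2) raw(4) raw(3) integral_oscillation_orbit[OF w r c g cont(3) lpos le]; simp add: sym)+
qed

context radon_data
begin

text \<open>For \<open>k2 > nu1 T\<close> the second momentum never vanishes, so \<theta>2 rotates,
  while \<theta>1 oscillates about \<open>w1 / 4\<close>.\<close>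

lemma abel_integral_eq_0_U2:
  assumes k1: "nu3 T < k1" "k1 < 0" and k2: "nu1 T < k2" "k2 < nu0 T"
  shows "abel_integral k1 k2 = 0"
proof -
  obtain r h where r: "0 < r" "r < w1 / 4" and h: "smooth_fun_on UNIV h"
    "\<And>x. f1 x - k2 = (r\<^sup>2 - (x - w1 / 4)\<^sup>2) * h x" "\<And>x. \<bar>x - w1 / 4\<bar> \<le> r \<Longrightarrow> h x > 0"
    and out: "\<And>x. 0 \<le> x \<Longrightarrow> x \<le> w1 / 2 \<Longrightarrow> \<bar>x - w1 / 4\<bar> > r \<Longrightarrow> f1 x < k2"
    by (rule f1_oscillation[OF k2]) blast
  have pos1: "f1 x - k1 > 0" for x using nu1_le_f1[of x] nu1_pos k1 by auto
  have neg: "f1 x - k2 \<le> 0" if "0 \<le> x" "x \<le> w1 / 4" "\<bar>x - w1 / 4\<bar> > r" for x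
    using out[of x] that sizes by auto
  obtain G1' \<theta>1 q1 e1 where osc: "orbit (\<lambda>x. (f1 x - k1) * (f1 x - k2)) G1' \<theta>1 q1 e1"
    "\<And>s t. \<theta>1 s = \<theta>1 t \<and> q1 s = q1 t \<longleftrightarrow> s - t \<in> \<int>"
    "\<And>x y. \<bar>x - w1 / 4\<bar> \<le> r \<Longrightarrow> y\<^sup>2 = (f1 x - k1) * (f1 x - k2) \<Longrightarrow> \<exists>s. \<theta>1 s = x \<and> q1 s = y"
    "\<And>s. \<bar>\<theta>1 s - w1 / 4\<bar> \<le> r"
    "\<And>G. continuous_on UNIV G \<Longrightarrow> (\<And>x. G (- x) = G x) \<Longrightarrow> (\<And>x. G (w1 / 2 - x) = G x) \<Longrightarrow>
      integral {0..1} (\<lambda>s. G (\<theta>1 s) * e1 s) = 4 * (\<integral>x. indicator {0..w1 / 4} x *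
        (if (f1 x - k1) * (f1 x - k2) > 0 then G x / sqrt ((f1 x - k1) * (f1 x - k2)) else 0) \<partial>lborel)"
    by (rule smooth_oscillation_orbit[OF sizes(2) r disjI2[OF refl] smooth_fun_on_uminus_const(2)[OF smooth(1)] pos1 h neg])
      (simp add: even half | blast)+
  define G2 where "G2 x = (f2 x - k1) * (k2 - f2 x)" for x
  have G2pos: "G2 x > 0" for x
    using f2_nonneg[of x] k1 f2_le_nu1[of x] k2 by (auto simp: G2_def)
  obtain f2' where d2: "\<And>x. (f2 has_real_derivative f2' x) (at x)" "continuous_on UNIV f2'"
    using smooth_fun_on_UNIV_derivative[OF smooth(2)] by blast
  define G2' where "G2' x = f2' x * (k2 - f2 x) + (- f2' x) * (f2 x - k1)" for x
  have dG2: "(G2 has_real_derivative G2' x) (at x)" for x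
    unfolding G2_def G2'_def by (auto intro!: derivative_eq_intros d2(1))
  have cG2': "continuous_on UNIV G2'" unfolding G2'_def by (intro continuous_intros d2(2))
  have cG2: "continuous_on UNIV G2" by (rule DERIV_continuous_on) (rule dG2)
  define \<theta>2 where "\<theta>2 = (\<lambda>s. w2 * s)"
  define q2 where "q2 = (\<lambda>s. sqrt (G2 (w2 * s)))"
  define e2 where "e2 = (\<lambda>s. w2 / sqrt (G2 (w2 * s)))"
  note rot = rotation_orbit[OF sizes(3) dG2 cG2' G2pos, folded \<theta>2_def q2_def e2_def]
  define S where "S z = sin (2 * pi * (fst (fst z) / w1)) * snd (snd z)" for z :: bcoord
  have rng: "0 < \<theta>1 s" "\<theta>1 s < w1 / 2" for s using osc(4)[of s] r by auto
  have sin_pos: "sin (2 * pi * (a / w1)) > 0" if "0 < a" "a < w1 / 2" for a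
    using that sizes by (intro sin_gt_zero) (auto simp: field_simps)
  have q2_pos: "q2 t > 0" for t using G2pos by (simp add: q2_def)
  interpret torus T k1 k2 G1' G2' \<theta>1 \<theta>2 q1 q2 e1 e2 S
  proof (rule torus.intro[OF classical_table_axioms], rule torus_axioms.intro)
    show "nu3 T < k1" "k1 < 0" by (rule k1)+
    show "0 < k2" "k2 \<noteq> nu1 T" "k2 < nu0 T" using k2 nu1_pos by auto
    show "orbit (\<lambda>x. (f1 x - k1) * (f1 x - k2)) G1' \<theta>1 q1 e1"
      by (rule osc(1))
    show "orbit (\<lambda>x. (f2 x - k1) * (k2 - f2 x)) G2' \<theta>2 q2 e2"
      using rot unfolding G2_def[abs_def] .
    show "continuous_on UNIV S" unfolding S_def using sizes by (intro continuous_intros) auto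
    show "S z' = S z" if "rel z z'" for z z' unfolding S_def by (rule sin_rel[OF that])
    show "S z \<noteq> 0" if "(fst (snd z))\<^sup>2 = (f1 (fst (fst z)) - k1) * (f1 (fst (fst z)) - k2)"
       "(snd (snd z))\<^sup>2 = (f2 (snd (fst z)) - k1) * (k2 - f2 (snd (fst z)))" for z
    proof -
      have "f1 (fst (fst z)) \<noteq> nu1 T" using energy_bounds(1)[OF k1(2) that] k2(1) by auto
      have "sin (2 * pi * (fst (fst z) / w1)) \<noteq> 0"
      proof
        assume "sin (2 * pi * (fst (fst z) / w1)) = 0"
        then obtain i :: int where "2 * pi * (fst (fst z) / w1) = of_int i * pi"
          unfolding sin_zero_iff_int2 by auto
        then have "fst (fst z) = of_int i * (w1 / 2)" using sizes by (simp add: field_simps)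
        then show False using \<open>f1 (fst (fst z)) \<noteq> nu1 T\<close> f1_eq_nu1 by blast
      qed
      moreover have "snd (snd z) \<noteq> 0" using that(2) G2pos[of "snd (fst z)"] by (auto simp: G2_def)
      ultimately show ?thesis by (simp add: S_def)
    qed
    show "S ((\<theta>1 s, \<theta>2 t), (q1 s, q2 t)) > 0" for s t
      using sin_pos[OF rng] q2_pos by (simp add: S_def)
    show "rel ((\<theta>1 s, \<theta>2 t), (q1 s, q2 t)) ((\<theta>1 s', \<theta>2 t'), (q1 s', q2 t')) \<longleftrightarrow>
       s - s' \<in> \<int> \<and> t - t' \<in> \<int>" for s t s' t'
    proof
      assume "rel ((\<theta>1 s, \<theta>2 t), (q1 s, q2 t)) ((\<theta>1 s', \<theta>2 t'), (q1 s', q2 t'))"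
      from rel_sign[OF this] q2_pos obtain m n :: int where e: "q1 s' = q1 s"
        "\<theta>1 s' = \<theta>1 s + of_int m * w1" "\<theta>2 t' = \<theta>2 t + of_int n * w2" by blast
      have "\<bar>of_int m * w1\<bar> < w1" using e(2) rng[of s] rng[of s'] by linarith
      then have "m = 0" using sizes(2) by (rule small_multiple)
      then have "s - s' \<in> \<int>" using osc(2)[of s s'] e by simp
      moreover have "w2 * (t - t') = w2 * of_int (- n)" using e(3) by (simp add: \<theta>2_def algebra_simps)
      then have "t - t' = of_int (- n)" using sizes by (simp only: mult_cancel_left) simp
      then have "t - t' \<in> \<int>" by (simp only: Ints_of_int)
      ultimately show "s - s' \<in> \<int> \<and> t - t' \<in> \<int>" ..
    next
      assume st: "s - s' \<in> \<int> \<and> t - t' \<in> \<int>"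
      then obtain n :: int where n: "t - t' = of_int n" by (auto elim: Ints_cases)
      then have t': "w2 * t' = w2 * t + of_int (- n) * w2" by (simp add: algebra_simps)
      have "\<theta>1 s' = \<theta>1 s" "q1 s' = q1 s" using st osc(2)[of s s'] by auto
      moreover have "q2 t' = q2 t" unfolding q2_def G2_def t' periodic ..
      moreover have "\<theta>2 t' = \<theta>2 t + of_int (- n) * w2" unfolding \<theta>2_def by (rule t')
      ultimately show "rel ((\<theta>1 s, \<theta>2 t), (q1 s, q2 t)) ((\<theta>1 s', \<theta>2 t'), (q1 s', q2 t'))"
        using rel_shiftI[of "\<theta>1 s'" "\<theta>1 s" 0 "\<theta>2 t'" "\<theta>2 t" "- n"] by simp
    qed
    fix a b p1 p2 :: real
    assume en: "p1\<^sup>2 = (f1 a - k1) * (f1 a - k2)" "p2\<^sup>2 = (f2 b - k1) * (k2 - f2 b)"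
      and S: "S ((a, b), (p1, p2)) > 0"
    have reg: "((a, b), (p1, p2)) \<in> regular"
      using energy_bounds(1)[OF k1(2) en] f2_le_nu1[of b] k2(1) by (auto simp: regular_iff)
    define m where "m = \<lfloor>a / w1\<rfloor>"
    define a0 where "a0 = a + of_int (- m) * w1"
    have a0: "0 \<le> a0" "a0 < w1"
      using floor_divide_lower[OF sizes(2), of a] floor_divide_upper[OF sizes(2), of a]
      by (auto simp: a0_def m_def algebra_simps)
    obtain z where z: "rel ((a, b), (p1, p2)) z" "0 \<le> fst (fst z)" "fst (fst z) \<le> w1 / 2"
    proof (cases "a0 \<le> w1 / 2")
      case True
      have "rel ((a, b), (p1, p2)) ((a0, b), (p1, p2))"
        by (rule rel_shiftI[of _ _ "- m" _ _ 0]) (auto simp: a0_def)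
      then show thesis using that[of "((a0, b), (p1, p2))"] a0 True by simp
    next
      case False
      \<comment> \<open>As a0 = a - m w1, the flipped angle w1 - a0 is -a + (m + 1) w1.\<close>
      have "rel ((a, b), (p1, p2)) ((w1 - a0, - b + w2 / 2), (- p1, - p2))"
        by (rule rel_flipI[of _ _ "m + 1" _ _ 0]) (auto simp: a0_def algebra_simps)
      then show thesis using that[of "((w1 - a0, - b + w2 / 2), (- p1, - p2))"] a0 False by simp
    qed
    obtain a' b' p1' p2' where z': "z = ((a', b'), (p1', p2'))" by (cases z) auto
    have f: "f1 a' = f1 a" "f2 b' = f2 b" "p1'\<^sup>2 = p1\<^sup>2" "p2'\<^sup>2 = p2\<^sup>2" using rel_f[OF z(1)] by (auto simp: z')
    have S': "sin (2 * pi * (a' / w1)) * p2' > 0" using S sin_rel[OF z(1)] by (simp add: S_def z')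
    have le: "\<bar>a' - w1 / 4\<bar> \<le> r"
      using out[of a'] z energy_bounds(1)[OF k1(2) en] by (force simp: z' f)
    then obtain s where s: "\<theta>1 s = a'" "q1 s = p1'" using osc(3)[OF le, of p1'] f en by auto
    have "sin (2 * pi * (a' / w1)) > 0" using le r by (intro sin_pos) auto
    then have "p2' > 0" using S' by (simp add: zero_less_mult_iff)
    moreover have "p2'\<^sup>2 = G2 b'" using f en by (simp add: G2_def)
    ultimately have "p2' = sqrt (G2 b')" by (metis abs_of_pos real_sqrt_abs)
    then have "\<theta>2 (b' / w2) = b'" "q2 (b' / w2) = p2'" using sizes by (auto simp: \<theta>2_def q2_def)
    then have "rel ((a, b), (p1, p2)) ((\<theta>1 s, \<theta>2 (b' / w2)), (q1 s, q2 (b' / w2)))"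
      using z(1) s by (simp add: z')
    then show "\<exists>s t. rel ((a, b), (p1, p2)) ((\<theta>1 s, \<theta>2 t), (q1 s, q2 t))" by blast
  qed
  show ?thesis
  proof (rule abel_integral_eq_0[OF radon_data_axioms osc(5)])
    fix G :: "real \<Rightarrow> real" assume G: "continuous_on UNIV G"
    show "integral {0..1} (\<lambda>s. G (\<theta>2 s) * e2 s) = 4 * (\<integral>x. indicator {0..w2 / 4} x *
        (if (f2 x - k1) * (k2 - f2 x) > 0 then G x / sqrt ((f2 x - k1) * (k2 - f2 x)) else 0) \<partial>lborel)"
      if "\<And>x. G (- x) = G x" "\<And>x. G (w2 / 2 - x) = G x"
      unfolding G2_def[symmetric] e2_def \<theta>2_def
      by (rule integral_rotation_orbit[OF sizes(3) cG2 G G2pos _ _ that]) (auto simp: G2_def even half)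
  qed
qed

text \<open>The roles are exchanged: for \<open>k2 < nu1 T\<close> the first momentum never
  vanishes, so \<theta>1 rotates, while \<theta>2 oscillates about 0.\<close>

lemma abel_integral_eq_0_U1:
  assumes k1: "nu3 T < k1" "k1 < 0" and k2: "0 < k2" "k2 < nu1 T"
  shows "abel_integral k1 k2 = 0"
proof -
  obtain r h where r: "0 < r" "r < w2 / 4" and h: "smooth_fun_on UNIV h"
    "\<And>x. k2 - f2 x = (r\<^sup>2 - (x - 0)\<^sup>2) * h x" "\<And>x. \<bar>x - 0\<bar> \<le> r \<Longrightarrow> h x > 0"
    and out: "\<And>x. - w2 / 4 \<le> x \<Longrightarrow> x \<le> w2 / 4 \<Longrightarrow> \<bar>x - 0\<bar> > r \<Longrightarrow> f2 x > k2"
    by (rule f2_oscillation[OF k2]) blast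
  have pos2: "f2 x - k1 > 0" for x using f2_nonneg[of x] k1 by auto
  have neg: "k2 - f2 x \<le> 0" if "0 \<le> x" "x \<le> w2 / 4" "\<bar>x - 0\<bar> > r" for x
    using out[of x] that sizes by auto
  obtain G2' \<theta>2 q2 e2 where osc: "orbit (\<lambda>x. (f2 x - k1) * (k2 - f2 x)) G2' \<theta>2 q2 e2"
    "\<And>s t. \<theta>2 s = \<theta>2 t \<and> q2 s = q2 t \<longleftrightarrow> s - t \<in> \<int>"
    "\<And>x y. \<bar>x - 0\<bar> \<le> r \<Longrightarrow> y\<^sup>2 = (f2 x - k1) * (k2 - f2 x) \<Longrightarrow> \<exists>s. \<theta>2 s = x \<and> q2 s = y"
    "\<And>s. \<bar>\<theta>2 s - 0\<bar> \<le> r"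
    "\<And>G. continuous_on UNIV G \<Longrightarrow> (\<And>x. G (- x) = G x) \<Longrightarrow> (\<And>x. G (w2 / 2 - x) = G x) \<Longrightarrow>
      integral {0..1} (\<lambda>s. G (\<theta>2 s) * e2 s) = 4 * (\<integral>x. indicator {0..w2 / 4} x *
        (if (f2 x - k1) * (k2 - f2 x) > 0 then G x / sqrt ((f2 x - k1) * (k2 - f2 x)) else 0) \<partial>lborel)"
    by (rule smooth_oscillation_orbit[OF sizes(3) r disjI1[OF refl] smooth_fun_on_uminus_const(2)[OF smooth(2)] pos2 h neg])
      (simp add: even half | blast)+
  define G1 where "G1 x = (f1 x - k1) * (f1 x - k2)" for x
  have G1pos: "G1 x > 0" for x
    using nu1_le_f1[of x] nu1_pos k1 k2 by (auto simp: G1_def)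
  obtain f1' where d1: "\<And>x. (f1 has_real_derivative f1' x) (at x)" "continuous_on UNIV f1'"
    using smooth_fun_on_UNIV_derivative[OF smooth(1)] by blast
  define G1' where "G1' x = f1' x * (f1 x - k2) + f1' x * (f1 x - k1)" for x
  have dG1: "(G1 has_real_derivative G1' x) (at x)" for x
    unfolding G1_def G1'_def by (auto intro!: derivative_eq_intros d1(1))
  have cG1': "continuous_on UNIV G1'" unfolding G1'_def by (intro continuous_intros d1(2))
  have cG1: "continuous_on UNIV G1" by (rule DERIV_continuous_on) (rule dG1)
  define \<theta>1 where "\<theta>1 = (\<lambda>s. w1 * s)"
  define q1 where "q1 = (\<lambda>s. sqrt (G1 (w1 * s)))"
  define e1 where "e1 = (\<lambda>s. w1 / sqrt (G1 (w1 * s)))"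
  note rot = rotation_orbit[OF sizes(2) dG1 cG1' G1pos, folded \<theta>1_def q1_def e1_def]
  define S where "S z = cos (2 * pi * (snd (fst z) / w2)) * fst (snd z)" for z :: bcoord
  have rng: "- (w2 / 4) < \<theta>2 s" "\<theta>2 s < w2 / 4" for s using osc(4)[of s] r by auto
  have cos_pos: "cos (2 * pi * (a / w2)) > 0" if "- (w2 / 4) < a" "a < w2 / 4" for a
  proof (rule cos_gt_zero_pi)
    have "2 * a / w2 < 1 / 2" "- (1 / 2) < 2 * a / w2" using that sizes by (auto simp: field_simps)
    then have "pi * (2 * a / w2) < pi * (1 / 2)" "pi * (- (1 / 2)) < pi * (2 * a / w2)"
      by (blast intro: mult_strict_left_mono pi_gt_zero)+
    then show "- (pi / 2) < 2 * pi * (a / w2)" "2 * pi * (a / w2) < pi / 2" by (auto simp: mult_ac)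
  qed
  have q1_pos: "q1 t > 0" for t using G1pos by (simp add: q1_def)
  interpret torus T k1 k2 G1' G2' \<theta>1 \<theta>2 q1 q2 e1 e2 S
  proof (rule torus.intro[OF classical_table_axioms], rule torus_axioms.intro)
    show "nu3 T < k1" "k1 < 0" by (rule k1)+
    show "0 < k2" "k2 \<noteq> nu1 T" "k2 < nu0 T" using k2 nu1_le_f1[of 0] f_values(5)[of 0] by auto
    show "orbit (\<lambda>x. (f2 x - k1) * (k2 - f2 x)) G2' \<theta>2 q2 e2"
      by (rule osc(1))
    show "orbit (\<lambda>x. (f1 x - k1) * (f1 x - k2)) G1' \<theta>1 q1 e1"
      using rot unfolding G1_def[abs_def] .
    show "continuous_on UNIV S" unfolding S_def using sizes by (intro continuous_intros) auto
    show "S z' = S z" if "rel z z'" for z z' unfolding S_def by (rule cos_rel[OF that])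
    show "S z \<noteq> 0" if "(fst (snd z))\<^sup>2 = (f1 (fst (fst z)) - k1) * (f1 (fst (fst z)) - k2)"
       "(snd (snd z))\<^sup>2 = (f2 (snd (fst z)) - k1) * (k2 - f2 (snd (fst z)))" for z
    proof -
      have "f2 (snd (fst z)) \<noteq> nu1 T" using energy_bounds(2)[OF k1(2) that] k2(2) by auto
      have "cos (2 * pi * (snd (fst z) / w2)) \<noteq> 0"
      proof
        assume "cos (2 * pi * (snd (fst z) / w2)) = 0"
        then obtain i :: int where "2 * pi * (snd (fst z) / w2) = of_int i * pi + pi / 2"
          unfolding cos_zero_iff_int2 by auto
        then have "pi * (2 * (snd (fst z) / w2)) = pi * (of_int i + 1 / 2)" by (simp add: algebra_simps)
        then have "2 * (snd (fst z) / w2) = of_int i + 1 / 2" by (simp only: mult_cancel_left) simp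
        then have "snd (fst z) = w2 / 4 + of_int i * (w2 / 2)" using sizes by (simp add: field_simps)
        then show False using \<open>f2 (snd (fst z)) \<noteq> nu1 T\<close> f2_eq_nu1 by blast
      qed
      moreover have "fst (snd z) \<noteq> 0" using that(1) G1pos[of "fst (fst z)"] by (auto simp: G1_def)
      ultimately show ?thesis by (simp add: S_def)
    qed
    show "S ((\<theta>1 s, \<theta>2 t), (q1 s, q2 t)) > 0" for s t
      using cos_pos[OF rng] q1_pos by (simp add: S_def)
    show "rel ((\<theta>1 s, \<theta>2 t), (q1 s, q2 t)) ((\<theta>1 s', \<theta>2 t'), (q1 s', q2 t')) \<longleftrightarrow>
       s - s' \<in> \<int> \<and> t - t' \<in> \<int>" for s t s' t'
    proof
      assume "rel ((\<theta>1 s, \<theta>2 t), (q1 s, q2 t)) ((\<theta>1 s', \<theta>2 t'), (q1 s', q2 t'))"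
      from rel_sign[OF this] q1_pos obtain m n :: int where e: "q2 t' = q2 t"
        "\<theta>1 s' = \<theta>1 s + of_int m * w1" "\<theta>2 t' = \<theta>2 t + of_int n * w2" by blast
      have "\<bar>of_int n * w2\<bar> < w2" using e(3) rng[of t] rng[of t'] by linarith
      then have "n = 0" using sizes(3) by (rule small_multiple)
      then have "t - t' \<in> \<int>" using osc(2)[of t t'] e by simp
      moreover have "w1 * (s - s') = w1 * of_int (- m)" using e(2) by (simp add: \<theta>1_def algebra_simps)
      then have "s - s' = of_int (- m)" using sizes by (simp only: mult_cancel_left) simp
      then have "s - s' \<in> \<int>" by (simp only: Ints_of_int)
      ultimately show "s - s' \<in> \<int> \<and> t - t' \<in> \<int>" by blast
    next
      assume st: "s - s' \<in> \<int> \<and> t - t' \<in> \<int>"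
      then obtain n :: int where n: "s - s' = of_int n" by (auto elim: Ints_cases)
      then have t': "w1 * s' = w1 * s + of_int (- n) * w1" by (simp add: algebra_simps)
      have "\<theta>2 t' = \<theta>2 t" "q2 t' = q2 t" using st osc(2)[of t t'] by auto
      moreover have "q1 s' = q1 s" unfolding q1_def G1_def t' periodic ..
      moreover have "\<theta>1 s' = \<theta>1 s + of_int (- n) * w1" unfolding \<theta>1_def by (rule t')
      ultimately show "rel ((\<theta>1 s, \<theta>2 t), (q1 s, q2 t)) ((\<theta>1 s', \<theta>2 t'), (q1 s', q2 t'))"
        using rel_shiftI[of "\<theta>1 s'" "\<theta>1 s" "- n" "\<theta>2 t'" "\<theta>2 t" 0] by simp
    qed
    fix a b p1 p2 :: real
    assume en: "p1\<^sup>2 = (f1 a - k1) * (f1 a - k2)" "p2\<^sup>2 = (f2 b - k1) * (k2 - f2 b)"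
      and S: "S ((a, b), (p1, p2)) > 0"
    \<comment> \<open>The offset \<open>w2 / 4\<close> yields a period cell starting at
      \<open>- w2 / 4\<close>; its second half is carried onto the first, centred at 0, by the
      flip.\<close>
    define m where "m = \<lfloor>(b + w2 / 4) / w2\<rfloor>"
    define b0 where "b0 = b + of_int (- m) * w2"
    have b0: "- (w2 / 4) \<le> b0" "b0 < 3 * w2 / 4"
      using floor_divide_lower[OF sizes(3), of "b + w2 / 4"] floor_divide_upper[OF sizes(3), of "b + w2 / 4"]
      by (auto simp: b0_def m_def algebra_simps)
    obtain z where z: "rel ((a, b), (p1, p2)) z" "- (w2 / 4) \<le> snd (fst z)" "snd (fst z) \<le> w2 / 4"
    proof (cases "b0 \<le> w2 / 4")
      case True
      have "rel ((a, b), (p1, p2)) ((a, b0), (p1, p2))"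
        by (rule rel_shiftI[of _ _ 0 _ _ "- m"]) (auto simp: b0_def)
      then show thesis using that[of "((a, b0), (p1, p2))"] b0 True by simp
    next
      case False
      have "rel ((a, b), (p1, p2)) ((- a, w2 / 2 - b0), (- p1, - p2))"
        by (rule rel_flipI[of _ _ 0 _ _ m]) (auto simp: b0_def algebra_simps)
      then show thesis using that[of "((- a, w2 / 2 - b0), (- p1, - p2))"] b0 False by simp
    qed
    obtain a' b' p1' p2' where z': "z = ((a', b'), (p1', p2'))" by (cases z) auto
    have f: "f1 a' = f1 a" "f2 b' = f2 b" "p1'\<^sup>2 = p1\<^sup>2" "p2'\<^sup>2 = p2\<^sup>2" using rel_f[OF z(1)] by (auto simp: z')
    have S': "cos (2 * pi * (b' / w2)) * p1' > 0" using S cos_rel[OF z(1)] by (simp add: S_def z')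
    have le: "\<bar>b' - 0\<bar> \<le> r"
      using out[of b'] z energy_bounds(2)[OF k1(2) en] by (force simp: z' f)
    then obtain t where t: "\<theta>2 t = b'" "q2 t = p2'" using osc(3)[OF le, of p2'] f en by auto
    have "cos (2 * pi * (b' / w2)) > 0" using le r by (intro cos_pos) auto
    then have "p1' > 0" using S' by (simp add: zero_less_mult_iff)
    moreover have "p1'\<^sup>2 = G1 a'" using f en by (simp add: G1_def)
    ultimately have "p1' = sqrt (G1 a')" by (metis abs_of_pos real_sqrt_abs)
    then have "\<theta>1 (a' / w1) = a'" "q1 (a' / w1) = p1'" using sizes by (auto simp: \<theta>1_def q1_def)
    then have "rel ((a, b), (p1, p2)) ((\<theta>1 (a' / w1), \<theta>2 t), (q1 (a' / w1), q2 t))"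
      using z(1) t by (simp add: z')
    then show "\<exists>s t. rel ((a, b), (p1, p2)) ((\<theta>1 s, \<theta>2 t), (q1 s, q2 t))" by blast
  qed
  show ?thesis
  proof (rule abel_integral_eq_0[OF radon_data_axioms _ osc(5)])
    fix G :: "real \<Rightarrow> real" assume G: "continuous_on UNIV G"
    show "integral {0..1} (\<lambda>s. G (\<theta>1 s) * e1 s) = 4 * (\<integral>x. indicator {0..w1 / 4} x *
        (if (f1 x - k1) * (f1 x - k2) > 0 then G x / sqrt ((f1 x - k1) * (f1 x - k2)) else 0) \<partial>lborel)"
      if "\<And>x. G (- x) = G x" "\<And>x. G (w1 / 2 - x) = G x"
      unfolding G1_def[symmetric] e1_def \<theta>1_def
      by (rule integral_rotation_orbit[OF sizes(2) cG1 G G1pos _ _ that]) (auto simp: G1_def even half)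
  qed
qed

end

section \<open>Injectivity\<close>

context classical_table
begin

lemma proj_memI:
  "y = shift T m n x \<or> y = shift T m n (sigma1 T x) \<or> y = shift T m n (sigma2 x) \<or>
    y = shift T m n (sigma1 T (sigma2 x)) \<Longrightarrow> y \<in> proj T x"
  unfolding proj_eq by auto

text \<open>For an involution that maps orbits into orbits, applying the inclusion twice gives the
  reverse inclusion.\<close>

lemma image_proj:
  assumes inv: "\<And>x. f (f x) = x"
    and sub: "\<And>m n x. f (shift T m n x) \<in> proj T (f x)" "\<And>m n x. f (shift T m n (sigma1 T x)) \<in> proj T (f x)"
      "\<And>m n x. f (shift T m n (sigma2 x)) \<in> proj T (f x)" "\<And>m n x. f (shift T m n (sigma1 T (sigma2 x))) \<in> proj T (f x)"
  shows "f ` proj T x = proj T (f x)"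
proof
  have mem: "f y \<in> proj T (f x)" if "y \<in> proj T x" for x y
    using that sub unfolding proj_eq[of x] by blast
  then show "f ` proj T x \<subseteq> proj T (f x)" by blast
  show "proj T (f x) \<subseteq> f ` proj T x"
  proof
    fix y assume "y \<in> proj T (f x)"
    then have "f y \<in> proj T x" using mem[of y "f x"] inv[of x] by simp
    then have "f (f y) \<in> f ` proj T x" by (rule imageI)
    then show "y \<in> f ` proj T x" by (simp only: inv)
  qed
qed

lemma image_reflections:
  "(\<lambda>(a, b, c). (- a, b, c)) ` proj T (a, b, c) = proj T (- a, b, c)"
  "(\<lambda>(a, b, c). (w1 / 2 - a, b, c)) ` proj T (a, b, c) = proj T (w1 / 2 - a, b, c)"
  "(\<lambda>(a, b, c). (a, - b, c)) ` proj T (a, b, c) = proj T (a, - b, c)"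
proof -
  have "(\<lambda>(a, b, c). (- a, b, c)) ` proj T (a, b, c) = proj T ((\<lambda>(a, b, c). (- a, b, c)) (a, b, c))"
  proof (rule image_proj)
    show "(\<lambda>(a, b, c). (- a, b, c)) (shift T m n x) \<in> proj T ((\<lambda>(a, b, c). (- a, b, c)) x)" for m n x
      by (rule proj_memI[of _ "- m" n]) (auto simp: shift_def sigma1_def sigma2_def split_beta algebra_simps)
    show "(\<lambda>(a, b, c). (- a, b, c)) (shift T m n (sigma1 T x)) \<in> proj T ((\<lambda>(a, b, c). (- a, b, c)) x)" for m n x
      by (rule proj_memI[of _ "- m" n]) (auto simp: shift_def sigma1_def sigma2_def split_beta algebra_simps)
    show "(\<lambda>(a, b, c). (- a, b, c)) (shift T m n (sigma2 x)) \<in> proj T ((\<lambda>(a, b, c). (- a, b, c)) x)" for m n x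
      by (rule proj_memI[of _ "- m" n]) (auto simp: shift_def sigma1_def sigma2_def split_beta algebra_simps)
    show "(\<lambda>(a, b, c). (- a, b, c)) (shift T m n (sigma1 T (sigma2 x))) \<in> proj T ((\<lambda>(a, b, c). (- a, b, c)) x)" for m n x
      by (rule proj_memI[of _ "- m" n]) (auto simp: shift_def sigma1_def sigma2_def split_beta algebra_simps)
  qed auto
  then show "(\<lambda>(a, b, c). (- a, b, c)) ` proj T (a, b, c) = proj T (- a, b, c)" by simp
  have "(\<lambda>(a, b, c). (w1 / 2 - a, b, c)) ` proj T (a, b, c) = proj T ((\<lambda>(a, b, c). (w1 / 2 - a, b, c)) (a, b, c))"
  proof (rule image_proj)
    show "(\<lambda>(a, b, c). (w1 / 2 - a, b, c)) (shift T m n x) \<in> proj T ((\<lambda>(a, b, c). (w1 / 2 - a, b, c)) x)" for m n x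
      by (rule proj_memI[of _ "- m" n]) (auto simp: shift_def sigma1_def sigma2_def split_beta algebra_simps)
    \<comment> \<open>Conjugating \<open>sigma1\<close> by the reflection in \<open>w1 / 4\<close>
      adds a full period: w1 / 2 + a - m w1 = -(w1 / 2 - a) + (1 - m) w1.\<close>
    show "(\<lambda>(a, b, c). (w1 / 2 - a, b, c)) (shift T m n (sigma1 T x)) \<in> proj T ((\<lambda>(a, b, c). (w1 / 2 - a, b, c)) x)" for m n x
      by (rule proj_memI[of _ "1 - m" n]) (auto simp: shift_def sigma1_def sigma2_def split_beta algebra_simps)
    show "(\<lambda>(a, b, c). (w1 / 2 - a, b, c)) (shift T m n (sigma2 x)) \<in> proj T ((\<lambda>(a, b, c). (w1 / 2 - a, b, c)) x)" for m n x
      by (rule proj_memI[of _ "- m" n]) (auto simp: shift_def sigma1_def sigma2_def split_beta algebra_simps)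
    show "(\<lambda>(a, b, c). (w1 / 2 - a, b, c)) (shift T m n (sigma1 T (sigma2 x))) \<in> proj T ((\<lambda>(a, b, c). (w1 / 2 - a, b, c)) x)" for m n x
      by (rule proj_memI[of _ "1 - m" n]) (auto simp: shift_def sigma1_def sigma2_def split_beta algebra_simps)
  qed auto
  then show "(\<lambda>(a, b, c). (w1 / 2 - a, b, c)) ` proj T (a, b, c) = proj T (w1 / 2 - a, b, c)" by simp
  have "(\<lambda>(a, b, c). (a, - b, c)) ` proj T (a, b, c) = proj T ((\<lambda>(a, b, c). (a, - b, c)) (a, b, c))"
  proof (rule image_proj)
    show "(\<lambda>(a, b, c). (a, - b, c)) (shift T m n x) \<in> proj T ((\<lambda>(a, b, c). (a, - b, c)) x)" for m n x
      by (rule proj_memI[of _ m "- n"]) (auto simp: shift_def sigma1_def sigma2_def split_beta algebra_simps)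
    \<comment> \<open>Here the extra period appears in \<theta>2: b - w2 / 2 - n w2 = w2 / 2 + b +
      (- n - 1) w2.\<close>
    show "(\<lambda>(a, b, c). (a, - b, c)) (shift T m n (sigma1 T x)) \<in> proj T ((\<lambda>(a, b, c). (a, - b, c)) x)" for m n x
      by (rule proj_memI[of _ m "- n - 1"]) (auto simp: shift_def sigma1_def sigma2_def split_beta algebra_simps)
    show "(\<lambda>(a, b, c). (a, - b, c)) (shift T m n (sigma2 x)) \<in> proj T ((\<lambda>(a, b, c). (a, - b, c)) x)" for m n x
      by (rule proj_memI[of _ m "- n"]) (auto simp: shift_def sigma1_def sigma2_def split_beta algebra_simps)
    show "(\<lambda>(a, b, c). (a, - b, c)) (shift T m n (sigma1 T (sigma2 x))) \<in> proj T ((\<lambda>(a, b, c). (a, - b, c)) x)" for m n x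
      by (rule proj_memI[of _ m "- n - 1"]) (auto simp: shift_def sigma1_def sigma2_def split_beta algebra_simps)
  qed auto
  then show "(\<lambda>(a, b, c). (a, - b, c)) ` proj T (a, b, c) = proj T (a, - b, c)" by simp
qed

lemma proj_sigma2: "proj T (sigma2 x) = proj T x"
proof -
  have "sigma2 (sigma2 x) = x" for x by (cases x) (simp add: sigma2_def)
  then show ?thesis unfolding proj_eq by auto
qed

lemma bdry_cases:
  assumes "x \<in> bdry T"
  obtains a b where "x = proj T (a, b, N)"
proof -
  obtain a b c where x: "x = proj T (a, b, c)" "\<bar>c\<bar> = N" using assms by (auto simp: bdry_def)
  then consider "c = N" | "c = - N" by linarith
  then show thesis
  proof cases
    case 2
    then have "x = proj T (sigma2 (a, b, c))" by (simp only: proj_sigma2 x)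
    then have "x = proj T (a, - b, N)" by (simp add: sigma2_def 2)
    then show thesis by (rule that)
  qed (use x that in auto)
qed

lemma continuous_on_bdry:
  assumes "continuous_map (subtopology (X_top T) (bdry T)) euclideanreal K"
  shows "continuous_on UNIV (\<lambda>x :: real \<times> real. K (proj T (fst x, snd x, N)))"
proof -
  have s: "(a, b, N) \<in> strip T" for a b using sizes by (simp add: strip_def)
  have top: "topspace (X_top T) = X_space T"
  proof
    have "openin (X_top T) (X_space T)"
      unfolding openin_X_top
    proof (intro conjI subset_refl)
      have "{x \<in> strip T. proj T x \<in> X_space T} = strip T" by (auto simp: X_space_def)
      then show "openin (top_of_set (strip T)) {x \<in> strip T. proj T x \<in> X_space T}" by simp
    qed
    then show "X_space T \<subseteq> topspace (X_top T)" by (rule openin_subset)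
    show "topspace (X_top T) \<subseteq> X_space T" using openin_topspace[of "X_top T"] unfolding openin_X_top by blast
  qed
  have "continuous_map euclidean (X_top T) (\<lambda>x :: real \<times> real. proj T (fst x, snd x, N))"
    unfolding continuous_map_def
  proof (intro conjI allI impI)
    show "(\<lambda>x :: real \<times> real. proj T (fst x, snd x, N)) \<in> topspace euclidean \<rightarrow> topspace (X_top T)"
      using s by (auto simp: top X_space_def)
    fix W assume "openin (X_top T) W"
    then obtain O' where O': "open O'" "{x \<in> strip T. proj T x \<in> W} = strip T \<inter> O'"
      unfolding openin_X_top openin_open by auto
    have "{x :: real \<times> real. proj T (fst x, snd x, N) \<in> W} = (\<lambda>x. (fst x, snd x, N)) -` O'"
      using O'(2) s by auto
    moreover have "open ((\<lambda>x :: real \<times> real. (fst x, snd x, N)) -` O')"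
      by (intro open_vimage[OF O'(1)] continuous_intros)
    ultimately show "openin euclidean {x \<in> topspace euclidean. proj T (fst x :: real, snd x :: real, N) \<in> W}"
      by simp
  qed
  then have "continuous_map euclidean (subtopology (X_top T) (bdry T)) (\<lambda>x :: real \<times> real. proj T (fst x, snd x, N))"
    by (auto simp: continuous_map_in_subtopology proj_bdry)
  from continuous_map_compose[OF this assms] show ?thesis by (simp add: o_def)
qed

lemma function_on_table_eq_0:
  fixes F :: "real \<Rightarrow> real \<Rightarrow> real"
  assumes F: "continuous_on UNIV (\<lambda>x. F (fst x) (snd x))" and F0: "\<And>a b. f1 a = f2 b \<Longrightarrow> F a b = 0"
    and abel: "\<And>k1 k2. nu3 T < k1 \<Longrightarrow> k1 < 0 \<Longrightarrow> 0 < k2 \<Longrightarrow> k2 < nu0 T \<Longrightarrow> k2 \<noteq> nu1 T \<Longrightarrow>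
      (\<integral>a. \<integral>b. indicator (cbox (0, 0) (w1 / 4, w2 / 4)) (a, b) * (F a b / sqrt ((f1 a - k1) * (f2 b - k1))) *
        abel_kernel (f1 a) (f2 b) k2 \<partial>lborel \<partial>lborel) = 0"
    and x: "0 \<le> a0" "a0 \<le> w1 / 4" "0 \<le> b0" "b0 \<le> w2 / 4"
  shows "F a0 b0 = 0"
proof -
  \<comment> \<open>The midpoint of ]\<open>nu3 T\<close>, 0[: shifts smaller than -k0 keep the
    parameter of the tori between \<open>nu3 T\<close> and 0, and since u and v are at most 1 / -k0
    they also stay inside the radius of convergence.\<close>
  define k0 where "k0 = nu3 T / 2"
  have k0: "k0 < 0" "nu3 T = 2 * k0" using ph3_N(3) by (auto simp: k0_def)
  define u v where "u x = 1 / (f1 (fst x) - k0)" and "v x = 1 / (f2 (snd x) - k0)" for x :: "real \<times> real"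
  have pos1: "f1 a - k > 0" if "k < 0" for a k using nu1_le_f1[of a] nu1_pos that by auto
  have pos2: "f2 b - k > 0" if "k < 0" for b k using f2_nonneg[of b] that by auto
  have cf: "continuous_on S (\<lambda>x :: real \<times> real. f1 (fst x))" "continuous_on S (\<lambda>x :: real \<times> real. f2 (snd x))" for S
    by (intro continuous_intros)+
  have ne: "f1 a - k0 \<noteq> 0" "f2 b - k0 \<noteq> 0" for a b using pos1[OF k0(1), of a] pos2[OF k0(1), of b] by auto
  have cu: "continuous_on S u" "continuous_on S v" for S
    unfolding u_def v_def using ne by (intro continuous_intros cf; simp)+
  have bound: "0 < u x" "u x \<le> 1 / - k0" "0 < v x" "v x \<le> 1 / - k0" for x
    using pos1[OF k0(1), of "fst x"] pos2[OF k0(1), of "snd x"] k0(1) nu1_le_f1[of "fst x"] nu1_pos f2_nonneg[of "snd x"]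
    by (auto simp: u_def v_def intro!: divide_left_mono mult_pos_neg simp: divide_simps)
  \<comment> \<open>Rewriting each of the two square roots in terms of u and v contributes a factor
    sqrt (u v).\<close>
  define G where "G x = F (fst x) (snd x) * u x * v x" for x
  have "G (a0, b0) = 0"
  proof (rule integral_products_eq_0_imp_eq_0[where \<eta> = "- k0" and u = u and v = v and a = "(0, 0)" and b = "(w1 / 4, w2 / 4)"])
    show "continuous_on (cbox (0, 0) (w1 / 4, w2 / 4)) G"
      unfolding G_def by (intro continuous_on_mult continuous_on_subset[OF F] cu) simp
    show "\<bar>s * u x\<bar> < 1 \<and> \<bar>s * v x\<bar> < 1" if "\<bar>s\<bar> < - k0" for s x
    proof -
      have "\<bar>s\<bar> * y < 1" if "0 < y" "y \<le> 1 / - k0" for y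
      proof -
        have "\<bar>s\<bar> * y < - k0 * y" using \<open>\<bar>s\<bar> < - k0\<close> that by (intro mult_strict_right_mono)
        also have "\<dots> \<le> - k0 * (1 / - k0)" using k0(1) that by (intro mult_left_mono) auto
        also have "\<dots> = 1" using k0(1) by simp
        finally show ?thesis .
      qed
      then show ?thesis using bound[of x] by (simp add: abs_mult)
    qed
    show "integral (cbox (0, 0) (w1 / 4, w2 / 4)) (\<lambda>x. G x / sqrt ((1 - s * u x) * (1 - s * v x))
        / sqrt ((1 - t * u x) * (1 - t * v x))) = 0" if s: "\<bar>s\<bar> < - k0" and t: "\<bar>t\<bar> < - k0" for s t
    proof -
      define k where "k = k0 + s"
      define \<tau> where "\<tau> = k0 + t"
      have k: "nu3 T < k" "k < 0" "\<tau> < 0" using s t k0 by (auto simp: k_def \<tau>_def)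
      have "integral (cbox (0, 0) (w1 / 4, w2 / 4)) (\<lambda>x. F (fst x) (snd x) / sqrt ((f1 (fst x) - k) * (f2 (snd x) - k))
          / sqrt ((f1 (fst x) - \<tau>) * (f2 (snd x) - \<tau>))) = 0"
      proof (rule integral_abel_kernel_eq_0[where lo = 0 and hi = "nu0 T" and N = "{nu1 T}"])
        have "f1 a - k \<noteq> 0" "f2 b - k \<noteq> 0" for a b using pos1[OF k(2), of a] pos2[OF k(2), of b] by auto
        then show "continuous_on UNIV (\<lambda>x. F (fst x) (snd x) / sqrt ((f1 (fst x) - k) * (f2 (snd x) - k)))"
          by (intro continuous_intros F cf) auto
        show "continuous_on UNIV (\<lambda>x :: real \<times> real. f1 (fst x))" "continuous_on UNIV (\<lambda>x :: real \<times> real. f2 (snd x))"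
          by (rule cf)+
        show "f2 (snd x) \<le> f1 (fst x)" "0 \<le> f2 (snd x)" "f1 (fst x) \<le> nu0 T" for x :: "real \<times> real"
          by (rule f2_le_f1 f2_nonneg f_values)+
        show "F (fst x) (snd x) / sqrt ((f1 (fst x) - k) * (f2 (snd x) - k)) = 0" if "f2 (snd x) = f1 (fst x)" for x
          using F0[of "fst x" "snd x"] that by simp
        show "\<tau> < 0" by (rule k)
        show "(\<integral>s. \<integral>t. indicator (cbox (0, 0) (w1 / 4, w2 / 4)) (s, t) *
            (F (fst (s, t)) (snd (s, t)) / sqrt ((f1 (fst (s, t)) - k) * (f2 (snd (s, t)) - k))) *
            abel_kernel (f1 (fst (s, t))) (f2 (snd (s, t))) k' \<partial>lborel \<partial>lborel) = 0"
          if "0 < k'" "k' < nu0 T" "k' \<notin> {nu1 T}" for k'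
          using abel[OF k(1,2) that(1,2)] that(3) by simp
      qed simp
      also have "(\<lambda>x. F (fst x) (snd x) / sqrt ((f1 (fst x) - k) * (f2 (snd x) - k))
          / sqrt ((f1 (fst x) - \<tau>) * (f2 (snd x) - \<tau>))) =
        (\<lambda>x. G x / sqrt ((1 - s * u x) * (1 - s * v x)) / sqrt ((1 - t * u x) * (1 - t * v x)))"
      proof
        fix x :: "real \<times> real"
        have uv: "u x > 0" "v x > 0" using bound[of x] by auto
        have e: "f1 (fst x) - (k0 + r) = (1 - r * u x) / u x" "f2 (snd x) - (k0 + r) = (1 - r * v x) / v x" for r
          using ne(1)[of "fst x"] ne(2)[of "snd x"] by (auto simp: u_def v_def field_simps)
        have q: "sqrt ((1 - r * u x) / u x * ((1 - r * v x) / v x)) = sqrt ((1 - r * u x) * (1 - r * v x)) / sqrt (u x * v x)" for r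
          by (simp add: real_sqrt_divide real_sqrt_mult)
        have "sqrt (u x * v x) * sqrt (u x * v x) = u x * v x" using uv by simp
        moreover have "y / (p / r) / (q / r) = y * (r * r) / p / q" for y p q r :: real by simp
        ultimately show "F (fst x) (snd x) / sqrt ((f1 (fst x) - k) * (f2 (snd x) - k))
          / sqrt ((f1 (fst x) - \<tau>) * (f2 (snd x) - \<tau>)) =
          G x / sqrt ((1 - s * u x) * (1 - s * v x)) / sqrt ((1 - t * u x) * (1 - t * v x))"
          unfolding k_def \<tau>_def e q G_def by (simp only: mult.assoc)
      qed
      finally show ?thesis .
    qed
    show "x = y" if xy: "x \<in> cbox (0, 0) (w1 / 4, w2 / 4)" "y \<in> cbox (0, 0) (w1 / 4, w2 / 4)"
      "u x + v x = u y + v y" "u x * v x = u y * v y" for x y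
    proof -
      \<comment> \<open>The symmetric functions determine u and v only up to order; the order is
        fixed by \<phi>2 \<le> \<phi>1.\<close>
      have uv: "u x \<le> v x" for x
        unfolding u_def v_def using f2_le_f1[of "snd x" "fst x"] pos1[OF k0(1), of "fst x"] pos2[OF k0(1), of "snd x"]
        by (intro divide_left_mono) auto
      have "(v x - u x)\<^sup>2 = (u x + v x)\<^sup>2 - 4 * (u x * v x)" by (simp add: power2_eq_square algebra_simps)
      also have "\<dots> = (v y - u y)\<^sup>2" unfolding that(3,4) by (simp add: power2_eq_square algebra_simps)
      finally have "v x - u x = v y - u y" using uv[of x] uv[of y] by (simp add: power2_eq_iff_nonneg)
      then have "u x = u y" "v x = v y" using that(3) by linarith+
      then have f: "f1 (fst x) = f1 (fst y)" "f2 (snd x) = f2 (snd y)"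
        using ne by (auto simp: u_def v_def)
      have r: "0 \<le> fst x" "fst x \<le> w1 / 4" "0 \<le> snd x" "snd x \<le> w2 / 4"
        "0 \<le> fst y" "fst y \<le> w1 / 4" "0 \<le> snd y" "snd y \<le> w2 / 4"
        using xy(1,2) by (cases x; cases y; auto simp: cbox_Pair_eq)+
      have "fst x = fst y"
        using f1_mono[of "fst x" "fst y"] f1_mono[of "fst y" "fst x"] f(1) r by (cases "fst x" "fst y" rule: linorder_cases) auto
      moreover have "snd x = snd y"
        using f2_mono[of "snd x" "snd y"] f2_mono[of "snd y" "snd x"] f(2) r by (cases "snd x" "snd y" rule: linorder_cases) auto
      ultimately show ?thesis by (rule prod_eqI)
    qed
    show "box (0, 0) (w1 / 4, w2 / 4) \<noteq> {}"
      using sizes by (auto simp: box_ne_empty Basis_prod_def)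
    show "(a0, b0) \<in> cbox (0, 0) (w1 / 4, w2 / 4)" using x by (auto simp: cbox_Pair_eq)
    show "- k0 > 0" using k0 by simp
  qed (rule cu)+
  then show ?thesis using bound[of "(a0, b0)"] by (simp add: G_def)
qed

lemma radon_transform_injective:
  fixes K :: "pt set \<Rightarrow> real" and \<mu> :: "brep set \<Rightarrow> real"
  assumes \<mu>: "(\<forall>\<xi>\<in>BGamma T. \<mu> \<xi> = 1) \<or>
         (\<forall>\<xi>\<in>BGamma T. \<mu> \<xi> = inverse (normal_pairing T (pi_plus T \<xi>)))"
    and cont: "continuous_map (subtopology (X_top T) (bdry T)) euclideanreal K"
    and inv: "\<forall>h\<in>GX T. \<forall>x\<in>bdry T. K (h x) = K x"
    and K: "\<And>\<Lambda> r. liouville_torus T \<Lambda> \<Longrightarrow> \<Lambda> \<subseteq> U1 T \<union> U2 T \<Longrightarrow>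
           has_radon_transform T K \<mu> \<Lambda> r \<Longrightarrow> r = 0"
  shows "\<forall>x\<in>bdry T. K x = 0"
proof -
  define k where "k a b = K (proj T (a, b, N))" for a b
  have ck: "continuous_on UNIV (\<lambda>x. k (fst x) (snd x))"
    unfolding k_def by (rule continuous_on_bdry[OF cont])
  have k_sym: "k (- a) b = k a b" "k (w1 / 2 - a) b = k a b" "k a (- b) = k a b" for a b
  proof -
    have g: "K (h (proj T (a, b, N))) = K (proj T (a, b, N))" if "h \<circ> id \<in> GX T" for h
      using inv that proj_bdry[of a b] by (metis comp_apply id_apply)
    show "k (- a) b = k a b" "k (w1 / 2 - a) b = k a b" "k a (- b) = k a b"
      using g[OF GX.intros(2)[OF GX.intros(1)]] g[OF GX.intros(3)[OF GX.intros(1)]] g[OF GX.intros(4)[OF GX.intros(1)]]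
      unfolding k_def image_reflections by auto
  qed
  \<comment> \<open>This reflection is not among the generators of \<open>GX T\<close>; it is the
    reflection of \<theta>1 composed with the deck transformation \<open>sigma1\<close>.\<close>
  have k_flip: "k a (w2 / 2 - b) = k a b" if "f1 a \<noteq> f2 b" for a b
  proof -
    have "rel ((a, b), (0, 0)) ((- a, w2 / 2 - b), (- 0, - 0))" by (rule rel_flipI[of _ _ 0 _ _ 0]) auto
    then have "bdry_covec a b 0 0 = bdry_covec (- a) (w2 / 2 - b) 0 0"
      using bdry_class_eq_iff[of "((a, b), (0, 0))" "((- a, w2 / 2 - b), (0, 0))"] that by (simp add: regular_iff)
    then have "foot (bdry_covec a b 0 0) = foot (bdry_covec (- a) (w2 / 2 - b) 0 0)" by simp
    then have "k a b = k (- a) (w2 / 2 - b)" unfolding foot_bdry_covec by (simp add: k_def)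
    then show ?thesis by (simp add: k_sym)
  qed
  obtain W where W: "((\<forall>\<xi>\<in>BGamma T. \<mu> \<xi> = 1) \<and> W = (\<lambda>a b. 1)) \<or>
      ((\<forall>\<xi>\<in>BGamma T. \<mu> \<xi> = inverse (normal_pairing T (pi_plus T \<xi>))) \<and> W = (\<lambda>a b. sqrt (P3 a b)))"
    using \<mu> by blast
  have cW: "continuous_on UNIV (\<lambda>x. W (fst x) (snd x))"
    using W by (auto simp: P3_def intro!: continuous_intros)
  have W_pos: "W a b > 0" for a b using W P_pos(1) by auto
  have W_sym: "W (- a) b = W a b" "W (w1 / 2 - a) b = W a b" "W a (- b) = W a b" "W a (w2 / 2 - b) = W a b" for a b
    using W by (auto simp: P3_def even half)
  define F where "F a b = k a b * W a b * (f1 a - f2 b)" for a b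
  have F: "continuous_on UNIV (\<lambda>x. F (fst x) (snd x))"
    unfolding F_def by (intro continuous_intros ck cW)
  \<comment> \<open>Where \<phi>1 = \<phi>2, so that \<open>k_flip\<close> does not apply, both
    sides vanish by the last factor of \<open>F\<close>.\<close>
  have F_sym: "F (- a) b = F a b" "F (w1 / 2 - a) b = F a b" "F a (- b) = F a b" "F a (w2 / 2 - b) = F a b" for a b
    using k_flip[of a b] by (auto simp: F_def k_sym W_sym even half)
  have rect: "F a b = 0" if "0 \<le> a" "a \<le> w1 / 4" "0 \<le> b" "b \<le> w2 / 4" for a b
  proof (rule function_on_table_eq_0[OF F _ _ that])
    show "F a b = 0" if "f1 a = f2 b" for a b using that by (simp add: F_def)
    interpret radon_data T K \<mu> W F
      by standard (fact W, fact K, auto simp: F_def k_def F_sym[unfolded F_def k_def] intro: F[unfolded F_def k_def])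
    fix k1 k2 assume k: "nu3 T < k1" "k1 < 0" "0 < k2" "k2 < nu0 T" "k2 \<noteq> nu1 T"
    show "(\<integral>a. \<integral>b. indicator (cbox (0, 0) (w1 / 4, w2 / 4)) (a, b) * (F a b / sqrt ((f1 a - k1) * (f2 b - k1))) *
        abel_kernel (f1 a) (f2 b) k2 \<partial>lborel \<partial>lborel) = 0"
      unfolding abel_integral_def[symmetric]
      using abel_integral_eq_0_U1[OF k(1-3)] abel_integral_eq_0_U2[OF k(1,2) _ k(4)] k(5) by force
  qed
  have F_zero: "F a b = 0" for a b
  proof -
    obtain a' where a': "0 \<le> a'" "a' \<le> w1 / 4"
      "\<forall>H :: real \<Rightarrow> real. (\<forall>t. H (- t) = H t) \<and> (\<forall>t. H (w1 / 2 - t) = H t) \<longrightarrow> H a' = H a"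
      by (rule symmetric_reduce[OF sizes(2), where x = a])
    obtain b' where b': "0 \<le> b'" "b' \<le> w2 / 4"
      "\<forall>H :: real \<Rightarrow> real. (\<forall>t. H (- t) = H t) \<and> (\<forall>t. H (w2 / 2 - t) = H t) \<longrightarrow> H b' = H b"
      by (rule symmetric_reduce[OF sizes(3), where x = b])
    have "F a' b' = F a b'" using a'(3)[rule_format, of "\<lambda>t. F t b'"] F_sym by simp
    moreover have "F a b' = F a b" using b'(3)[rule_format, of "\<lambda>t. F a t"] F_sym by simp
    ultimately show ?thesis using rect[OF a'(1,2) b'(1,2)] by simp
  qed
  have k_reg: "k a b = 0" if "f1 a \<noteq> f2 b" for a b
    using F_zero[of a b] that W_pos[of a b] by (simp add: F_def)
  have "k a b = 0" for a b
  proof (cases "f1 a = f2 b")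
    case True
    then obtain m :: int where m: "a = of_int m * (w1 / 2)" unfolding f1_eq_f2 f1_eq_nu1 by auto
    \<comment> \<open>Along the \<theta>1-line the branch points are isolated with spacing
      \<open>w1 / 2\<close>, so K is zero at all nearby points of the line and, by continuity, at
      the branch point.\<close>
    have ca: "isCont (\<lambda>t. k t b) a"
    proof -
      have "continuous_on UNIV (\<lambda>t. k (fst (t, b)) (snd (t, b)))"
        by (rule continuous_on_compose2[OF ck]) (auto intro!: continuous_intros)
      then show ?thesis by (simp add: continuous_on_eq_continuous_at)
    qed
    have "eventually (\<lambda>t. k t b = 0) (at a)"
      unfolding eventually_at
    proof (intro exI[of _ "w1 / 2"] conjI ballI impI)
      fix t assume t: "t \<noteq> a \<and> dist t a < w1 / 2"
      have "f1 t \<noteq> f2 b"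
      proof
        assume "f1 t = f2 b"
        then obtain m' :: int where m': "t = of_int m' * (w1 / 2)" unfolding f1_eq_f2 f1_eq_nu1 by auto
        have "of_int (m' - m) * (w1 / 2) = t - a" by (simp add: m m' left_diff_distrib)
        then have "\<bar>of_int (m' - m) * (w1 / 2)\<bar> < w1 / 2" using t by (simp only: dist_real_def)
        then have "m' - m = 0" by (rule small_multiple) (use sizes in simp)
        then show False using t m m' by simp
      qed
      then show "k t b = 0" by (rule k_reg)
    qed (use sizes in simp)
    then have "((\<lambda>t. k t b) \<longlongrightarrow> 0) (at a)" by (rule tendsto_eventually)
    moreover have "((\<lambda>t. k t b) \<longlongrightarrow> k a b) (at a)" using ca by (simp add: isCont_def)
    ultimately show ?thesis using tendsto_unique[of "at a"] by fastforce
  qed (rule k_reg)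
  then show ?thesis unfolding k_def using bdry_cases by metis
qed

end

theorem theorem4p1:
  fixes T :: table
    and K :: "pt set \<Rightarrow> real"
    and \<mu> :: "brep set \<Rightarrow> real"
  assumes "classical_liouville_table T"
    and "billiard_map_defined T"
    and "(\<forall>\<xi>\<in>BGamma T. \<mu> \<xi> = 1) \<or>
         (\<forall>\<xi>\<in>BGamma T. \<mu> \<xi> = inverse (normal_pairing T (pi_plus T \<xi>)))"
    and "continuous_map (subtopology (X_top T) (bdry T)) euclideanreal K"
    and "\<forall>h\<in>GX T. \<forall>x\<in>bdry T. K (h x) = K x"
    and "\<And>\<Lambda> r. liouville_torus T \<Lambda> \<Longrightarrow> \<Lambda> \<subseteq> U1 T \<union> U2 T \<Longrightarrow>
           has_radon_transform T K \<mu> \<Lambda> r \<Longrightarrow> r = 0"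
  shows "\<forall>x\<in>bdry T. K x = 0"
proof -
  interpret classical_table T by standard (rule assms(1))
  show ?thesis by (rule radon_transform_injective[OF assms(3-6)])
qed

end
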